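(* $$\lim_{X\to\infty}\frac{\sum_{0<n<X,\ n \text{ squarefree}} \#\mathcal{F}^{0,\mathrm{sol}}_{4n^2}}{\sum_{0<n<X,\ n\text{ squarefree}} \#\mathcal{F}^{0,\mathrm{ls}}_{4n^2}} = 1.$$ Equivalently: when the locally soluble forms in $\bigcup_{n\ge1 \text{ squarefree}}\mathcal{F}^0_{4n^2}$ are ordered by the Bhargava–Ho height, $100\%$ of them are soluble.
   Context: For integers $B,M$, $W^B_M(\mathbb{Z})$ is the set of binary quartic forms $ax^4+Bx^2y^2+cy^4$ with $a,c\in\mathbb{Z}$, $ac=M$, and $\mathcal{F}^B_M=\{ax^4+Bx^2y^2+cy^4\in W^B_M(\mathbb{Z}): 0\le\operatorname{ord}_pa\le1 \text{ for all primes } p\}$. A form $f$ is locally soluble if for every place $v$ of $\mathbb{Q}$ there are $x,y,z\in\mathbb{Q}_v$, $(x,y)\ne(0,0)$, with $z^2=f(x,y)$; it is soluble if such $x,y,z$ exist in $\mathbb{Q}$. $\mathcal{F}^{B,\mathrm{ls}}_M$ and $\mathcal{F}^{B,\mathrm{sol}}_M$ denote the locally soluble and soluble elements of $\mathcal{F}^B_M$. The Bhargava–Ho height of $ax^4+Bx^2y^2+cy^4$ is $\max\{B^2,|ac|\}$. *)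

theory Defs
  imports "HOL-Analysis.Analysis" "HOL-Computational_Algebra.Computational_Algebra"
begin

definition quartic_eval :: "int \<Rightarrow> int \<Rightarrow> int \<Rightarrow> 'a::comm_ring_1 \<Rightarrow> 'a \<Rightarrow> 'a" where
  "quartic_eval a B c x y = of_int a * x ^ 4 + of_int B * x ^ 2 * y ^ 2 + of_int c * y ^ 4"

text \<open>p-adic integers, as the inverse limit of the rings Z/p^k Z: compatible
sequences of residues x k in {0..<p^k}.\<close>

definition padic_int :: "int \<Rightarrow> (nat \<Rightarrow> int) \<Rightarrow> bool" where
  "padic_int p x \<longleftrightarrow> (\<forall>k. 0 \<le> x k \<and> x k < p ^ k \<and> x (Suc k) mod p ^ k = x k)"

text \<open>Solubility over Q_p.  Every element of Q_p = Z_p[1/p] is u / p^m with u in Z_p,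
and any triple can be written with a common denominator p^m.  For x = x'/p^m,
y = y'/p^m, z = z'/p^m the equation z^2 = f(x,y) in Q_p is equivalent to
p^(2m) z'^2 = f(x',y') in Z_p, i.e. to the congruence modulo p^k of the components
for every k; and (x,y) \<noteq> (0,0) iff (x',y') \<noteq> (0,0) in Z_p.\<close>

definition soluble_Qp :: "int \<Rightarrow> int \<Rightarrow> int \<Rightarrow> int \<Rightarrow> bool" where
  "soluble_Qp p a B c \<longleftrightarrow>
     (\<exists>m::nat. \<exists>x y z. padic_int p x \<and> padic_int p y \<and> padic_int p z \<and>
        (x \<noteq> (\<lambda>_. 0) \<or> y \<noteq> (\<lambda>_. 0)) \<and>
        (\<forall>k. (p ^ (2 * m) * (z k) ^ 2) mod p ^ k = (quartic_eval a B c (x k) (y k)) mod p ^ k))"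

definition soluble_R :: "int \<Rightarrow> int \<Rightarrow> int \<Rightarrow> bool" where
  "soluble_R a B c \<longleftrightarrow>
     (\<exists>x y z :: real. (x, y) \<noteq> (0, 0) \<and> z ^ 2 = quartic_eval a B c x y)"

definition soluble_Q :: "int \<Rightarrow> int \<Rightarrow> int \<Rightarrow> bool" where
  "soluble_Q a B c \<longleftrightarrow>
     (\<exists>x y z :: rat. (x, y) \<noteq> (0, 0) \<and> z ^ 2 = quartic_eval a B c x y)"

definition locally_soluble :: "int \<Rightarrow> int \<Rightarrow> int \<Rightarrow> bool" where
  "locally_soluble a B c \<longleftrightarrow> soluble_R a B c \<and> (\<forall>p::int. prime p \<longrightarrow> soluble_Qp p a B c)"

text \<open>The family F^B_M, with the form a x^4 + B x^2 y^2 + c y^4 identified with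
the pair (a, c) (B is fixed).\<close>

definition F_fam :: "int \<Rightarrow> int \<Rightarrow> (int \<times> int) set" where
  "F_fam B M = {(a, c). a * c = M \<and> (\<forall>p::int. prime p \<longrightarrow> multiplicity p a \<le> 1)}"

definition F_ls :: "int \<Rightarrow> int \<Rightarrow> (int \<times> int) set" where
  "F_ls B M = {(a, c) \<in> F_fam B M. locally_soluble a B c}"

definition F_sol :: "int \<Rightarrow> int \<Rightarrow> (int \<times> int) set" where
  "F_sol B M = {(a, c) \<in> F_fam B M. soluble_Q a B c}"

end

(*
  A form a x^4 + c y^4 with a c = 4 n^2 and a = 1 is soluble, so it suffices to show that only o(X) pairs
  (n, a) with a <> 1 are locally soluble.  Up to powers of 2, write a = d and n = d e.  Local solubility
  forces all p | d to be 1 modulo 4, e to be a square modulo all p | d, and d to be a square modulo all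
  p | e.  If d <= (log X)^A, then e avoids about half of the primes; as the sum of (d/n)/n over n <= y is
  O(log d), this saves a power of log X, uniformly enough in d to sum over d.  If e <= (log X)^A, the same
  argument applies to d, which avoids the primes that are 3 modulo 4.  The remaining part of the hyperbola
  is covered by dyadic boxes, where the conditions are expanded into a sum over d = d1 d2, e = e1 e2 of
  (e2/d1) (e1/d2), divided by the number of divisors of d e.  The part with d1, e2 or d2, e1 both large is
  small by a bilinear estimate for Jacobi symbols; in the rest d1, e1 or d2, e2 are both small, and the
  weights alone save a power of log X.
*)
theory Submission
  imports Defs "HOL-Number_Theory.Number_Theory" "HOL-Real_Asymp.Real_Asymp"
begin

section \<open>Chebyshev's bound and mean values of multiplicative functions\<close>

text \<open>Without local conditions there are about N ln N pairs (d, e) with d e \<le> N, while the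
  soluble forms with a = 1 already contribute order N; so more than a full logarithm has to be
  saved. On average a prime of n may enter d with weight 1/4 (it must be 1 modulo 4 and satisfy a
  symbol condition) or e with weight 1/2, which suggests a count of order N (ln N)^(-1/4). The
  bounds reach this up to powers of ln ln N. The margin is small: symbols are estimated trivially
  only when their small factors are at most a fixed power of ln N, so that summing over these
  factors costs powers of ln ln N only. Upper bounds suffice throughout, so Chebyshev's estimate and
  L(1, chi) = O(ln q) replace all information on primes in progressions; for q up to a power of ln N
  the loss ln q is only of size ln ln N.\<close>

lemma binomial_middle_le: "(2 * n + 1) choose n \<le> 4 ^ n"
proof -
  have "(\<Sum>k\<in>{n, n+1}. (2*n+1) choose k) \<le> (\<Sum>k\<le>2*n+1. (2*n+1) choose k)"
    by (rule sum_mono2) auto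
  also have "\<dots> = 2 * 4 ^ n"
    unfolding choose_row_sum by (simp add: power_mult)
  finally have "((2*n+1) choose n) + ((2*n+1) choose (n+1)) \<le> 2 * 4 ^ n" by simp
  moreover have "(2*n+1) choose (n+1) = (2*n+1) choose n"
    using binomial_symmetric[of "n+1" "2*n+1"] by simp
  ultimately show ?thesis by linarith
qed

lemma prod_primes_dvd:
  fixes m :: nat
  assumes "finite A" "\<And>p. p \<in> A \<Longrightarrow> prime p" "\<And>p. p \<in> A \<Longrightarrow> p dvd m"
  shows "\<Prod>A dvd m"
  using assms
proof (induction A rule: finite_induct)
  case (insert p A)
  have "coprime p (\<Prod>A)"
    by (rule prod_coprime_right) (use insert primes_coprime in \<open>metis insertCI\<close>)
  then show ?case using insert by (auto intro: divides_mult)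
qed simp

text \<open>These primes divide \<open>fact (2 * n + 1)\<close> but neither \<open>fact n\<close>
  nor \<open>fact (n + 1)\<close>, so all of them survive in the middle binomial
  coefficient.\<close>

lemma prod_primes_interval_le:
  "\<Prod>{p. prime p \<and> n + 1 < p \<and> p \<le> 2 * n + 1} \<le> 4 ^ n"
proof -
  have "\<Prod>{p. prime p \<and> n + 1 < p \<and> p \<le> 2 * n + 1} dvd ((2 * n + 1) choose n)"
  proof (rule prod_primes_dvd)
    fix p assume p: "p \<in> {p. prime p \<and> n + 1 < p \<and> p \<le> 2 * n + 1}"
    have "fact n * fact (2*n+1-n) * ((2*n+1) choose n) = (fact (2*n+1) :: nat)"
      by (rule binomial_fact_lemma) simp
    moreover have "p dvd fact (2*n+1)" using p by (subst prime_dvd_fact_iff) auto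
    moreover have "\<not> p dvd fact n" "\<not> p dvd fact (2*n+1-n)"
      using p by (subst prime_dvd_fact_iff; auto)+
    ultimately show "p dvd ((2 * n + 1) choose n)"
      using p by (metis (no_types, lifting) mem_Collect_eq prime_dvd_mult_iff)
  qed auto
  then have "\<Prod>{p. prime p \<and> n + 1 < p \<and> p \<le> 2 * n + 1} \<le> ((2 * n + 1) choose n)"
    by (rule dvd_imp_le) simp
  then show ?thesis using binomial_middle_le[of n] by linarith
qed

definition chebyshev_theta :: "nat \<Rightarrow> real" where
  "chebyshev_theta n = (\<Sum>p | prime p \<and> p \<le> n. ln (real p))"

text \<open>Induction of Erdos: for odd \<open>n = 2 * k + 1\<close> the primes up to
  \<open>k + 1\<close> are covered by the induction hypothesis and the others by the binomial
  coefficient; an even \<open>n > 2\<close> is not prime and adds no factor.\<close>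

lemma primorial_le: "\<Prod>{p::nat. prime p \<and> p \<le> n} \<le> 4 ^ n"
proof (induction n rule: less_induct)
  case (less n)
  consider "n \<le> 1" | "n = 2" | k where "n = 2 * k + 1" "k \<ge> 1" | k where "n = 2 * k" "k \<ge> 2"
  proof (cases "even n")
    case True then obtain k where "n = 2 * k" by (elim evenE)
    then show ?thesis using that(1,2) that(4)[of k] by linarith
  next
    case False then obtain k where "n = 2 * k + 1" by (elim oddE)
    then show ?thesis using that(1) that(3)[of k] by linarith
  qed
  then show ?case
  proof cases
    case 1
    then have "{p::nat. prime p \<and> p \<le> n} = {}" by (auto dest: prime_ge_2_nat)
    then show ?thesis by (simp only: prod.empty) simp
  next
    case 2
    then have "{p::nat. prime p \<and> p \<le> n} = {2}" by (auto dest: prime_ge_2_nat)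
    then show ?thesis unfolding 2 by (simp only: prod.insert) simp
  next
    case (3 k)
    have "{p::nat. prime p \<and> p \<le> n} = {p. prime p \<and> p \<le> k + 1} \<union> {p. prime p \<and> k + 1 < p \<and> p \<le> 2 * k + 1}"
      using 3 by auto
    then have "\<Prod>{p::nat. prime p \<and> p \<le> n} = \<Prod>{p. prime p \<and> p \<le> k + 1} * \<Prod>{p. prime p \<and> k + 1 < p \<and> p \<le> 2 * k + 1}"
      by (simp add: prod.union_disjoint Int_def)
    also have "\<dots> \<le> 4 ^ (k + 1) * 4 ^ k"
      using less[of "k+1"] 3 prod_primes_interval_le[of k] by (intro mult_mono) auto
    also have "\<dots> = 4 ^ n" using 3 by (simp add: power_add mult_2)
    finally show ?thesis .
  next
    case (4 k)
    have "\<not> prime n" using 4 prime_product[of 2 k] by auto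
    then have "prime p \<and> p \<le> n \<longleftrightarrow> prime p \<and> p \<le> n - 1" for p
      using 4 by (cases "p = n") auto
    then have "{p::nat. prime p \<and> p \<le> n} = {p. prime p \<and> p \<le> n - 1}"
      by blast
    then have "\<Prod>{p::nat. prime p \<and> p \<le> n} \<le> 4 ^ (n - 1)" using less[of "n-1"] 4 by simp
    also have "\<dots> \<le> 4 ^ n" by (rule power_increasing) auto
    finally show ?thesis .
  qed
qed

lemma chebyshev_theta_le: "chebyshev_theta n \<le> 2 * real n"
proof -
  have "chebyshev_theta n = ln (\<Prod>p | prime p \<and> p \<le> n. real p)"
    unfolding chebyshev_theta_def
    by (subst ln_prod) (auto simp: prime_gt_0_nat)
  also have "(\<Prod>p | prime p \<and> p \<le> n. real p) = real (\<Prod>{p::nat. prime p \<and> p \<le> n})"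
    by simp
  also have "ln \<dots> \<le> ln (real (4 ^ n))"
    using primorial_le[of n]
    by (subst ln_le_cancel_iff) (auto simp del: of_nat_power of_nat_prod intro!: prod_pos prime_gt_0_nat)
  also have "\<dots> = real n * ln 4" by (simp add: ln_realpow)
  finally have "chebyshev_theta n \<le> real n * ln 4" .
  moreover have "ln (4::real) \<le> 2"
    using ln_2_less_1 ln_realpow[of 2 2] by simp
  ultimately show ?thesis using mult_left_mono[of "ln 4" 2 "real n"] by linarith
qed

section \<open>Mean values from logarithmic means\<close>

lemma sum_ln_prime_divisors:
  fixes n :: nat assumes "squarefree n" "n > 0"
  shows "(\<Sum>p | prime p \<and> p dvd n. ln (real p)) = ln (real n)"
proof -
  have "(\<Prod>p\<in>prime_factors n. real p) = real (\<Prod>p\<in>prime_factors n. p ^ multiplicity p n)"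
    unfolding of_nat_prod
    by (rule prod.cong) (use assms in \<open>auto simp: squarefree_factorial_semiring'\<close>)
  also have "(\<Prod>p\<in>prime_factors n. p ^ multiplicity p n) = n"
    using assms by (simp add: prod_prime_factors)
  finally have "ln (real n) = ln (\<Prod>p\<in>prime_factors n. real p)" by (rule arg_cong[OF sym])
  also have "\<dots> = (\<Sum>p\<in>prime_factors n. ln (real p))"
    by (subst ln_prod) (auto dest: in_prime_factors_imp_prime prime_gt_0_nat)
  also have "prime_factors n = {p. prime p \<and> p dvd n}"
    using assms by (auto simp: prime_factors_dvd)
  finally show ?thesis by simp
qed

lemma sum_inverse_le: "n \<ge> 1 \<Longrightarrow> (\<Sum>k=1..n. 1 / real k) \<le> 1 + ln (real n)"
  using euler_mascheroni_sequence_decreasing[of 1 n]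
  by (simp add: harm_def inverse_eq_divide)

text \<open>Write \<open>ln N = ln (N / n) + ln n\<close> in each term of the sum and expand \<open>ln n\<close> over the primes
  dividing \<open>n\<close>.\<close>
lemma sum_submultiplicative_le:
  fixes f :: "nat \<Rightarrow> real"
  assumes nonneg: "\<And>n. f n \<ge> 0" and supp: "\<And>n. f n \<noteq> 0 \<Longrightarrow> squarefree n"
    and sub: "\<And>m p. prime p \<Longrightarrow> f (m * p) \<le> f m" and N: "N \<ge> 2"
  shows "(\<Sum>n=1..N. f n) \<le> 3 * real N / ln (real N) * (\<Sum>m=1..N. f m / real m)"
proof -
  let ?S = "\<Sum>m=1..N. f m / real m"
  have lnN: "ln (real N) > 0" using N by simp
  have split: "f n * ln (real N) \<le> f n * (real N / real n) + f n * ln (real n)" if "n \<in> {1..N}" for n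
  proof -
    have "ln (real N) = ln (real N / real n) + ln (real n)"
      using that N by (simp add: ln_div)
    moreover have "ln (real N / real n) \<le> real N / real n"
      using ln_le_minus_one[of "real N / real n"] that N by force
    ultimately have "ln (real N) \<le> real N / real n + ln (real n)" by linarith
    then have "f n * ln (real N) \<le> f n * (real N / real n + ln (real n))"
      by (rule mult_left_mono[OF _ nonneg])
    then show ?thesis by (simp add: distrib_left)
  qed
  have "(\<Sum>n=1..N. f n * ln (real n)) = (\<Sum>n=1..N. \<Sum>p | prime p \<and> p dvd n. f n * ln (real p))"
  proof (rule sum.cong)
    fix n assume "n \<in> {1..N}"
    then show "f n * ln (real n) = (\<Sum>p | prime p \<and> p dvd n. f n * ln (real p))"
      using sum_ln_prime_divisors[of n] supp[of n]
      by (cases "f n = 0") (auto simp flip: sum_distrib_left)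
  qed simp
  also have "\<dots> = (\<Sum>(n,p)\<in>Sigma {1..N} (\<lambda>n. {p. prime p \<and> p dvd n}). f n * ln (real p))"
    by (rule sum.Sigma) (auto intro: finite_subset[OF _ finite_divisors_nat])
  \<comment> \<open>The substitution \<open>n = m * p\<close> makes \<open>sub\<close> applicable
    and leaves Chebyshev's function at \<open>N div m\<close> as the inner sum.\<close>
  also have "\<dots> = (\<Sum>(m,p)\<in>Sigma {1..N} (\<lambda>m. {p. prime p \<and> p \<le> N div m}). f (m * p) * ln (real p))"
  proof (rule sum.reindex_bij_witness[of _ "\<lambda>(m,p). (m * p, p)" "\<lambda>(n,p). (n div p, p)"], goal_cases)
    case (2 a)
    then obtain n p where a: "a = (n,p)" "n \<in> {1..N}" "prime p" "p dvd n" by auto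
    then obtain k where k: "n = p * k" by (elim dvdE)
    then have "k > 0" "p > 0" using a by (auto intro: Nat.gr0I)
    moreover have "k \<le> p * k" using \<open>p > 0\<close> by simp
    moreover have "p * k \<le> N" using a k by simp
    ultimately have "k \<le> N" by (metis order_trans)
    then show ?case using a k \<open>k > 0\<close> \<open>p > 0\<close> \<open>p * k \<le> N\<close>
      by (simp add: less_eq_div_iff_mult_less_eq mult.commute)
  next
    case (4 a)
    then obtain m p where a: "a = (m,p)" "m \<in> {1..N}" "prime p" "p \<le> N div m" by auto
    then have "p * m \<le> N" by (subst (asm) less_eq_div_iff_mult_less_eq) auto
    moreover have "p > 0" using a prime_gt_0_nat by auto
    ultimately show ?case using a by (auto simp: mult.commute)
  qed (auto simp: prime_gt_0_nat)
  also have "\<dots> = (\<Sum>m=1..N. \<Sum>p | prime p \<and> p \<le> N div m. f (m * p) * ln (real p))"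
    by (rule sum.Sigma[symmetric]) auto
  also have "\<dots> \<le> (\<Sum>m=1..N. f m * (2 * (real N / real m)))"
  proof (rule sum_mono)
    fix m assume m: "m \<in> {1..N}"
    have "(\<Sum>p | prime p \<and> p \<le> N div m. f (m * p) * ln (real p)) \<le> (\<Sum>p | prime p \<and> p \<le> N div m. f m * ln (real p))"
      by (intro sum_mono mult_right_mono sub) (auto dest: prime_ge_1_nat)
    also have "\<dots> = f m * chebyshev_theta (N div m)"
      by (simp add: chebyshev_theta_def sum_distrib_left)
    also have "\<dots> \<le> f m * (2 * (real N / real m))"
      using chebyshev_theta_le[of "N div m"] of_nat_div_le_of_nat[of N m, where 'a = real]
      by (intro mult_left_mono nonneg) linarith
    finally show "(\<Sum>p | prime p \<and> p \<le> N div m. f (m * p) * ln (real p)) \<le> f m * (2 * (real N / real m))" .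
  qed
  also have "\<dots> = 2 * real N * ?S" by (simp add: sum_distrib_left algebra_simps)
  finally have 1: "(\<Sum>n=1..N. f n * ln (real n)) \<le> 2 * real N * ?S" .
  \<comment> \<open>The constant 3 is 1 from \<open>ln (N / n) \<le> N / n\<close> plus 2 from the
    bound on \<open>chebyshev_theta\<close>.\<close>
  have "(\<Sum>n=1..N. f n) * ln (real N) \<le> (\<Sum>n=1..N. f n * (real N / real n) + f n * ln (real n))"
    unfolding sum_distrib_right by (rule sum_mono) (rule split)
  also have "\<dots> = real N * ?S + (\<Sum>n=1..N. f n * ln (real n))"
    by (simp add: sum.distrib sum_distrib_left algebra_simps)
  also have "\<dots> \<le> 3 * real N * ?S" using 1 by simp
  finally show ?thesis using lnN by (simp add: field_simps)
qed

section \<open>The divisor function and real characters\<close>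

definition tau :: "nat \<Rightarrow> nat" where "tau n = card {d. d dvd n}"

lemma tau_pos: "n > 0 \<Longrightarrow> tau n > 0"
  unfolding tau_def by (subst card_gt_0_iff) auto

lemma tau_mult_le: "m > 0 \<Longrightarrow> n > 0 \<Longrightarrow> tau (m * n) \<le> tau m * tau n"
proof -
  assume pos: "m > 0" "n > 0"
  have "{d. d dvd m * n} \<subseteq> (\<lambda>(a,b). a * b) ` ({d. d dvd m} \<times> {d. d dvd n})"
  proof
    fix d assume "d \<in> {d. d dvd m * n}"
    then obtain b c where "d = b * c" "b dvd m" "c dvd n"
      using division_decomp[of d m n] by auto
    then show "d \<in> (\<lambda>(a,b). a * b) ` ({d. d dvd m} \<times> {d. d dvd n})" by force
  qed
  then have "card {d. d dvd m * n} \<le> card ({d. d dvd m} \<times> {d. d dvd n})"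
    using pos by (intro surj_card_le) auto
  then show ?thesis by (simp add: tau_def card_cartesian_product)
qed

lemma tau_coprime_mult:
  assumes "coprime m n" "m > 0" "n > 0"
  shows "tau (m * n) = tau m * tau n"
proof -
  have "tau m * tau n = card ({d. d dvd m} \<times> {d. d dvd n})"
    by (simp add: tau_def card_cartesian_product)
  also have "\<dots> \<le> card {d. d dvd m * n}"
  proof (rule card_inj_on_le[of "\<lambda>(a,b). a * b"])
    show "inj_on (\<lambda>(a, b). a * b) ({d. d dvd m} \<times> {d. d dvd n})"
    proof (rule inj_onI, clarify)
      fix a b a' b' assume h: "a dvd m" "b dvd n" "a' dvd m" "b' dvd n" "a * b = a' * b'"
      have "coprime a b'" "coprime a' b"
        using h assms coprime_divisors by blast+
      then have "a dvd a'" "a' dvd a"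
        using h by (metis coprime_dvd_mult_left_iff dvd_triv_left)+
      then have "a = a'" by (rule dvd_antisym)
      moreover have "a > 0" using h assms by (auto intro: Nat.gr0I)
      ultimately show "a = a' \<and> b = b'" using h by simp
    qed
    show "(\<lambda>(a, b). a * b) ` ({d. d dvd m} \<times> {d. d dvd n}) \<subseteq> {d. d dvd m * n}"
      by (auto intro: mult_dvd_mono)
  qed (use assms in simp)
  finally show ?thesis using tau_mult_le[OF assms(2,3)] by (simp add: tau_def)
qed

lemma sum_divisors_swap:
  fixes F :: "nat \<Rightarrow> nat \<Rightarrow> real"
  shows "(\<Sum>n=1..N. \<Sum>d | d dvd n. F d (n div d)) = (\<Sum>b=1..N. \<Sum>a=1..N div b. F a b)"
proof -
  have "(\<Sum>n=1..N. \<Sum>d | d dvd n. F d (n div d)) = (\<Sum>(n,d)\<in>Sigma {1..N} (\<lambda>n. {d. d dvd n}). F d (n div d))"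
    by (rule sum.Sigma) auto
  also have "\<dots> = (\<Sum>(b,a)\<in>Sigma {1..N} (\<lambda>b. {1..N div b}). F a b)"
  proof (rule sum.reindex_bij_witness[of _ "\<lambda>(b,a). (a * b, a)" "\<lambda>(n,d). (n div d, d)"], goal_cases)
    case (2 z)
    then obtain n d where z: "z = (n,d)" "n \<in> {1..N}" "d dvd n" by auto
    then obtain k where k: "n = d * k" by (elim dvdE)
    then have "k > 0" "d > 0" using z by (auto intro: Nat.gr0I)
    moreover have "k \<le> d * k" using \<open>d > 0\<close> by simp
    moreover have "d * k \<le> N" using z k by simp
    ultimately have "k \<le> N" by (metis order_trans)
    then show ?case using z k \<open>k > 0\<close> \<open>d > 0\<close> \<open>d * k \<le> N\<close>
      by (simp add: less_eq_div_iff_mult_less_eq mult.commute)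
  next
    case (4 z)
    then show ?case by (auto simp: less_eq_div_iff_mult_less_eq)
  qed (auto simp: dvd_imp_le)
  also have "\<dots> = (\<Sum>b=1..N. \<Sum>a=1..N div b. F a b)"
    by (rule sum.Sigma[symmetric]) auto
  finally show ?thesis .
qed

text \<open>In the expanded square each \<open>k = m * n\<close> occurs at most \<open>tau k\<close>
  times, which cancels the \<open>tau\<close> in \<open>le\<close>. The effect is to halve powers of
  the logarithm: the sum with weight \<open>w\<close> is at most the square root of a sum with
  weight \<open>W\<close>. It is used with \<open>w = 1\<close>, \<open>W = tau\<close> and with
  \<open>w = 1 / tau\<close>, \<open>W = 1\<close>.\<close>

lemma square_sum_le_divisor_weighted:
  fixes w W :: "nat \<Rightarrow> real"
  assumes S: "\<And>m n. m \<in> S \<Longrightarrow> n \<in> S \<Longrightarrow> m * n \<in> S"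
    and le: "\<And>m n. m > 0 \<Longrightarrow> n > 0 \<Longrightarrow> w m * w n \<le> W (m * n) / real (tau (m * n))"
    and nonneg: "\<And>n. W n \<ge> 0"
  shows "(\<Sum>m\<in>{1..N} \<inter> S. w m / real m)\<^sup>2 \<le> (\<Sum>n\<in>{1..N\<^sup>2} \<inter> S. W n / real n)"
proof -
  let ?A = "{1..N} \<inter> S" and ?B = "{1..N\<^sup>2} \<inter> S"
  have "(\<Sum>m\<in>?A. w m / real m)\<^sup>2 = (\<Sum>(m,n)\<in>?A \<times> ?A. w m / real m * (w n / real n))"
    by (simp add: power2_eq_square sum_product sum.cartesian_product)
  also have "\<dots> = (\<Sum>k\<in>?B. \<Sum>z\<in>{z \<in> ?A \<times> ?A. fst z * snd z = k}. w (fst z) / real (fst z) * (w (snd z) / real (snd z)))"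
    by (subst sum.group) (auto simp: power2_eq_square case_prod_beta S intro!: mult_le_mono)
  also have "\<dots> \<le> (\<Sum>k\<in>?B. W k / real k)"
  proof (rule sum_mono)
    fix k assume k: "k \<in> ?B"
    let ?Z = "{z \<in> ?A \<times> ?A. fst z * snd z = k}"
    have "(\<Sum>z\<in>?Z. w (fst z) / real (fst z) * (w (snd z) / real (snd z))) \<le> (\<Sum>z\<in>?Z. W k / real (tau k) / real k)"
    proof (rule sum_mono)
      fix z assume z: "z \<in> ?Z"
      have "w (fst z) / real (fst z) * (w (snd z) / real (snd z)) = w (fst z) * w (snd z) / real k"
        using z by auto
      also have "\<dots> \<le> W k / real (tau k) / real k"
        using le[of "fst z" "snd z"] z by (intro divide_right_mono) auto
      finally show "w (fst z) / real (fst z) * (w (snd z) / real (snd z)) \<le> W k / real (tau k) / real k" .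
    qed
    also have "\<dots> = real (card ?Z) * (W k / real (tau k) / real k)" by simp
    also have "card ?Z \<le> tau k"
      unfolding tau_def
    proof (rule card_inj_on_le[of fst])
      show "inj_on fst ?Z" by (auto simp: inj_on_def)
    qed (use k in auto)
    then have "real (card ?Z) * (W k / real (tau k) / real k) \<le> real (tau k) * (W k / real (tau k) / real k)"
      by (intro mult_right_mono) (auto simp: nonneg)
    also have "\<dots> = W k / real k" using k tau_pos[of k] by auto
    finally show "(\<Sum>z\<in>?Z. w (fst z) / real (fst z) * (w (snd z) / real (snd z))) \<le> W k / real k" by simp
  qed
  finally show ?thesis .
qed

lemma sum_inverse_tau_le:
  assumes S: "\<And>m n. m \<in> S \<Longrightarrow> n \<in> S \<Longrightarrow> m * n \<in> S"
  shows "(\<Sum>m\<in>{1..N} \<inter> S. 1 / real (tau m) / real m)\<^sup>2 \<le> (\<Sum>n\<in>{1..N\<^sup>2} \<inter> S. 1 / real n)"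
proof (rule square_sum_le_divisor_weighted[OF S])
  fix m n :: nat assume mn: "m > 0" "n > 0"
  have "real (tau (m * n)) \<le> real (tau m) * real (tau n)"
    using tau_mult_le[OF mn] by (metis of_nat_le_iff of_nat_mult)
  then show "1 / real (tau m) * (1 / real (tau n)) \<le> 1 / real (tau (m * n))"
    using tau_pos mn by (simp add: frac_le)
qed auto

section \<open>Real characters and integers composed of split primes\<close>

locale real_character =
  fixes ch :: "nat \<Rightarrow> real"
  assumes one [simp]: "ch (Suc 0) = 1" and mult: "ch (m * n) = ch m * ch n"
    and vals: "ch n \<in> {-1, 0, 1}"
begin

lemma abs_le: "\<bar>ch n\<bar> \<le> 1" using vals[of n] by auto

lemma power: "ch (p ^ k) = ch p ^ k"
  by (induction k) (auto simp: mult)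

text \<open>The sum is multiplicative in \<open>n\<close>, and at a prime power it is a geometric
  sum in \<open>ch p\<close>, nonnegative for each of the values -1, 0, 1. The induction splits off
  the full power of one prime.\<close>

lemma divisor_sum_nonneg: "n > 0 \<Longrightarrow> (\<Sum>d | d dvd n. ch d) \<ge> 0"
proof (induction n rule: less_induct)
  case (less n)
  show ?case
  proof (cases "n = 1")
    case True then show ?thesis by simp
  next
    case False
    then obtain p where p: "prime p" "p dvd n" using prime_factor_nat by blast
    define k where "k = multiplicity p n"
    obtain m where m: "n = p ^ k * m" "\<not> p dvd m"
      using multiplicity_decompose'[of n p] p less.prems unfolding k_def by (auto simp: prime_nat_iff)
    have m0: "m > 0" "p > 1" using m less.prems p prime_gt_1_nat by (auto intro: Nat.gr0I)
    have "k > 0" using p less.prems by (simp add: k_def prime_multiplicity_gt_zero_iff)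
    then have "p ^ k > 1" using m0 by (metis one_less_power)
    then have mn: "m < n" using m m0 by simp
    have bij: "bij_betw (\<lambda>z. p ^ fst z * snd z) ({..k} \<times> {d. d dvd m}) {d. d dvd n}"
      unfolding bij_betw_def
    proof (intro conjI)
      show "inj_on (\<lambda>z. p ^ fst z * snd z) ({..k} \<times> {d. d dvd m})"
      proof (rule inj_onI, clarsimp)
        fix i d j e assume h: "d dvd m" "e dvd m" "p ^ i * d = p ^ j * e"
        have "\<not> p dvd d" "\<not> p dvd e" using h m by auto
        moreover have "multiplicity p (p ^ i * d) = i" "multiplicity p (p ^ j * e) = j"
          using calculation p by (auto simp: multiplicity_eqI prime_elem_multiplicity_mult_distrib not_dvd_imp_multiplicity_0
               intro!: multiplicity_eqI)
        ultimately have "i = j" using h by simp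
        then show "i = j \<and> d = e" using h m0 by simp
      qed
      show "(\<lambda>z. p ^ fst z * snd z) ` ({..k} \<times> {d. d dvd m}) = {d. d dvd n}"
      proof (intro equalityI subsetI)
        fix d assume "d \<in> {d. d dvd n}"
        then obtain b c where bc: "d = b * c" "b dvd p ^ k" "c dvd m"
          using division_decomp[of d "p ^ k" m] m by auto
        then obtain i where "i \<le> k" "b = p ^ i" using p by (auto simp: divides_primepow_nat)
        then show "d \<in> (\<lambda>z. p ^ fst z * snd z) ` ({..k} \<times> {d. d dvd m})" using bc by force
      qed (auto simp: m intro!: mult_dvd_mono le_imp_power_dvd)
    qed
    have "(\<Sum>d | d dvd n. ch d) = (\<Sum>z\<in>{..k} \<times> {d. d dvd m}. ch (p ^ fst z * snd z))"
      by (rule sum.reindex_bij_betw[OF bij, symmetric])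
    also have "\<dots> = (\<Sum>i\<le>k. ch p ^ i) * (\<Sum>d | d dvd m. ch d)"
      by (simp add: sum_product sum.cartesian_product mult power case_prod_beta)
    also have "\<dots> \<ge> 0"
    proof (rule mult_nonneg_nonneg)
      have "(\<Sum>i\<le>k. (-1::real) ^ i) = (if even k then 1 else 0)" by (induction k) auto
      then show "(\<Sum>i\<le>k. ch p ^ i) \<ge> 0" using vals[of p] by (auto simp: power_0_left sum_nonneg)
    qed (use less.IH[OF mn] m0 in simp)
    finally show ?thesis .
  qed
qed

text \<open>For a quadratic character these are the integers composed of primes that split in the
  quadratic field. On them the divisor sum of \<open>ch\<close> is the whole divisor
  function.\<close>

definition split_set :: "nat set" where
  "split_set = {n. n > 0 \<and> (\<forall>p. prime p \<longrightarrow> p dvd n \<longrightarrow> ch p = 1)}"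

lemma split_set_mult: "m \<in> split_set \<Longrightarrow> n \<in> split_set \<Longrightarrow> m * n \<in> split_set"
  by (auto simp: split_set_def prime_dvd_mult_iff)

lemma split_set_dvd: "n \<in> split_set \<Longrightarrow> d dvd n \<Longrightarrow> d \<in> split_set"
  by (auto simp: split_set_def intro: dvd_trans Nat.gr0I)

lemma split_set_eq_1: "n \<in> split_set \<Longrightarrow> ch n = 1"
proof (induction n rule: prime_divisors_induct)
  case (factor p n)
  then have "n \<in> split_set" by (meson dvd_triv_right split_set_dvd)
  then show ?case using factor by (auto simp: mult split_set_def)
qed (auto simp: split_set_def)

lemma divisor_sum_split: "n \<in> split_set \<Longrightarrow> (\<Sum>d | d dvd n. ch d) = real (tau n)"
  using split_set_eq_1 split_set_dvd by (simp add: tau_def)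

text \<open>Terms up to \<open>q\<close> are bounded trivially, the others by partial summation;
  this is the classical L(1, chi) = O(ln q). The bound on partial sums is a hypothesis because for
  \<open>Jac a\<close> in its lower argument periodicity comes from reciprocity and not from the
  definition.\<close>

lemma sum_char_div_le:
  assumes q: "q \<ge> (1::nat)" and bd: "\<And>y. \<bar>\<Sum>a=1..y. ch a\<bar> \<le> real q"
  shows "\<bar>\<Sum>a=1..y. ch a / real a\<bar> \<le> 3 + ln (real q)"
proof -
  have small: "\<bar>\<Sum>a=1..y. ch a / real a\<bar> \<le> 1 + ln (real q)" if "y \<le> q" for y
  proof -
    have "\<bar>\<Sum>a=1..y. ch a / real a\<bar> \<le> (\<Sum>a=1..y. \<bar>ch a / real a\<bar>)" by (rule sum_abs)
    also have "\<dots> \<le> (\<Sum>a=1..y. 1 / real a)"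
      by (rule sum_mono) (auto simp: abs_le intro!: divide_right_mono)
    also have "\<dots> \<le> (\<Sum>a=1..q. 1 / real a)" by (rule sum_mono2) (use that in auto)
    also have "\<dots> \<le> 1 + ln (real q)" using sum_inverse_le[OF q] .
    finally show ?thesis .
  qed
  show ?thesis
  proof (cases "y \<le> q")
    case True
    then show ?thesis using small[of y] by simp
  next
    case False
    define T where "T y = (\<Sum>a=1..y. ch a)" for y
    define R where "R y = (\<Sum>a=1..y. ch a / real a)" for y
    have T: "\<bar>T y\<bar> \<le> real q" for y using bd by (simp add: T_def)
    \<comment> \<open>Abel summation as an induction: \<open>R y - T y / y\<close> grows by
      \<open>T n * (1 / n - 1 / (n + 1))\<close> at each step, so the error telescopes to
      \<open>q * (1 / q - 1 / y)\<close>.\<close>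
    have "\<bar>R y - T y / real y\<bar> \<le> 2 + ln (real q) + real q * (1 / real q - 1 / real y)" if "y \<ge> q" for y
      using that
    proof (induction y rule: dec_induct)
      case base
      have "\<bar>R q\<bar> \<le> 1 + ln (real q)" unfolding R_def by (rule small) simp
      moreover have "\<bar>T q / real q\<bar> \<le> 1" using T[of q] q by (simp add: field_simps)
      ultimately have "\<bar>R q - T q / real q\<bar> \<le> 2 + ln (real q)" by linarith
      then show ?case by simp
    next
      case (step n)
      have n: "real n > 0" using step q by simp
      have "R (Suc n) - T (Suc n) / real (Suc n) = (R n - T n / real n) + T n * (1 / real n - 1 / real (Suc n))"
        by (simp add: R_def T_def add_divide_distrib right_diff_distrib)
      moreover have "\<bar>T n * (1 / real n - 1 / real (Suc n))\<bar> \<le> real q * (1 / real n - 1 / real (Suc n))"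
        unfolding abs_mult using n T[of n] by (intro mult_mono) (auto simp: field_simps)
      ultimately show ?case using step.IH by (simp add: algebra_simps)
    qed
    from this[of y] have "\<bar>R y - T y / real y\<bar> \<le> 3 + ln (real q) - real q / real y"
      using False q by (simp add: algebra_simps)
    moreover have "\<bar>T y / real y\<bar> \<le> real q / real y"
      using T[of y] by (simp add: divide_right_mono)
    ultimately show ?thesis unfolding R_def[symmetric] by linarith
  qed
qed

text \<open>Half of the primes are excluded, so the sum should have order
  \<open>sqrt (ln N)\<close>; the factor with \<open>q\<close> is the bound for L(1, chi). Squaring
  leads to \<open>tau n / n\<close> over split \<open>n\<close>, where \<open>tau\<close> equals the
  divisor sum of the character.\<close>

lemma sum_split_set_le:
  assumes q: "q \<ge> (1::nat)" and bd: "\<And>y. \<bar>\<Sum>a=1..y. ch a\<bar> \<le> real q" and N: "N \<ge> 1"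
  shows "(\<Sum>m\<in>{1..N} \<inter> split_set. 1 / real m)\<^sup>2 \<le> (1 + 2 * ln (real N)) * (3 + ln (real q))"
proof -
  have "(\<Sum>m\<in>{1..N} \<inter> split_set. 1 / real m)\<^sup>2 \<le> (\<Sum>n\<in>{1..N\<^sup>2} \<inter> split_set. real (tau n) / real n)"
  proof (rule square_sum_le_divisor_weighted)
    fix m n :: nat assume "m > 0" "n > 0"
    then have "tau (m * n) > 0" by (simp add: tau_pos)
    then show "1 * 1 \<le> real (tau (m * n)) / real (tau (m * n))" by simp
  qed (auto simp: split_set_mult)
  also have "\<dots> = (\<Sum>n\<in>{1..N\<^sup>2} \<inter> split_set. (\<Sum>d | d dvd n. ch d) / real n)"
    by (rule sum.cong) (auto simp: divisor_sum_split)
  \<comment> \<open>Nonnegativity of the divisor sum lets the restriction to split \<open>n\<close>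
    be dropped, after which the sum unfolds along the hyperbola.\<close>
  also have "\<dots> \<le> (\<Sum>n\<in>{1..N\<^sup>2}. (\<Sum>d | d dvd n. ch d) / real n)"
    by (rule sum_mono2) (auto intro!: divide_nonneg_nonneg divisor_sum_nonneg)
  also have "\<dots> = (\<Sum>n\<in>{1..N\<^sup>2}. \<Sum>d | d dvd n. ch d / real d * (1 / real (n div d)))"
  proof (rule sum.cong)
    fix n assume "n \<in> {1..N\<^sup>2}"
    have "(\<Sum>d | d dvd n. ch d) / real n = (\<Sum>d | d dvd n. ch d / real n)" by (rule sum_divide_distrib)
    also have "\<dots> = (\<Sum>d | d dvd n. ch d / real d * (1 / real (n div d)))"
    proof (rule sum.cong)
      fix d assume "d \<in> {d. d dvd n}"
      then have "real n = real d * real (n div d)" by (metis dvd_mult_div_cancel mem_Collect_eq of_nat_mult)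
      then show "ch d / real n = ch d / real d * (1 / real (n div d))" by simp
    qed simp
    finally show "(\<Sum>d | d dvd n. ch d) / real n = (\<Sum>d | d dvd n. ch d / real d * (1 / real (n div d)))" .
  qed simp
  also have "\<dots> = (\<Sum>b=1..N\<^sup>2. \<Sum>a=1..N\<^sup>2 div b. ch a / real a * (1 / real b))"
    by (rule sum_divisors_swap)
  also have "\<dots> = (\<Sum>b=1..N\<^sup>2. (\<Sum>a=1..N\<^sup>2 div b. ch a / real a) * (1 / real b))"
    by (simp only: sum_distrib_right)
  also have "\<dots> \<le> (\<Sum>b=1..N\<^sup>2. (3 + ln (real q)) * (1 / real b))"
    using sum_char_div_le[OF q bd]
    by (intro sum_mono mult_right_mono) (auto simp: abs_le_iff)
  also have "\<dots> = (3 + ln (real q)) * (\<Sum>b=1..N\<^sup>2. 1 / real b)"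
    by (simp add: sum_distrib_left)
  also have "\<dots> \<le> (3 + ln (real q)) * (1 + ln (real (N\<^sup>2)))"
    using N q by (intro mult_left_mono sum_inverse_le) auto
  also have "ln (real (N\<^sup>2)) = 2 * ln (real N)" using N by (simp add: ln_realpow)
  finally show ?thesis by (simp add: mult.commute)
qed

end

section \<open>Jacobi symbols\<close>

text \<open>Multiplication by \<open>u\<close> permutes the residues modulo \<open>q\<close> and
  reverses the sign of \<open>ch\<close>, so a full period sums to 0. The same \<open>u\<close>
  gives \<open>ch 0 = 0\<close>, so it is immaterial whether the sum starts at 0 or at 1.\<close>

lemma (in real_character) sum_bounded_if_periodic:
  assumes q: "q > 0" and per: "\<And>n. ch (n + q) = ch n" and u: "coprime u q" "ch u = -1"
  shows "\<bar>\<Sum>a=1..y. ch a\<bar> \<le> real q"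
proof -
  have "ch 0 = ch u * ch 0" using mult[of u 0] by simp
  then have ch0: "ch 0 = 0" using u by simp
  have permul: "ch (n + k * q) = ch n" for n k
  proof (induction k)
    case (Suc k)
    have "n + Suc k * q = (n + k * q) + q" by simp
    then show ?case using Suc per by metis
  qed simp
  have mod: "ch (n mod q) = ch n" for n
    using permul[of "n mod q" "n div q"] by simp
  have inj: "inj_on (\<lambda>a. (u * a) mod q) {..<q}"
  proof (rule inj_onI)
    fix a b assume ab: "a \<in> {..<q}" "b \<in> {..<q}" "(u * a) mod q = (u * b) mod q"
    then have "[a = b] (mod q)" using u cong_mult_lcancel_nat[of u q a b] by (simp add: cong_def)
    then show "a = b" using ab by (simp add: cong_def)
  qed
  have img: "(\<lambda>a. (u * a) mod q) ` {..<q} = {..<q}"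
    by (rule endo_inj_surj) (use inj q in auto)
  have "(\<Sum>a<q. ch a) = (\<Sum>a<q. ch ((u * a) mod q))"
    by (subst sum.reindex[OF inj, unfolded img]) (simp add: o_def)
  also have "\<dots> = - (\<Sum>a<q. ch a)" by (simp add: mod mult u sum_negf)
  finally have zero: "(\<Sum>a<q. ch a) = 0" by simp
  have bd: "\<bar>\<Sum>a<y. ch a\<bar> \<le> real q" for y
  proof (induction y rule: less_induct)
    case (less y)
    show ?case
    proof (cases "y < q")
      case True
      have "\<bar>\<Sum>a<y. ch a\<bar> \<le> (\<Sum>a<y. \<bar>ch a\<bar>)" by (rule sum_abs)
      also have "\<dots> \<le> (\<Sum>a<y. 1)" by (intro sum_mono abs_le)
      finally show ?thesis using True by simp
    next
      case False
      then have "(\<Sum>a<y. ch a) = (\<Sum>a<q. ch a) + (\<Sum>a=q..<y. ch a)"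
        by (subst sum.union_disjoint[symmetric]) (auto intro!: sum.cong)
      also have "(\<Sum>a=q..<y. ch a) = (\<Sum>a<y - q. ch (a + q))"
        by (rule sum.reindex_bij_witness[of _ "\<lambda>a. a + q" "\<lambda>a. a - q"]) (use False in auto)
      finally show ?thesis using less[of "y - q"] q False by (simp add: zero per)
    qed
  qed
  have "{..<Suc y} = insert 0 {1..y}" by auto
  then have "(\<Sum>a<Suc y. ch a) = ch 0 + (\<Sum>a=1..y. ch a)" by simp
  then show ?thesis using bd[of "Suc y"] ch0 by simp
qed

lemma Legendre_cong: "[a = b] (mod p) \<Longrightarrow> Legendre a p = Legendre b p"
proof -
  assume "[a = b] (mod p)"
  then have "[a = 0] (mod p) \<longleftrightarrow> [b = 0] (mod p)" "[y\<^sup>2 = a] (mod p) \<longleftrightarrow> [y\<^sup>2 = b] (mod p)" for y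
    by (meson cong_sym cong_trans)+
  then show ?thesis by (simp add: Legendre_def QuadRes_def)
qed

lemma Legendre_vals: "Legendre a p \<in> {-1, 0, 1}"
  by (auto simp: Legendre_def)

text \<open>By Euler's criterion the two sides are congruent modulo \<open>p\<close>; they differ by
  at most 2, and \<open>p > 2\<close>.\<close>

lemma Legendre_mult:
  assumes "prime p" "2 < p"
  shows "Legendre (a * b) (int p) = Legendre a (int p) * Legendre b (int p)"
proof -
  have "[Legendre (a * b) (int p) = (a * b) ^ ((p - 1) div 2)] (mod int p)"
    using euler_criterion assms by blast
  moreover have "[Legendre a (int p) * Legendre b (int p) = a ^ ((p - 1) div 2) * b ^ ((p - 1) div 2)] (mod int p)"
    using euler_criterion assms by (intro cong_mult) blast+
  ultimately have "[Legendre (a * b) (int p) = Legendre a (int p) * Legendre b (int p)] (mod int p)"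
    by (metis cong_sym cong_trans power_mult_distrib)
  then have "int p dvd Legendre (a * b) (int p) - Legendre a (int p) * Legendre b (int p)"
    by (simp add: cong_iff_dvd_diff)
  moreover have "\<bar>Legendre (a * b) (int p) - Legendre a (int p) * Legendre b (int p)\<bar> \<le> 2"
    using Legendre_vals[of "a * b" p] Legendre_vals[of a p] Legendre_vals[of b p] by auto
  ultimately show ?thesis using assms(2) zdvd_imp_le[of "int p" "\<bar>Legendre (a * b) (int p) - Legendre a (int p) * Legendre b (int p)\<bar>"]
    by (cases "Legendre (a * b) (int p) = Legendre a (int p) * Legendre b (int p)") auto
qed

lemma Legendre_1: "prime p \<Longrightarrow> Legendre 1 (int p) = 1"
  unfolding Legendre_def QuadRes_def
  by (auto simp: cong_0_iff dest: zdvd_imp_le prime_gt_1_nat intro: exI[of _ 1])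

text \<open>The Jacobi symbol, set to \<open>0\<close> at even moduli so that it is a real character in either
  argument.\<close>
definition Jac :: "int \<Rightarrow> nat \<Rightarrow> int" where
  "Jac a n = (if even n then 0 else \<Prod>p\<in>#prime_factorization n. Legendre a (int p))"

lemma Jac_1 [simp]: "Jac a (Suc 0) = 1" by (simp add: Jac_def)

lemma Jac_even [simp]: "even n \<Longrightarrow> Jac a n = 0" by (simp add: Jac_def)

lemma Jac_mult_right: "Jac a (m * n) = Jac a m * Jac a n"
proof (cases "m = 0 \<or> n = 0")
  case False
  then show ?thesis by (auto simp: Jac_def prime_factorization_mult)
qed (auto simp: Jac_def)

lemma Jac_prime: "prime p \<Longrightarrow> odd p \<Longrightarrow> Jac a p = Legendre a (int p)"
  by (simp add: Jac_def prime_factorization_prime)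

lemma odd_prime_factor: "odd (n::nat) \<Longrightarrow> p \<in># prime_factorization n \<Longrightarrow> prime p \<and> 2 < p \<and> p dvd n"
  by (metis dvd_trans in_prime_factors_iff nat_less_le prime_ge_2_nat)

lemma Jac_mult_left: "Jac (a * b) n = Jac a n * Jac b n"
proof (cases "even n")
  case False
  have "(\<Prod>p\<in>#prime_factorization n. Legendre (a * b) (int p)) = (\<Prod>p\<in>#prime_factorization n. Legendre a (int p) * Legendre b (int p))"
    by (rule arg_cong[of _ _ prod_mset], rule image_mset_cong) (use False odd_prime_factor in \<open>simp add: Legendre_mult\<close>)
  then show ?thesis using False by (simp add: Jac_def prod_mset.distrib)
qed simp

lemma Jac_1_left [simp]: "odd n \<Longrightarrow> Jac 1 n = 1"
  unfolding Jac_def using odd_prime_factor[of n] by (simp add: Legendre_1 cong: image_mset_cong)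

lemma Jac_cong: "[a = b] (mod int n) \<Longrightarrow> Jac a n = Jac b n"
proof (cases "even n")
  case False
  assume ab: "[a = b] (mod int n)"
  have "(\<Prod>p\<in>#prime_factorization n. Legendre a (int p)) = (\<Prod>p\<in>#prime_factorization n. Legendre b (int p))"
  proof (rule arg_cong[of _ _ prod_mset], rule image_mset_cong)
    fix p assume "p \<in># prime_factorization n"
    then have "int p dvd int n" using odd_prime_factor[of n p] False by simp
    then show "Legendre a (int p) = Legendre b (int p)"
      using ab cong_dvd_modulus Legendre_cong by blast
  qed
  then show ?thesis by (simp add: Jac_def)
qed simp

lemma Jac_vals: "Jac a n \<in> {-1, 0, 1}"
proof (cases "n = 0")
  case False
  then have "n > 0" by simp
  then show ?thesis
  proof (induction n rule: prime_divisors_induct)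
    case (factor p n)
    have "Jac a p \<in> {-1, 0, 1}"
      using factor Legendre_vals[of a "int p"] by (cases "odd p") (auto simp: Jac_prime)
    then show ?case using factor by (cases "n = 0") (auto simp: Jac_mult_right)
  qed auto
qed simp

lemma abs_Jac_le: "\<bar>Jac a n\<bar> \<le> 1" using Jac_vals[of a n] by auto

abbreviation rJac :: "int \<Rightarrow> nat \<Rightarrow> real" where "rJac a n \<equiv> real_of_int (Jac a n)"

interpretation Jac_right: real_character "\<lambda>n. rJac a n" for a
proof
  show "rJac a n \<in> {-1, 0, 1}" for n using Jac_vals[of a n] by auto
qed (auto simp: Jac_mult_right)

lemma Jac_left_character: "odd k \<Longrightarrow> real_character (\<lambda>n. rJac (int n) k)"
proof
  show "rJac (int n) k \<in> {-1, 0, 1}" for n using Jac_vals[of "int n" k] by auto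
qed (auto simp: Jac_mult_left)

section \<open>Reciprocity, supplementary laws and sums over periods\<close>

lemma quadratic_reciprocity_1_mod_4:
  assumes "prime p" "p mod 4 = 1" "prime q" "odd q"
  shows "Legendre (int p) (int q) = Legendre (int q) (int p)"
proof (cases "p = q")
  case False
  have p2: "2 < p" using assms prime_ge_2_nat[of p] by (cases "p = 2") auto
  have q2: "2 < q" using assms prime_ge_2_nat[of q] by (cases "q = 2") auto
  have "even ((p - 1) div 2)" using assms(2) by presburger
  then have "Legendre (int p) (int q) * Legendre (int q) (int p) = 1"
    using Quadratic_Reciprocity[OF assms(1) p2 assms(3) q2 False] by simp
  then show ?thesis using Legendre_vals[of p q] Legendre_vals[of q p] by auto
qed simp

definition primes_1_mod_4 :: "nat \<Rightarrow> bool" where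
  "primes_1_mod_4 n \<longleftrightarrow> n > 0 \<and> (\<forall>p. prime p \<longrightarrow> p dvd n \<longrightarrow> p mod 4 = 1)"

lemma primes_1_mod_4_odd: "primes_1_mod_4 n \<Longrightarrow> odd n"
  unfolding primes_1_mod_4_def by (metis mod_less numeral_1_eq_Suc_0 numeral_One numeral_eq_iff numeral_less_iff semiring_norm(76,78,85) two_is_prime_nat)

text \<open>Every prime of \<open>m\<close> is 1 modulo 4, so all signs in quadratic reciprocity are
  +1. The law is extended prime by prime, in \<open>n\<close> for a prime upper argument and then in
  \<open>m\<close>.\<close>

lemma Jac_reciprocity:
  assumes "primes_1_mod_4 m" "odd n"
  shows "Jac (int m) n = Jac (int n) m"
proof -
  have *: "Jac (int p) n = Jac (int n) p" if p: "prime p" "p mod 4 = 1" and "odd n" for p n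
    using \<open>odd n\<close>
  proof (induction n rule: prime_divisors_induct)
    case (factor q n)
    have "odd p" using p by presburger
    moreover have "Legendre (int p) (int q) = Legendre (int q) (int p)"
      using quadratic_reciprocity_1_mod_4[OF p, of q] factor by simp
    ultimately show ?case using factor p
      by (simp add: Jac_mult_left Jac_mult_right Jac_prime)
  next
    case (unit n)
    have "odd p" using p by presburger
    then show ?case using unit by simp
  qed simp
  show ?thesis using assms(1)
  proof (induction m rule: prime_divisors_induct)
    case (factor p m)
    then have "primes_1_mod_4 m" "p mod 4 = 1"
      by (auto simp: primes_1_mod_4_def intro: Nat.gr0I)
    then show ?case using factor *[of p n] assms(2)
      by (simp add: Jac_mult_left Jac_mult_right)
  qed (use assms in \<open>auto simp: primes_1_mod_4_def\<close>)
qed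

text \<open>Squaring on \<open>{1..<p}\<close> takes the same value at 1 and at
  \<open>p - 1\<close>; being not injective on a finite set, it misses some residue.\<close>

lemma ex_nonresidue:
  assumes "prime p" "odd p"
  obtains u :: nat where "Legendre (int u) (int p) = -1"
proof -
  have p: "p > 2" using assms by (metis nat_less_le prime_ge_2_nat even_numeral)
  let ?f = "\<lambda>x. x\<^sup>2 mod p"
  have ni: "\<not> inj_on ?f {1..<p}"
  proof
    assume "inj_on ?f {1..<p}"
    moreover have "?f 1 = ?f (p - 1)"
    proof -
      have "(p - 1)\<^sup>2 = 1 + p * (p - 2)"
      proof -
        obtain k where "p = k + 2" using p by (metis add.commute le_add_diff_inverse less_imp_le_nat)
        then show ?thesis by (simp add: power2_eq_square)
      qed
      then show ?thesis by (metis mod_mult_self2 power_one)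
    qed
    ultimately have "1 = p - 1" by (rule inj_onD) (use p in auto)
    then show False using p by simp
  qed
  have sub: "?f ` {1..<p} \<subseteq> {1..<p}"
  proof (rule image_subsetI)
    fix x assume x: "x \<in> {1..<p}"
    then have "\<not> p dvd x\<^sup>2" using assms by (auto simp: prime_dvd_power_iff dest: dvd_imp_le)
    then show "x\<^sup>2 mod p \<in> {1..<p}" using p by (auto simp: dvd_eq_mod_eq_0 Suc_le_eq)
  qed
  have "?f ` {1..<p} \<noteq> {1..<p}" using ni by (metis finite_atLeastLessThan eq_card_imp_inj_on)
  then obtain u where u: "u \<in> {1..<p}" "u \<notin> ?f ` {1..<p}" using sub by blast
  have "\<not> [int u = 0] (mod int p)" using u by (auto simp: cong_0_iff dest: dvd_imp_le)
  moreover have "\<not> QuadRes (int p) (int u)"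
  proof
    assume "QuadRes (int p) (int u)"
    then obtain y where y: "[y\<^sup>2 = int u] (mod int p)" by (auto simp: QuadRes_def)
    define x where "x = nat (y mod int p)"
    have x: "int x = y mod int p" using p by (simp add: x_def)
    have "[(int x)\<^sup>2 = int u] (mod int p)" using y unfolding x by (simp add: cong_def power_mod)
    then have c: "[x\<^sup>2 = u] (mod p)" by (metis cong_int_iff of_nat_power)
    then have "x\<^sup>2 mod p = u" using u by (simp add: cong_def)
    moreover have "x < p" using x p by (simp add: x_def nat_less_iff)
    moreover have "x \<noteq> 0" using calculation u by (intro notI) simp
    ultimately show False using u by force
  qed
  ultimately have "Legendre (int u) (int p) = -1" by (simp add: Legendre_def)
  then show ?thesis by (rule that)
qed

lemma Jac_minus_1: "odd n \<Longrightarrow> Jac (-1) n = (if n mod 4 = 1 then 1 else -1)"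
proof (induction n rule: prime_divisors_induct)
  case (factor p n)
  then have odd: "odd p" "odd n" "prime p" by auto
  have p2: "2 < p" using odd prime_ge_2_nat[of p] by (cases "p = 2") auto
  have "[Legendre (-1) (int p) = (-1) ^ ((p - 1) div 2)] (mod int p)"
    using euler_criterion odd p2 by blast
  moreover have "(-1::int) ^ ((p - 1) div 2) = (if p mod 4 = 1 then 1 else -1)"
  proof -
    have "even ((p - 1) div 2) \<longleftrightarrow> p mod 4 = 1" using odd(1) by presburger
    then show ?thesis by auto
  qed
  ultimately have c: "int p dvd Legendre (-1) (int p) - (if p mod 4 = 1 then 1 else -1)"
    by (simp add: cong_iff_dvd_diff)
  have "Legendre (-1) (int p) = (if p mod 4 = 1 then 1 else -1)"
  proof (rule ccontr)
    assume ne: "Legendre (-1) (int p) \<noteq> (if p mod 4 = 1 then 1 else -1)"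
    have "\<bar>Legendre (-1) (int p) - (if p mod 4 = 1 then 1 else -1)\<bar> \<le> 2"
      using Legendre_vals[of "-1" "int p"] by auto
    then show False using c ne p2 dvd_imp_le_int[OF _ c] by auto
  qed
  moreover have "p mod 4 = 1 \<or> p mod 4 = 3" "n mod 4 = 1 \<or> n mod 4 = 3" using odd by presburger+
  moreover have "Jac (-1) n = (if n mod 4 = 1 then 1 else -1)" using factor odd by blast
  moreover have "Jac (-1) (p * n) = Legendre (-1) (int p) * Jac (-1) n"
    using odd by (simp add: Jac_mult_right Jac_prime)
  ultimately show ?case
    by (elim disjE) (simp_all add: mod_mult_eq[of p 4 n, symmetric])
qed auto

text \<open>Gauss's lemma with multiplier 2: \<open>C\<close> consists of 2, 4, ..., 2 h with
  \<open>h = (p - 1) / 2\<close>, and \<open>E\<close> of those exceeding \<open>h\<close>. The sign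
  is therefore the parity of \<open>h - h div 2\<close>, which depends on \<open>p\<close> modulo
  8.\<close>

lemma Legendre_2:
  assumes "prime p" "2 < p"
  shows "Legendre 2 (int p) = (if p mod 8 = 1 \<or> p mod 8 = 7 then 1 else -1)"
proof -
  have odd: "odd p" using assms by (metis prime_odd_nat)
  interpret GAUSS p 2
    by unfold_locales (use assms in \<open>auto simp: cong_0_iff dest: zdvd_imp_le\<close>)
  define h where "h = (int p - 1) div 2"
  have p: "int p = 2 * h + 1" using odd unfolding h_def by presburger
  have h: "h > 0" using p assms by simp
  have "C = (\<lambda>x. 2 * x) ` {0<..h}"
  proof -
    have "C = (\<lambda>x. (x * 2) mod int p) ` {0<..h}"
      by (simp add: C_def B_def A_def image_image h_def)
    also have "\<dots> = (\<lambda>x. 2 * x) ` {0<..h}"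
      by (rule image_cong) (use p in auto)
    finally show ?thesis .
  qed
  then have "E = (\<lambda>x. 2 * x) ` {h div 2<..h}"
    using h unfolding E_def h_def[symmetric] by (auto simp: image_def)
  then have "card E = card {h div 2<..h}"
    by (simp add: card_image inj_on_def)
  then have card: "card E = nat (h - h div 2)" by simp
  have "even (card E) \<longleftrightarrow> (int p mod 8 = 1 \<or> int p mod 8 = 7)"
  proof -
    have "even (nat (h - h div 2)) \<longleftrightarrow> even (h - h div 2)" using h by (simp add: even_nat_iff)
    also have "\<dots> \<longleftrightarrow> (int p mod 8 = 1 \<or> int p mod 8 = 7)" unfolding p by presburger
    finally show ?thesis using card by simp
  qed
  moreover have "(int p mod 8 = 1 \<or> int p mod 8 = 7) \<longleftrightarrow> p mod 8 = 1 \<or> p mod 8 = 7"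
    using zmod_int[of p 8] by auto
  ultimately show ?thesis using gauss_lemma by simp
qed

lemma Jac_2: "odd n \<Longrightarrow> Jac 2 n = (if n mod 8 = 1 \<or> n mod 8 = 7 then 1 else -1)"
proof (induction n rule: prime_divisors_induct)
  case (factor p n)
  then have odd: "odd p" "odd n" "prime p" by auto
  have p2: "2 < p" using odd prime_ge_2_nat[of p] by (cases "p = 2") auto
  from odd have "p mod 8 = 1 \<or> p mod 8 = 3 \<or> p mod 8 = 5 \<or> p mod 8 = 7"
     "n mod 8 = 1 \<or> n mod 8 = 3 \<or> n mod 8 = 5 \<or> n mod 8 = 7" by presburger+
  then show ?case using factor odd Legendre_2[OF odd(3) p2]
    by (elim disjE) (simp_all add: Jac_mult_right Jac_prime mod_mult_eq[of p 8 n, symmetric])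
qed auto

text \<open>A nonsquare has a prime \<open>p\<close> with odd exponent \<open>s\<close>. By the
  Chinese remainder theorem choose \<open>u\<close> a nonresidue modulo \<open>p\<close> and 1
  modulo the part of \<open>k\<close> prime to \<open>p\<close>; the symbol is then
  \<open>(-1) ^ s\<close>. A common factor of \<open>u\<close> and \<open>k\<close> would make it
  0.\<close>

lemma ex_Jac_minus_1:
  assumes "odd k" "\<not> is_square k"
  obtains u :: nat where "Jac (int u) k = -1" "coprime u k"
proof -
  have "k > 0" using assms by (auto intro: Nat.gr0I)
  have "\<exists>p. prime p \<and> odd (multiplicity p k)"
  proof (rule ccontr)
    assume "\<not> ?thesis"
    then have "is_nth_power 2 k"
      using \<open>k > 0\<close> by (subst is_nth_power_conv_multiplicity_nat) auto
    then show False using assms by simp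
  qed
  then obtain p where p: "prime p" "odd (multiplicity p k)" by blast
  define s where "s = multiplicity p k"
  obtain m where m: "k = p ^ s * m" "\<not> p dvd m"
    using multiplicity_decompose'[of k p] p \<open>k > 0\<close> unfolding s_def by (auto simp: prime_nat_iff)
  have "s > 0" using p by (auto simp: s_def intro: Nat.gr0I)
  then have odd: "odd p" "odd m" using assms m by auto
  obtain v where v: "Legendre (int v) (int p) = -1" using ex_nonresidue[OF p(1) odd(1)] .
  have "coprime p m" using p m by (simp add: prime_imp_coprime)
  then obtain u where u: "[u = v] (mod p)" "[u = 1] (mod m)"
    using binary_chinese_remainder_nat by blast
  have Jp: "Jac (int u) p = -1"
    using Jac_cong[of "int u" "int v" p] u v p odd by (simp add: cong_int_iff Jac_prime)
  have Jm: "Jac (int u) m = 1"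
    using Jac_cong[of "int u" 1 m] u odd by (simp add: cong_int_iff[of u 1, simplified])
  have "odd s" using p by (simp add: s_def)
  have "Jac (int u) (p ^ n) = Jac (int u) p ^ n" for n
    by (induction n) (auto simp: Jac_mult_right)
  then have "Jac (int u) k = (-1) ^ s * 1"
    by (simp only: m(1) Jac_mult_right Jp Jm)
  also have "\<dots> = -1" using \<open>odd s\<close> by simp
  finally have J: "Jac (int u) k = -1" .
  have "coprime u k"
  proof (rule ccontr)
    assume "\<not> coprime u k"
    then have "gcd u k \<noteq> 1" by (simp only: coprime_iff_gcd_eq_1 not_False_eq_True)
    then obtain q where "prime q" "q dvd gcd u k" using prime_factor_nat by blast
    then have q: "prime q" "q dvd u" "q dvd k" by simp_all
    then have "odd q" using assms by (metis dvd_trans)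
    obtain r where r: "k = q * r" using q by blast
    have "Jac (int u) q = 0" using q \<open>odd q\<close> by (simp add: Jac_prime Legendre_def cong_0_iff)
    then show False using J by (simp add: r Jac_mult_right)
  qed
  with J show ?thesis by (rule that)
qed

lemma sum_Jac_left_bound:
  assumes "odd k" "\<not> is_square k"
  shows "\<bar>\<Sum>a=1..y. rJac (int a) k\<bar> \<le> real k"
proof -
  interpret real_character "\<lambda>n. rJac (int n) k" using Jac_left_character assms by blast
  obtain u where "Jac (int u) k = -1" "coprime u k" using ex_Jac_minus_1 assms by blast
  then show ?thesis
  proof (intro sum_bounded_if_periodic)
    fix n show "rJac (int (n + k)) k = rJac (int n) k"
      using Jac_cong[of "int (n + k)" "int n" k] by (simp add: cong_def)
  qed (use assms in \<open>auto intro: Nat.gr0I\<close>)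
qed

lemma sum_Jac_minus_1_bound: "\<bar>\<Sum>a=1..y. rJac (-1) a\<bar> \<le> real 4"
proof (rule Jac_right.sum_bounded_if_periodic)
  fix n :: nat
  show "rJac (-1) (n + 4) = rJac (-1) n"
    by (cases "odd n") (simp_all add: Jac_minus_1)
  show "coprime (3::nat) 4" using coprime_Suc_right_nat[of 3] by simp
qed (simp_all add: Jac_minus_1)

text \<open>Reciprocity turns the symbol into (2/n) (n/d) or (n/d) on odd \<open>n\<close>, which
  has period \<open>8 * d\<close>. It remains to find an odd argument with value -1: for even
  \<open>a\<close> one that is 5 modulo 8 and 1 modulo \<open>d\<close>, for odd \<open>a\<close> a
  nonresidue symbol modulo the nonsquare \<open>d\<close>. The assumption \<open>a > 1\<close>
  excludes the principal character.\<close>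

lemma sum_Jac_twist_bound:
  assumes d: "primes_1_mod_4 d" "squarefree d" and a: "a = (if t then 2 else 1) * d" "a > 1"
  shows "\<bar>\<Sum>n=1..y. rJac (int a) n\<bar> \<le> real (8 * d)"
proof -
  have odd: "odd d" using d(1) by (rule primes_1_mod_4_odd)
  have J: "Jac (int a) n = (if t then Jac 2 n else 1) * Jac (int n) d" if "odd n" for n
    using Jac_reciprocity[OF d(1) that] that by (simp add: a Jac_mult_left)
  have "\<exists>u. odd u \<and> coprime u d \<and> Jac (int a) u = -1"
  proof (cases t)
    case True
    have "coprime (2 ^ 3) d" using odd by (subst coprime_power_left_iff) simp
    then have "coprime 8 d" by simp
    then obtain u where u: "[u = 5] (mod 8)" "[u = 1] (mod d)"
      using binary_chinese_remainder_nat by blast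
    have u8: "u mod 8 = 5" using u by (simp add: cong_def)
    then have "odd u" by presburger
    moreover have "coprime u d" using u(2) by (metis cong_imp_coprime cong_sym coprime_1_left)
    moreover have "Jac (int u) d = 1"
      using Jac_cong[of "int u" 1 d] u odd by (simp add: cong_int_iff[of u 1, simplified])
    ultimately show ?thesis using J[of u] True u8 by (auto simp: Jac_2)
  next
    case False
    then have "d > 1" using a by simp
    have "\<not> is_square d"
    proof
      assume "is_square d"
      then obtain x where "d = x\<^sup>2" by (auto elim: is_nth_powerE)
      then have "x dvd 1" using squarefreeD[OF d(2), of x] by simp
      then show False using \<open>d > 1\<close> \<open>d = x\<^sup>2\<close> by simp
    qed
    then obtain u where u: "Jac (int u) d = -1" "coprime u d" using ex_Jac_minus_1 odd by blast
    \<comment> \<open>\<open>Jac\<close> vanishes at even moduli, so an odd representative is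
      needed; adding the odd \<open>d\<close> changes the parity but not the class modulo
      \<open>d\<close>.\<close>
    define v where "v = (if odd u then u else u + d)"
    have "odd v" using odd by (simp add: v_def)
    moreover have "coprime v d" using u by (metis v_def coprime_iff_gcd_eq_1 gcd_add1)
    moreover have "Jac (int v) d = -1"
      using Jac_cong[of "int v" "int u" d] u by (auto simp: v_def cong_def)
    ultimately show ?thesis using J[of v] False by auto
  qed
  then obtain u where u: "odd u" "coprime u d" "Jac (int a) u = -1" by blast
  show ?thesis
  proof (rule Jac_right.sum_bounded_if_periodic)
    show "8 * d > 0" using d by (simp add: primes_1_mod_4_def)
    have "coprime u (2 ^ 3)" using u by (subst coprime_power_right_iff) simp
    then show "coprime u (8 * d)" using u by simp
    show "rJac (int a) u = -1" using u by simp
    fix n show "rJac (int a) (n + 8 * d) = rJac (int a) n"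
    proof (cases "odd n")
      case True
      then have "odd (n + 8 * d)" by simp
      moreover have "Jac (int (n + 8 * d)) d = Jac (int n) d"
        by (rule Jac_cong) (simp add: cong_def)
      moreover have "Jac 2 (n + 8 * d) = Jac 2 n"
        using True \<open>odd (n + 8 * d)\<close> by (simp add: Jac_2)
      ultimately show ?thesis using J True by simp
    qed simp
  qed
qed

section \<open>Bilinear sums of Jacobi symbols\<close>

text \<open>\<open>tau k\<close> counts divisors and is submultiplicative, so
  \<open>tau ^ (j + 1)\<close> is dominated by the Dirichlet convolution of \<open>tau ^ j\<close>
  with itself; this doubles the exponents of the logarithm. The two bounds are proved together
  because the mean for \<open>j + 1\<close> uses the logarithmic mean for \<open>j\<close>. The
  separate \<open>N\<close> keeps the logarithm fixed while \<open>n\<close> shrinks to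
  \<open>n div b\<close>.\<close>

lemma sum_tau_power_le:
  assumes "N \<ge> 1" "n \<le> N"
  shows "(\<Sum>k=1..n. real (tau k) ^ j) \<le> real n * (1 + ln (real N)) ^ (2 ^ j - 1)
    \<and> (\<Sum>k=1..n. real (tau k) ^ j / real k) \<le> (1 + ln (real N)) ^ (2 ^ j)"
  using assms(2)
proof (induction j arbitrary: n)
  case 0
  show ?case
  proof (cases "n = 0")
    case False
    then have "(\<Sum>k=1..n. 1 / real k) \<le> 1 + ln (real n)" by (intro sum_inverse_le) simp
    also have "\<dots> \<le> 1 + ln (real N)" using False 0 by simp
    finally show ?thesis by simp
  qed (use assms in simp)
next
  case (Suc j)
  let ?L = "1 + ln (real N)"
  have L: "?L \<ge> 1" using assms by simp
  have tau_le: "real (tau k) ^ Suc j \<le> (\<Sum>d | d dvd k. real (tau d) ^ j * real (tau (k div d)) ^ j)" if "k \<ge> 1" for k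
  proof -
    have "real (tau k) ^ Suc j = (\<Sum>d | d dvd k. real (tau k) ^ j)" by (simp add: tau_def)
    also have "\<dots> \<le> (\<Sum>d | d dvd k. real (tau d) ^ j * real (tau (k div d)) ^ j)"
    proof (rule sum_mono)
      fix d assume d: "d \<in> {d. d dvd k}"
      then have "k = d * (k div d)" by simp
      moreover from d that have "d > 0" "k div d > 0" by (auto intro: Nat.gr0I simp: dvd_div_eq_0_iff)
      ultimately have "tau k \<le> tau d * tau (k div d)" using tau_mult_le by metis
      then have "real (tau k) \<le> real (tau d) * real (tau (k div d))" by (metis of_nat_le_iff of_nat_mult)
      then show "real (tau k) ^ j \<le> real (tau d) ^ j * real (tau (k div d)) ^ j"
        unfolding power_mult_distrib[symmetric] by (intro power_mono) auto
    qed
    finally show ?thesis .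
  qed
  have le: "n div b \<le> N" for b using Suc.prems by (meson div_le_dividend le_trans)
  have "(\<Sum>k=1..n. real (tau k) ^ Suc j) \<le> (\<Sum>k=1..n. \<Sum>d | d dvd k. real (tau d) ^ j * real (tau (k div d)) ^ j)"
    by (rule sum_mono) (use tau_le in auto)
  also have "\<dots> = (\<Sum>b=1..n. \<Sum>a=1..n div b. real (tau a) ^ j * real (tau b) ^ j)"
    by (rule sum_divisors_swap)
  also have "\<dots> = (\<Sum>b=1..n. (\<Sum>a=1..n div b. real (tau a) ^ j) * real (tau b) ^ j)"
    by (simp only: sum_distrib_right)
  also have "\<dots> \<le> (\<Sum>b=1..n. (real n / real b * ?L ^ (2 ^ j - 1)) * real (tau b) ^ j)"
  proof (intro sum_mono mult_right_mono)
    fix b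
    have "(\<Sum>a=1..n div b. real (tau a) ^ j) \<le> real (n div b) * ?L ^ (2 ^ j - 1)"
      using Suc.IH[OF le] by blast
    also have "\<dots> \<le> real n / real b * ?L ^ (2 ^ j - 1)"
      using L of_nat_div_le_of_nat[of n b, where 'a = real] by (intro mult_right_mono) auto
    finally show "(\<Sum>a=1..n div b. real (tau a) ^ j) \<le> real n / real b * ?L ^ (2 ^ j - 1)" .
  qed auto
  also have "\<dots> = real n * ?L ^ (2 ^ j - 1) * (\<Sum>b=1..n. real (tau b) ^ j / real b)"
    by (simp add: sum_distrib_left sum_distrib_right mult_ac)
  also have "\<dots> \<le> real n * ?L ^ (2 ^ j - 1) * ?L ^ (2 ^ j)"
    using Suc.IH[OF Suc.prems] L by (intro mult_left_mono) auto
  also have "\<dots> = real n * ?L ^ (2 ^ Suc j - 1)"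
    by (simp add: mult.assoc mult_2 flip: power_add)
  finally have 1: "(\<Sum>k=1..n. real (tau k) ^ Suc j) \<le> real n * ?L ^ (2 ^ Suc j - 1)" .
  have "(\<Sum>k=1..n. real (tau k) ^ Suc j / real k) \<le>
      (\<Sum>k=1..n. \<Sum>d | d dvd k. (real (tau d) ^ j / real d) * (real (tau (k div d)) ^ j / real (k div d)))"
  proof (rule sum_mono)
    fix k assume k: "k \<in> {1..n}"
    have "real (tau k) ^ Suc j / real k \<le> (\<Sum>d | d dvd k. real (tau d) ^ j * real (tau (k div d)) ^ j) / real k"
      by (intro divide_right_mono tau_le) (use k in auto)
    also have "\<dots> = (\<Sum>d | d dvd k. (real (tau d) ^ j / real d) * (real (tau (k div d)) ^ j / real (k div d)))"
      unfolding sum_divide_distrib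
    proof (rule sum.cong)
      fix d assume "d \<in> {d. d dvd k}"
      then have "real k = real d * real (k div d)" by (metis dvd_mult_div_cancel mem_Collect_eq of_nat_mult)
      then show "real (tau d) ^ j * real (tau (k div d)) ^ j / real k = (real (tau d) ^ j / real d) * (real (tau (k div d)) ^ j / real (k div d))"
        by simp
    qed simp
    finally show "real (tau k) ^ Suc j / real k \<le> (\<Sum>d | d dvd k. (real (tau d) ^ j / real d) * (real (tau (k div d)) ^ j / real (k div d)))" .
  qed
  also have "\<dots> = (\<Sum>b=1..n. \<Sum>a=1..n div b. (real (tau a) ^ j / real a) * (real (tau b) ^ j / real b))"
    by (rule sum_divisors_swap)
  also have "\<dots> = (\<Sum>b=1..n. (\<Sum>a=1..n div b. real (tau a) ^ j / real a) * (real (tau b) ^ j / real b))"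
    by (simp only: sum_distrib_right)
  also have "\<dots> \<le> (\<Sum>b=1..n. ?L ^ (2 ^ j) * (real (tau b) ^ j / real b))"
    using Suc.IH[OF le] by (intro sum_mono mult_right_mono) auto
  also have "\<dots> = ?L ^ (2 ^ j) * (\<Sum>b=1..n. real (tau b) ^ j / real b)" by (simp only: sum_distrib_left)
  also have "\<dots> \<le> ?L ^ (2 ^ j) * ?L ^ (2 ^ j)"
    using Suc.IH[OF Suc.prems] L by (intro mult_left_mono) auto
  also have "\<dots> = ?L ^ (2 ^ Suc j)" by (simp add: mult_2 flip: power_add)
  finally show ?case using 1 by blast
qed

lemma square_sum_le_card: "(\<Sum>x\<in>A. f x)\<^sup>2 \<le> real (card A) * (\<Sum>x\<in>A. (f x :: real)\<^sup>2)"
  using Cauchy_Schwarz_ineq_sum[of "\<lambda>_. 1" f A] by simp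

definition quad_prod :: "(nat \<times> nat) \<times> (nat \<times> nat) \<Rightarrow> nat" where
  "quad_prod t = fst (fst t) * snd (fst t) * (fst (snd t) * snd (snd t))"

lemma card_quad_prod_le:
  assumes "k > 0"
  shows "card {t \<in> (B \<times> B) \<times> (B \<times> B). quad_prod t = k} \<le> tau k ^ 3"
proof -
  let ?f = "\<lambda>t :: (nat \<times> nat) \<times> (nat \<times> nat). (fst (fst t), snd (fst t), fst (snd t))"
  have "card {t \<in> (B \<times> B) \<times> (B \<times> B). quad_prod t = k} \<le> card ({d. d dvd k} \<times> {d. d dvd k} \<times> {d. d dvd k})"
  proof (rule card_inj_on_le[of ?f])
    show "inj_on ?f {t \<in> (B \<times> B) \<times> (B \<times> B). quad_prod t = k}"
      using assms by (auto simp: inj_on_def quad_prod_def)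
    show "?f ` {t \<in> (B \<times> B) \<times> (B \<times> B). quad_prod t = k} \<subseteq> {d. d dvd k} \<times> {d. d dvd k} \<times> {d. d dvd k}"
      by (auto simp: quad_prod_def)
  qed (use assms in simp)
  then show ?thesis by (simp add: card_cartesian_product tau_def power3_eq_cube)
qed

text \<open>The left side counts pairs of quadruples with equal product, the second moment of the
  multiplicities in the fourth power of a sum. The exponent 28 is \<open>4 * (2 ^ 3 - 1)\<close>: a
  third moment of \<open>tau\<close> for each of four variables.\<close>

lemma sum_card_quad_prod_le:
  assumes B: "B \<subseteq> {1..N}" and N: "N \<ge> 1"
  defines "T \<equiv> (B \<times> B) \<times> (B \<times> B)"
  shows "(\<Sum>t\<in>T. real (card {s \<in> T. quad_prod s = quad_prod t})) \<le> real N ^ 4 * (1 + ln (real N)) ^ 28"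
proof -
  have fin: "finite B" using B finite_subset by blast
  have "(\<Sum>t\<in>T. real (card {s \<in> T. quad_prod s = quad_prod t})) \<le>
      (\<Sum>t\<in>T. real (tau (fst (fst t))) ^ 3 * real (tau (snd (fst t))) ^ 3 *
        (real (tau (fst (snd t))) ^ 3 * real (tau (snd (snd t))) ^ 3))"
  proof (rule sum_mono)
    fix t assume "t \<in> T"
    then obtain a b c d where t: "t = ((a,b),(c,d))" "a > 0" "b > 0" "c > 0" "d > 0"
      using B by (force simp: T_def)
    have "card {s \<in> T. quad_prod s = quad_prod t} \<le> tau (quad_prod t) ^ 3"
      unfolding T_def by (rule card_quad_prod_le) (use t in \<open>simp add: quad_prod_def\<close>)
    also have "tau (quad_prod t) \<le> (tau a * tau b) * (tau c * tau d)"
      using t by (auto simp: quad_prod_def intro!: order_trans[OF tau_mult_le] mult_mono tau_mult_le)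
    then have "tau (quad_prod t) ^ 3 \<le> ((tau a * tau b) * (tau c * tau d)) ^ 3" by (rule power_mono) simp
    finally have "real (card {s \<in> T. quad_prod s = quad_prod t}) \<le> real (((tau a * tau b) * (tau c * tau d)) ^ 3)"
      by (simp only: of_nat_le_iff)
    then show "real (card {s \<in> T. quad_prod s = quad_prod t}) \<le> real (tau (fst (fst t))) ^ 3 * real (tau (snd (fst t))) ^ 3 *
        (real (tau (fst (snd t))) ^ 3 * real (tau (snd (snd t))) ^ 3)"
      by (simp add: t power_mult_distrib)
  qed
  also have "\<dots> = (\<Sum>n\<in>B. real (tau n) ^ 3) ^ 4"
  proof -
    have "(\<Sum>n\<in>B. real (tau n) ^ 3)\<^sup>2 = (\<Sum>x\<in>B \<times> B. real (tau (fst x)) ^ 3 * real (tau (snd x)) ^ 3)"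
      by (simp add: power2_eq_square sum_product sum.cartesian_product case_prod_beta)
    then have "((\<Sum>n\<in>B. real (tau n) ^ 3)\<^sup>2)\<^sup>2 = (\<Sum>t\<in>T. real (tau (fst (fst t))) ^ 3 * real (tau (snd (fst t))) ^ 3 *
       (real (tau (fst (snd t))) ^ 3 * real (tau (snd (snd t))) ^ 3))"
      unfolding T_def by (simp add: power2_eq_square sum_product sum.cartesian_product case_prod_beta)
    then show ?thesis by (simp add: case_prod_beta)
  qed
  also have "\<dots> \<le> (real N * (1 + ln (real N)) ^ 7) ^ 4"
  proof (rule power_mono)
    have "(\<Sum>n\<in>B. real (tau n) ^ 3) \<le> (\<Sum>n=1..N. real (tau n) ^ 3)" by (rule sum_mono2) (use B in auto)
    also have "\<dots> \<le> real N * (1 + ln (real N)) ^ 7"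
      using sum_tau_power_le[OF N order.refl, of 3] by simp
    finally show "(\<Sum>n\<in>B. real (tau n) ^ 3) \<le> real N * (1 + ln (real N)) ^ 7" .
  qed (auto intro: sum_nonneg)
  finally show ?thesis by (simp add: power_mult_distrib flip: power_mult)
qed

text \<open>Fourth powers turn the inner sum over \<open>n \<le> N\<close> into one over products of four such \<open>n\<close>, whose
  range \<open>N\<^sup>4\<close> exceeds the periods \<open>M\<^sup>2\<close> of the products of two characters as soon as \<open>M \<le> N\<close>.\<close>
lemma bilinear_character_bound:
  fixes psi :: "nat \<Rightarrow> nat \<Rightarrow> real"
  assumes A: "A \<subseteq> {1..M}" and B: "B \<subseteq> {1..N}" and MN: "1 \<le> M" "M \<le> N"
    and ch: "\<And>m. m \<in> A \<Longrightarrow> real_character (psi m)"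
    and orth: "\<And>m m' y. m \<in> A \<Longrightarrow> m' \<in> A \<Longrightarrow> m \<noteq> m' \<Longrightarrow> \<bar>\<Sum>n=1..y. psi m n * psi m' n\<bar> \<le> real M ^ 2"
    and a: "\<And>m. \<bar>a m\<bar> \<le> 1" and b: "\<And>n. \<bar>b n\<bar> \<le> 1"
  shows "(\<Sum>m\<in>A. \<Sum>n\<in>B. a m * b n * psi m n) ^ 8 \<le> 2 * real M ^ 7 * real N ^ 8 * (1 + ln (real N)) ^ 28"
proof -
  define S where "S m = (\<Sum>n\<in>B. b n * psi m n)" for m
  define T where "T = (B \<times> B) \<times> (B \<times> B)"
  define F where "F k = (\<Sum>m\<in>A. psi m k)" for k
  define r where "r k = real (card {t \<in> T. quad_prod t = k})" for k
  have finA: "finite A" and finB: "finite B" using A B finite_subset by blast+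
  have finT: "finite T" using finB by (simp add: T_def)
  have cardA: "real (card A) \<le> real M" using card_mono[OF _ A] by simp
  have N: "N \<ge> 1" using MN by simp
  have psi_mult: "psi m (x * y) = psi m x * psi m y" if "m \<in> A" for m x y
    using real_character.mult[OF ch[OF that]] .
  have psi_abs: "\<bar>psi m x\<bar> \<le> 1" if "m \<in> A" for m x
    using real_character.abs_le[OF ch[OF that]] .
  have "(\<Sum>m\<in>A. \<Sum>n\<in>B. a m * b n * psi m n) = (\<Sum>m\<in>A. a m * S m)"
    by (simp add: S_def sum_distrib_left mult.assoc)
  then have "(\<Sum>m\<in>A. \<Sum>n\<in>B. a m * b n * psi m n) ^ 8 = (((\<Sum>m\<in>A. a m * S m)\<^sup>2)\<^sup>2)\<^sup>2"
    by (simp flip: power_mult)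
  \<comment> \<open>Cauchy-Schwarz over \<open>m\<close> removes the coefficients \<open>a\<close>;
    the second application below raises \<open>S m\<close> to the fourth power. Together they cost
    \<open>M ^ 6\<close> in the eighth power of the sum.\<close>
  also have "\<dots> \<le> ((real M * (\<Sum>m\<in>A. (S m)\<^sup>2))\<^sup>2)\<^sup>2"
  proof (intro power_mono)
    have "(\<Sum>m\<in>A. a m * S m)\<^sup>2 \<le> (\<Sum>m\<in>A. (a m)\<^sup>2) * (\<Sum>m\<in>A. (S m)\<^sup>2)" by (rule Cauchy_Schwarz_ineq_sum)
    also have "\<dots> \<le> real M * (\<Sum>m\<in>A. (S m)\<^sup>2)"
    proof (rule mult_right_mono)
      have "(\<Sum>m\<in>A. (a m)\<^sup>2) \<le> (\<Sum>m\<in>A. 1)" by (intro sum_mono) (use a in \<open>simp add: abs_square_le_1\<close>)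
      then show "(\<Sum>m\<in>A. (a m)\<^sup>2) \<le> real M" using cardA by simp
    qed (simp add: sum_nonneg)
    finally show "(\<Sum>m\<in>A. a m * S m)\<^sup>2 \<le> real M * (\<Sum>m\<in>A. (S m)\<^sup>2)" .
  qed auto
  also have "\<dots> = (real M ^ 2 * (\<Sum>m\<in>A. (S m)\<^sup>2)\<^sup>2)\<^sup>2" by (simp add: power_mult_distrib)
  also have "\<dots> \<le> (real M ^ 2 * (real M * (\<Sum>m\<in>A. S m ^ 4)))\<^sup>2"
  proof (intro power_mono mult_left_mono)
    have "(\<Sum>m\<in>A. (S m)\<^sup>2)\<^sup>2 \<le> real (card A) * (\<Sum>m\<in>A. ((S m)\<^sup>2)\<^sup>2)" by (rule square_sum_le_card)
    also have "\<dots> \<le> real M * (\<Sum>m\<in>A. S m ^ 4)"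
      using cardA by (intro mult_mono) (auto simp flip: power_mult intro: sum_nonneg)
    finally show "(\<Sum>m\<in>A. (S m)\<^sup>2)\<^sup>2 \<le> real M * (\<Sum>m\<in>A. S m ^ 4)" .
  qed auto
  also have "\<dots> = real M ^ 6 * (\<Sum>m\<in>A. S m ^ 4)\<^sup>2" by (simp add: power_mult_distrib flip: power_mult)
  finally have 1: "(\<Sum>m\<in>A. \<Sum>n\<in>B. a m * b n * psi m n) ^ 8 \<le> real M ^ 6 * (\<Sum>m\<in>A. S m ^ 4)\<^sup>2"
    by (simp add: power_mult_distrib flip: power_mult power_add)

  define be where "be t = b (fst (fst t)) * b (snd (fst t)) * (b (fst (snd t)) * b (snd (snd t)))" for t
  have be: "\<bar>be t\<bar> \<le> 1" for t
    unfolding be_def abs_mult using b by (intro mult_le_one mult_nonneg_nonneg) auto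
  have S4: "S m ^ 4 = (\<Sum>t\<in>T. be t * psi m (quad_prod t))" if "m \<in> A" for m
  proof -
    have "(S m)\<^sup>2 = (\<Sum>x\<in>B \<times> B. b (fst x) * psi m (fst x) * (b (snd x) * psi m (snd x)))"
      by (simp add: S_def power2_eq_square sum_product sum.cartesian_product case_prod_beta)
    then have "((S m)\<^sup>2)\<^sup>2 = (\<Sum>t\<in>T. b (fst (fst t)) * psi m (fst (fst t)) * (b (snd (fst t)) * psi m (snd (fst t))) *
      (b (fst (snd t)) * psi m (fst (snd t)) * (b (snd (snd t)) * psi m (snd (snd t)))))"
      unfolding T_def by (simp add: power2_eq_square sum_product sum.cartesian_product case_prod_beta)
    also have "\<dots> = (\<Sum>t\<in>T. be t * psi m (quad_prod t))"
      by (rule sum.cong) (auto simp: be_def quad_prod_def psi_mult[OF that])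
    finally show ?thesis by (simp flip: power_mult)
  qed
  have nonneg: "0 \<le> (\<Sum>m\<in>A. S m ^ 4)" by (intro sum_nonneg) auto
  have qp: "quad_prod ` T \<subseteq> {1..N ^ 4}"
  proof
    fix k assume "k \<in> quad_prod ` T"
    then obtain x y z w where "k = x * y * (z * w)" "x \<in> {1..N}" "y \<in> {1..N}" "z \<in> {1..N}" "w \<in> {1..N}"
      using B by (force simp: T_def quad_prod_def)
    moreover have "x * y * (z * w) \<le> N * N * (N * N)" using calculation by (intro mult_le_mono) auto
    ultimately show "k \<in> {1..N ^ 4}" by (auto simp: power4_eq_xxxx Suc_le_eq mult.assoc)
  qed
  have "(\<Sum>m\<in>A. S m ^ 4) = (\<Sum>m\<in>A. \<Sum>t\<in>T. be t * psi m (quad_prod t))"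
    by (rule sum.cong) (auto simp: S4)
  also have "\<dots> = (\<Sum>t\<in>T. be t * F (quad_prod t))"
    unfolding F_def sum_distrib_left by (rule sum.swap)
  also have "\<dots> \<le> (\<Sum>t\<in>T. \<bar>F (quad_prod t)\<bar>)"
  proof (rule sum_mono)
    fix t
    have "be t * F (quad_prod t) \<le> \<bar>be t\<bar> * \<bar>F (quad_prod t)\<bar>" by (metis abs_ge_self abs_mult)
    also have "\<dots> \<le> 1 * \<bar>F (quad_prod t)\<bar>" using be by (intro mult_right_mono) auto
    finally show "be t * F (quad_prod t) \<le> \<bar>F (quad_prod t)\<bar>" by simp
  qed
  also have "\<dots> = (\<Sum>k=1..N ^ 4. \<Sum>t | t \<in> T \<and> quad_prod t = k. \<bar>F (quad_prod t)\<bar>)"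
    by (rule sum.group[OF finT _ qp, symmetric]) simp
  also have "\<dots> = (\<Sum>k=1..N ^ 4. r k * \<bar>F k\<bar>)"
    by (rule sum.cong) (auto simp: r_def)
  finally have "(\<Sum>m\<in>A. S m ^ 4)\<^sup>2 \<le> (\<Sum>k=1..N ^ 4. r k * \<bar>F k\<bar>)\<^sup>2"
    using nonneg by (intro power_mono) auto
  \<comment> \<open>This Cauchy-Schwarz separates the multiplicities \<open>r\<close> from the
    character sums \<open>F\<close>. Since \<open>k\<close> now runs over a full interval,
    orthogonality of distinct characters applies.\<close>
  also have "\<dots> \<le> (\<Sum>k=1..N ^ 4. (r k)\<^sup>2) * (\<Sum>k=1..N ^ 4. \<bar>F k\<bar>\<^sup>2)" by (rule Cauchy_Schwarz_ineq_sum)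
  also have "\<dots> \<le> (real N ^ 4 * (1 + ln (real N)) ^ 28) * (2 * real M * real N ^ 4)"
  proof (rule mult_mono)
    have "(\<Sum>k=1..N ^ 4. (r k)\<^sup>2) = (\<Sum>k=1..N ^ 4. \<Sum>t | t \<in> T \<and> quad_prod t = k. r (quad_prod t))"
      by (rule sum.cong) (auto simp: r_def power2_eq_square)
    also have "\<dots> = (\<Sum>t\<in>T. r (quad_prod t))"
      by (rule sum.group[OF finT _ qp]) simp
    also have "\<dots> \<le> real N ^ 4 * (1 + ln (real N)) ^ 28"
      unfolding r_def T_def by (rule sum_card_quad_prod_le[OF B N])
    finally show "(\<Sum>k=1..N ^ 4. (r k)\<^sup>2) \<le> real N ^ 4 * (1 + ln (real N)) ^ 28" .
    have "(\<Sum>k=1..N ^ 4. \<bar>F k\<bar>\<^sup>2) = (\<Sum>k=1..N ^ 4. \<Sum>m\<in>A. \<Sum>m'\<in>A. psi m k * psi m' k)"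
      by (simp add: F_def power2_eq_square sum_product)
    also have "\<dots> = (\<Sum>m\<in>A. \<Sum>k=1..N ^ 4. \<Sum>m'\<in>A. psi m k * psi m' k)" by (rule sum.swap)
    also have "\<dots> = (\<Sum>m\<in>A. \<Sum>m'\<in>A. \<Sum>k=1..N ^ 4. psi m k * psi m' k)"
      by (intro sum.cong sum.swap refl)
    also have "\<dots> \<le> (\<Sum>m\<in>A. \<Sum>m'\<in>A. (if m = m' then real N ^ 4 else 0) + real M ^ 2)"
    proof (intro sum_mono)
      fix m m' assume m: "m \<in> A" "m' \<in> A"
      show "(\<Sum>k=1..N ^ 4. psi m k * psi m' k) \<le> (if m = m' then real N ^ 4 else 0) + real M ^ 2"
      proof (cases "m = m'")
        case True
        have "(\<Sum>k=1..N ^ 4. psi m k * psi m' k) \<le> (\<Sum>k=1..N ^ 4. 1)"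
          using psi_abs[OF m(1)] True by (intro sum_mono) (simp add: abs_square_le_1 flip: power2_eq_square)
        also have "\<dots> \<le> real N ^ 4 + real M ^ 2" by simp
        finally show ?thesis using True by simp
      qed (use orth[OF m, of "N ^ 4"] in auto)
    qed
    also have "\<dots> = (\<Sum>m\<in>A. real N ^ 4 + real (card A) * real M ^ 2)"
      using finA by (intro sum.cong) (simp_all add: sum.distrib)
    also have "\<dots> = real (card A) * (real N ^ 4 + real (card A) * real M ^ 2)" by simp
    also have "\<dots> \<le> real M * (real N ^ 4 + real M * real M ^ 2)"
      using cardA by (intro mult_mono add_mono) auto
    also have "real M * real M ^ 2 = real M ^ 3" by (simp add: power2_eq_square power3_eq_cube)
    \<comment> \<open>Here \<open>M \<le> N\<close> enters: the off-diagonal part does not exceed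
      the diagonal part.\<close>
    also have "real M ^ 3 \<le> real N ^ 4"
    proof -
      have "real M ^ 3 \<le> real N ^ 3" using MN by (intro power_mono) auto
      also have "\<dots> \<le> real N ^ 4" using N by (intro power_increasing) auto
      finally show ?thesis .
    qed
    finally show "(\<Sum>k=1..N ^ 4. \<bar>F k\<bar>\<^sup>2) \<le> 2 * real M * real N ^ 4" by (simp add: mult_left_mono)
  qed (use N in \<open>auto intro!: sum_nonneg\<close>)
  also have "\<dots> = 2 * real M * real N ^ 8 * (1 + ln (real N)) ^ 28"
    by (simp add: power_add[of _ 4 4, simplified])
  finally have "real M ^ 6 * (\<Sum>m\<in>A. S m ^ 4)\<^sup>2 \<le> real M ^ 6 * (2 * real M * real N ^ 8 * (1 + ln (real N)) ^ 28)"
    by (intro mult_left_mono) auto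
  also have "\<dots> = 2 * real M ^ 7 * real N ^ 8 * (1 + ln (real N)) ^ 28"
    by (simp add: power_Suc[of _ 6, simplified])
  finally show ?thesis using 1 by linarith
qed

lemma squarefree_mult_is_square_nat:
  fixes m n :: nat
  assumes "squarefree m" "squarefree n" "is_square (m * n)"
  shows "m = n"
proof (rule multiplicity_eq_nat)
  show pos: "m > 0" "n > 0" using assms by (auto intro: Nat.gr0I)
  fix p :: nat assume p: "prime p"
  obtain k where k: "m * n = k\<^sup>2" using assms by (auto elim: is_nth_powerE)
  have "multiplicity p (m * n) = multiplicity p m + multiplicity p n"
    using pos p by (intro prime_elem_multiplicity_mult_distrib) auto
  moreover have "multiplicity p (k\<^sup>2) = 2 * multiplicity p k"
    using pos k p by (intro prime_elem_multiplicity_power_distrib) (auto intro: Nat.gr0I)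
  moreover have "multiplicity p m \<le> 1" "multiplicity p n \<le> 1"
    using assms p pos by (auto simp: squarefree_factorial_semiring'')
  moreover from calculation have "multiplicity p m + multiplicity p n = 2 * multiplicity p k"
    by (metis k)
  ultimately show "multiplicity p m = multiplicity p n" by presburger
qed

text \<open>The general bound saves the length \<open>M\<close> of the variable that indexes the
  characters, provided it is the shorter one. If \<open>N < M\<close>, reciprocity exchanges the
  roles, so at least \<open>V\<close> is saved in either case. Orthogonality holds because the
  product of two distinct squarefree numbers is not a square.\<close>

lemma bilinear_Jac_bound:
  assumes A: "A \<subseteq> {1..M}" "\<And>m. m \<in> A \<Longrightarrow> squarefree m \<and> primes_1_mod_4 m"
    and B: "B \<subseteq> {1..N}" "\<And>n. n \<in> B \<Longrightarrow> squarefree n \<and> odd n"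
    and X: "1 \<le> V" "V \<le> M" "V \<le> N" "M \<le> X" "N \<le> X"
    and a: "\<And>m. \<bar>a m\<bar> \<le> 1" and b: "\<And>n. \<bar>b n\<bar> \<le> 1"
  shows "(\<Sum>m\<in>A. \<Sum>n\<in>B. a m * b n * rJac (int n) m) ^ 8 * real V
     \<le> 2 * (real M * real N) ^ 8 * (1 + ln (real X)) ^ 28"
proof -
  have orth: "\<bar>\<Sum>k=1..y. rJac (int k) m * rJac (int k) m'\<bar> \<le> real Z ^ 2"
    if "odd m" "odd m'" "squarefree m" "squarefree m'" "m \<noteq> m'" "m \<le> Z" "m' \<le> Z" for m m' Z y
  proof -
    have "\<bar>\<Sum>k=1..y. rJac (int k) (m * m')\<bar> \<le> real (m * m')"
      by (rule sum_Jac_left_bound) (use that squarefree_mult_is_square_nat in auto)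
    also have "\<dots> \<le> real Z ^ 2" using that by (auto simp: power2_eq_square intro!: mult_mono)
    finally show ?thesis by (simp add: Jac_mult_right)
  qed
  have oddA: "odd m" if "m \<in> A" for m using A(2)[OF that] primes_1_mod_4_odd by blast
  let ?S = "\<Sum>m\<in>A. \<Sum>n\<in>B. a m * b n * rJac (int n) m"
  have ln: "1 + ln (real N) \<le> 1 + ln (real X)" "1 + ln (real M) \<le> 1 + ln (real X)" using X by auto
  show ?thesis
  proof (cases "M \<le> N")
    case True
    have "?S ^ 8 \<le> 2 * real M ^ 7 * real N ^ 8 * (1 + ln (real N)) ^ 28"
    proof (rule bilinear_character_bound[OF A(1) B(1) _ True _ _ a b])
      fix m m' y assume "m \<in> A" "m' \<in> A" "m \<noteq> m'"
      then show "\<bar>\<Sum>k=1..y. rJac (int k) m * rJac (int k) m'\<bar> \<le> real M ^ 2"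
        using oddA A by (intro orth) auto
    qed (use X oddA in \<open>auto intro: Jac_left_character\<close>)
    also have "\<dots> \<le> 2 * real M ^ 7 * real N ^ 8 * (1 + ln (real X)) ^ 28"
      using ln X by (intro mult_left_mono power_mono) auto
    finally have "?S ^ 8 * real V \<le> (2 * real M ^ 7 * real N ^ 8 * (1 + ln (real X)) ^ 28) * real M"
      using X by (intro mult_mono) auto
    also have "\<dots> = 2 * (real M * real N) ^ 8 * (1 + ln (real X)) ^ 28"
      by (simp add: power_mult_distrib power_Suc[of _ 7, simplified])
    finally show ?thesis .
  next
    case False
    have "?S = (\<Sum>n\<in>B. \<Sum>m\<in>A. b n * a m * rJac (int m) n)"
    proof (subst sum.swap, intro sum.cong refl)
      fix n m assume "n \<in> B" "m \<in> A"
      then have "Jac (int n) m = Jac (int m) n" using A B Jac_reciprocity[of m n] by auto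
      then show "a m * b n * rJac (int n) m = b n * a m * rJac (int m) n" by simp
    qed
    then have "?S ^ 8 = (\<Sum>n\<in>B. \<Sum>m\<in>A. b n * a m * rJac (int m) n) ^ 8" by simp
    also have "\<dots> \<le> 2 * real N ^ 7 * real M ^ 8 * (1 + ln (real M)) ^ 28"
    proof (rule bilinear_character_bound[OF B(1) A(1) _ _ _ _ b a])
      fix m m' y assume "m \<in> B" "m' \<in> B" "m \<noteq> m'"
      then show "\<bar>\<Sum>k=1..y. rJac (int k) m * rJac (int k) m'\<bar> \<le> real N ^ 2"
        using B by (intro orth) auto
    qed (use X B False in \<open>auto intro: Jac_left_character\<close>)
    also have "\<dots> \<le> 2 * real N ^ 7 * real M ^ 8 * (1 + ln (real X)) ^ 28"
      using ln X by (intro mult_left_mono power_mono) auto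
    finally have "?S ^ 8 * real V \<le> (2 * real N ^ 7 * real M ^ 8 * (1 + ln (real X)) ^ 28) * real N"
      using X by (intro mult_mono) auto
    also have "\<dots> = 2 * (real M * real N) ^ 8 * (1 + ln (real X)) ^ 28"
      by (simp add: power_mult_distrib power_Suc[of _ 7, simplified])
    finally show ?thesis .
  qed
qed

section \<open>Counting squarefree numbers in residue sets\<close>

lemma card_filter_eq_sum_indicator:
  "finite A \<Longrightarrow> real (card {x \<in> A. x \<in> S}) = (\<Sum>x\<in>A. indicator S x)"
  by (simp add: indicator_def sum.If_cases Int_def)

text \<open>This is \<open>split_set\<close> for the character \<open>Jac a\<close>. As
  \<open>Jac\<close> vanishes at even moduli, membership forces \<open>n\<close> to be odd.\<close>

definition residue_set :: "int \<Rightarrow> nat set" where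
  "residue_set a = {n. n > 0 \<and> (\<forall>p. prime p \<longrightarrow> p dvd n \<longrightarrow> Jac a p = 1)}"

lemma split_set_Jac: "real_character.split_set (\<lambda>n. rJac a n) = residue_set a"
  by (simp add: Jac_right.split_set_def residue_set_def)

lemma residue_set_minus_1: "n \<in> residue_set (-1) \<longleftrightarrow> primes_1_mod_4 n"
proof -
  have "Jac (-1) p = 1 \<longleftrightarrow> p mod 4 = 1" if "prime p" for p :: nat
  proof (cases "odd p")
    case False
    then have "p mod 4 \<noteq> 1" by presburger
    then show ?thesis using False by simp
  qed (simp add: Jac_minus_1)
  then show ?thesis by (auto simp: residue_set_def primes_1_mod_4_def)
qed

lemma residue_set_odd: "n \<in> residue_set a \<Longrightarrow> odd n"
  by (auto simp: residue_set_def dest: spec[of _ 2])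

lemma residue_set_dvd: "n \<in> residue_set a \<Longrightarrow> d dvd n \<Longrightarrow> d \<in> residue_set a"
  using Jac_right.split_set_dvd[of n a d] by (simp add: split_set_Jac)

lemma sum_residue_set_le:
  assumes "q \<ge> (1::nat)" "\<And>y. \<bar>\<Sum>n=1..y. rJac a n\<bar> \<le> real q" "x \<ge> 1"
  shows "(\<Sum>m\<in>{1..x} \<inter> residue_set a. 1 / real m)\<^sup>2 \<le> (1 + 2 * ln (real x)) * (3 + ln (real q))"
  using Jac_right.sum_split_set_le[OF assms] by (simp add: split_set_Jac)

text \<open>The indicator function of the set does not grow when a prime is multiplied in, so its
  mean is controlled by its logarithmic mean. The outcome is of order
  \<open>x * sqrt (ln q / ln x)\<close>, the saving expected when half of the primes are
  forbidden.\<close>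

lemma card_squarefree_residue_set_le:
  assumes q: "q \<ge> (1::nat)" "\<And>y. \<bar>\<Sum>n=1..y. rJac a n\<bar> \<le> real q" and x: "x \<ge> 2"
  shows "real (card {n \<in> {1..x}. squarefree n \<and> n \<in> residue_set a})
    \<le> 3 * real x / ln (real x) * sqrt ((1 + 2 * ln (real x)) * (3 + ln (real q)))"
proof -
  let ?S = "{n. squarefree n \<and> n \<in> residue_set a}"
  define f :: "nat \<Rightarrow> real" where "f n = indicator ?S n" for n
  have "real (card {n \<in> {1..x}. squarefree n \<and> n \<in> residue_set a}) = (\<Sum>n=1..x. f n)"
    unfolding f_def using card_filter_eq_sum_indicator[of "{1..x}" ?S] by simp
  also have "\<dots> \<le> 3 * real x / ln (real x) * (\<Sum>m=1..x. f m / real m)"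
  proof (rule sum_submultiplicative_le)
    fix m p :: nat assume "prime p"
    have "m * p \<in> ?S \<Longrightarrow> m \<in> ?S"
      using squarefree_mono[of m "m * p"] residue_set_dvd[of "m * p" a m] by auto
    then show "f (m * p) \<le> f m" by (auto simp: f_def indicator_def)
  qed (use x in \<open>auto simp: f_def indicator_def split: if_splits\<close>)
  also have "\<dots> \<le> 3 * real x / ln (real x) * sqrt ((1 + 2 * ln (real x)) * (3 + ln (real q)))"
  proof (rule mult_left_mono)
    have "(\<Sum>m=1..x. f m / real m) = (\<Sum>m\<in>{1..x} \<inter> ?S. 1 / real m)"
      by (rule sum.mono_neutral_cong_right) (auto simp: f_def indicator_def)
    also have "\<dots> \<le> (\<Sum>m\<in>{1..x} \<inter> residue_set a. 1 / real m)"
      by (rule sum_mono2) auto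
    also have "\<dots> \<le> sqrt ((1 + 2 * ln (real x)) * (3 + ln (real q)))"
      using sum_residue_set_le[OF q, of x] x by (intro real_le_rsqrt) auto
    finally show "(\<Sum>m=1..x. f m / real m) \<le> sqrt ((1 + 2 * ln (real x)) * (3 + ln (real q)))" .
  qed (use x in auto)
  finally show ?thesis .
qed

text \<open>On squarefree \<open>k\<close> this is the product over the primes of \<open>k\<close>
  of 1 if the prime is 1 modulo 4 and of 1/2 otherwise. It collects the weights
  \<open>1 / (tau a * tau b)\<close> over the factorizations \<open>k = a * b\<close> with
  \<open>a\<close> composed of primes 1 modulo 4.\<close>

definition divisor_ratio :: "nat \<Rightarrow> real" where
  "divisor_ratio k = (if squarefree k then real (card {a. a dvd k \<and> primes_1_mod_4 a}) / real (tau k) else 0)"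

lemma tau_prime: "prime p \<Longrightarrow> tau p = 2"
proof -
  assume p: "prime p"
  then have "{d. d dvd p} = {1, p}" by (auto simp: prime_nat_iff)
  then show ?thesis using p prime_gt_1_nat[OF p] by (simp add: tau_def)
qed

lemma squarefree_mult_imp_coprime:
  fixes m n :: nat assumes "squarefree (m * n)" shows "coprime m n"
proof (rule coprimeI)
  fix c assume "c dvd m" "c dvd n"
  then have "c\<^sup>2 dvd m * n" by (simp add: power2_eq_square mult_dvd_mono)
  then show "is_unit c" by (rule squarefreeD[OF assms])
qed

text \<open>A new prime doubles \<open>tau\<close> and at most doubles the number of admissible
  divisors.\<close>

lemma divisor_ratio_mult_le:
  assumes p: "prime p" shows "divisor_ratio (m * p) \<le> divisor_ratio m"
proof (cases "squarefree (m * p)")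
  case True
  let ?S = "{a. a dvd m \<and> primes_1_mod_4 a}"
  have m0: "m > 0" using True by (auto intro: Nat.gr0I)
  have sq: "squarefree m" using True squarefree_mono by (metis dvd_triv_left)
  have cop: "coprime m p" using True squarefree_mult_imp_coprime by blast
  have tau: "tau (m * p) = tau m * 2"
    using tau_coprime_mult[OF cop m0] p by (simp add: tau_prime prime_gt_0_nat)
  have fin: "finite ?S" using m0 by simp
  have "{a. a dvd m * p \<and> primes_1_mod_4 a} \<subseteq> ?S \<union> (\<lambda>b. b * p) ` ?S"
  proof
    fix a assume "a \<in> {a. a dvd m * p \<and> primes_1_mod_4 a}"
    then have a: "a dvd m * p" "primes_1_mod_4 a" by auto
    then obtain b c where bc: "a = b * c" "b dvd m" "c dvd p" using division_decomp by blast
    then have "c = 1 \<or> c = p" using p by (auto simp: prime_nat_iff)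
    moreover have "primes_1_mod_4 b" using a(2) bc(1) by (auto simp: primes_1_mod_4_def)
    ultimately show "a \<in> ?S \<union> (\<lambda>b. b * p) ` ?S" using bc by auto
  qed
  then have "card {a. a dvd m * p \<and> primes_1_mod_4 a} \<le> card (?S \<union> (\<lambda>b. b * p) ` ?S)"
    using fin by (intro card_mono) auto
  also have "\<dots> \<le> card ?S + card ((\<lambda>b. b * p) ` ?S)" by (rule card_Un_le)
  also have "\<dots> \<le> card ?S + card ?S" using fin by (intro add_left_mono card_image_le)
  finally have "real (card {a. a dvd m * p \<and> primes_1_mod_4 a}) \<le> 2 * real (card ?S)" by simp
  then show ?thesis using True sq tau_pos[OF m0] by (simp add: divisor_ratio_def tau field_simps)
qed (simp add: divisor_ratio_def)

text \<open>The average weight of a prime is 3/4, so the sum has order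
  \<open>x / (ln x) ^ (1/4)\<close>. The logarithmic mean is majorised by a product of two
  independent sums: the one over \<open>a\<close>, with both the weight \<open>1 / tau\<close> and
  half of the primes, gives a fourth root of the logarithm, the one over \<open>b\<close> a square
  root.\<close>

lemma sum_divisor_ratio_le:
  assumes x: "x \<ge> 2"
  shows "(\<Sum>k=1..x. divisor_ratio k) \<le> 3 * real x / ln (real x) *
     (sqrt (sqrt ((1 + 4 * ln (real x)) * (3 + ln 4))) * sqrt (1 + 2 * ln (real x)))"
proof -
  let ?P = "residue_set (-1)"
  define F :: "nat \<Rightarrow> nat \<Rightarrow> real" where
    "F a b = (indicator ?P a / real (tau a) / real a) * (1 / real (tau b) / real b)" for a b
  have F_nonneg: "F a b \<ge> 0" for a b by (simp add: F_def)
  have "(\<Sum>k=1..x. divisor_ratio k) \<le> 3 * real x / ln (real x) * (\<Sum>k=1..x. divisor_ratio k / real k)"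
    by (rule sum_submultiplicative_le)
      (use x divisor_ratio_mult_le in \<open>auto simp: divisor_ratio_def split: if_splits\<close>)
  also have "\<dots> \<le> 3 * real x / ln (real x) *
     (sqrt (sqrt ((1 + 4 * ln (real x)) * (3 + ln 4))) * sqrt (1 + 2 * ln (real x)))"
  proof (rule mult_left_mono)
    have "(\<Sum>k=1..x. divisor_ratio k / real k) \<le> (\<Sum>k=1..x. \<Sum>d | d dvd k. F d (k div d))"
    proof (rule sum_mono)
      fix k assume k: "k \<in> {1..x}"
      show "divisor_ratio k / real k \<le> (\<Sum>d | d dvd k. F d (k div d))"
      proof (cases "squarefree k")
        case True
        have "divisor_ratio k / real k = (\<Sum>d | d dvd k. indicator ?P d / real (tau k) / real k)"
          using True k card_filter_eq_sum_indicator[of "{d. d dvd k}" ?P]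
          by (simp add: divisor_ratio_def residue_set_minus_1 flip: sum_divide_distrib)
        also have "\<dots> = (\<Sum>d | d dvd k. F d (k div d))"
        proof (rule sum.cong)
          fix d assume d: "d \<in> {d. d dvd k}"
          then have kd: "k = d * (k div d)" by simp
          then have "tau k = tau d * tau (k div d)"
            using tau_coprime_mult[of d "k div d"] squarefree_mult_imp_coprime[of d "k div d"] True k
            by (metis atLeastAtMost_iff gr0I mult_is_0 not_one_le_zero)
          moreover have "real k = real d * real (k div d)" using kd by (metis of_nat_mult)
          ultimately show "indicator ?P d / real (tau k) / real k = F d (k div d)"
            by (simp add: F_def)
        qed simp
        finally show ?thesis by simp
      qed (simp add: divisor_ratio_def F_nonneg sum_nonneg)
    qed
    also have "\<dots> = (\<Sum>b=1..x. \<Sum>a=1..x div b. F a b)" by (rule sum_divisors_swap)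
    also have "\<dots> \<le> (\<Sum>b=1..x. \<Sum>a=1..x. F a b)"
      by (intro sum_mono sum_mono2) (auto simp: F_nonneg intro: order_trans[OF _ div_le_dividend])
    also have "\<dots> = (\<Sum>a=1..x. indicator ?P a / real (tau a) / real a) * (\<Sum>b=1..x. 1 / real (tau b) / real b)"
      unfolding F_def by (subst sum.swap) (simp only: sum_product)
    also have "(\<Sum>a=1..x. indicator ?P a / real (tau a) / real a) = (\<Sum>a\<in>{1..x} \<inter> ?P. 1 / real (tau a) / real a)"
      by (rule sum.mono_neutral_cong_right) (auto simp: indicator_def)
    also have "\<dots> * (\<Sum>b=1..x. 1 / real (tau b) / real b) \<le> sqrt (sqrt ((1 + 4 * ln (real x)) * (3 + ln 4))) * sqrt (1 + 2 * ln (real x))"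
    proof (rule mult_mono)
      have x2: "ln (real (x\<^sup>2)) = 2 * ln (real x)" using x by (simp add: ln_realpow)
      have "(\<Sum>a\<in>{1..x} \<inter> ?P. 1 / real (tau a) / real a)\<^sup>2 \<le> (\<Sum>n\<in>{1..x\<^sup>2} \<inter> ?P. 1 / real n)"
        using Jac_right.split_set_mult[of _ "-1"]
        by (intro sum_inverse_tau_le) (auto simp: split_set_Jac)
      also have "\<dots> \<le> sqrt ((1 + 4 * ln (real x)) * (3 + ln 4))"
        using sum_residue_set_le[of 4 "-1" "x\<^sup>2"] sum_Jac_minus_1_bound x
        unfolding x2 by (intro real_le_rsqrt) (auto simp: Suc_le_eq)
      finally show "(\<Sum>a\<in>{1..x} \<inter> ?P. 1 / real (tau a) / real a) \<le> sqrt (sqrt ((1 + 4 * ln (real x)) * (3 + ln 4)))"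
        by (rule real_le_rsqrt)
      have "(\<Sum>b\<in>{1..x} \<inter> UNIV. 1 / real (tau b) / real b)\<^sup>2 \<le> (\<Sum>n\<in>{1..x\<^sup>2} \<inter> UNIV. 1 / real n)"
        by (rule sum_inverse_tau_le) simp
      also have "\<dots> \<le> 1 + 2 * ln (real x)"
        using sum_inverse_le[of "x\<^sup>2"] x unfolding x2 by (simp add: Suc_le_eq)
      finally show "(\<Sum>b=1..x. 1 / real (tau b) / real b) \<le> sqrt (1 + 2 * ln (real x))"
        by (intro real_le_rsqrt) simp
    qed (use x in \<open>auto intro: sum_nonneg\<close>)
    finally show "(\<Sum>k=1..x. divisor_ratio k / real k) \<le> sqrt (sqrt ((1 + 4 * ln (real x)) * (3 + ln 4))) * sqrt (1 + 2 * ln (real x))" .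
  qed (use x in auto)
  finally show ?thesis .
qed

section \<open>Character expansion of the solubility conditions\<close>

lemma Jac_eq_0_iff:
  assumes "odd m"
  shows "Jac (int n) m = 0 \<longleftrightarrow> \<not> coprime n m"
  using assms
proof (induction m rule: prime_divisors_induct)
  case (factor p m)
  then have "Jac (int n) p = 0 \<longleftrightarrow> p dvd n"
    by (auto simp: Jac_prime Legendre_def cong_0_iff)
  moreover have "coprime n p \<longleftrightarrow> \<not> p dvd n"
    using factor(1) by (metis coprime_commute coprime_absorb_left not_prime_unit prime_imp_coprime)
  ultimately show ?case using factor by (auto simp: Jac_mult_right)
qed auto

text \<open>One term of the product of the two normalised divisor sums that detect the conditions on
  \<open>d\<close> and on \<open>e\<close>, with the symbols between \<open>d1\<close> and
  \<open>e1\<close> already cancelled. The integers \<open>w\<close> and \<open>u\<close> carry the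
  powers of 2.\<close>

definition char_term :: "int \<Rightarrow> int \<Rightarrow> nat \<Rightarrow> nat \<Rightarrow> nat \<Rightarrow> nat \<Rightarrow> real" where
  "char_term w u d1 d2 e1 e2 = rJac w d1 / real (tau d1) * (rJac u e1 / real (tau e1))
     * (1 / real (tau d2)) * (1 / real (tau e2)) * rJac (int e2) d1 * rJac (int e1) d2"

definition base_pair :: "nat \<Rightarrow> nat \<Rightarrow> bool" where
  "base_pair d e \<longleftrightarrow> squarefree (d * e) \<and> primes_1_mod_4 d \<and> odd e"

text \<open>These are the necessary conditions for local solubility at the odd primes dividing
  \<open>d * e\<close>; they are used for upper bounds only. \<open>base_pair\<close> retains just
  what is needed to expand the symbol conditions.\<close>

definition solvable_pair :: "int \<Rightarrow> int \<Rightarrow> nat \<Rightarrow> nat \<Rightarrow> bool" where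
  "solvable_pair w u d e \<longleftrightarrow> squarefree (d * e) \<and> primes_1_mod_4 d \<and> d \<in> residue_set (w * int e) \<and> e \<in> residue_set (u * int d)"

lemma base_pair_pos: "base_pair d e \<Longrightarrow> d > 0 \<and> e > 0"
  by (auto simp: base_pair_def intro: Nat.gr0I)

text \<open>Reciprocity makes the two symbols between \<open>d1\<close> and \<open>e1\<close> equal,
  and coprimality makes their product 1. Only the crossed symbols (e2/d1) and (e1/d2) are left,
  which is what produces a bilinear form in two independent pairs of variables.\<close>

lemma char_term_eq:
  assumes "base_pair (d1 * d2) (e1 * e2)"
  shows "rJac (w * int (e1 * e2)) d1 * rJac (u * int (d1 * d2)) e1
     / (real (tau (d1 * d2)) * real (tau (e1 * e2))) = char_term w u d1 d2 e1 e2"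
proof -
  have sq: "squarefree ((d1 * d2) * (e1 * e2))" and P: "primes_1_mod_4 (d1 * d2)" and odd: "odd (e1 * e2)"
    using assms by (auto simp: base_pair_def)
  have pos: "d1 > 0" "d2 > 0" "e1 > 0" "e2 > 0" using base_pair_pos[OF assms] by auto
  have P12: "primes_1_mod_4 d1" "primes_1_mod_4 d2"
    using P pos by (auto simp: primes_1_mod_4_def)
  have "coprime (d1 * d2) (e1 * e2)" using sq by (rule squarefree_mult_imp_coprime)
  then have cop: "coprime e1 d1" by (simp add: coprime_commute)
  have "squarefree (d1 * d2)" "squarefree (e1 * e2)" using squarefree_multD[OF sq] by auto
  then have "coprime d1 d2" "coprime e1 e2" by (auto intro: squarefree_mult_imp_coprime)
  then have tau: "tau (d1 * d2) = tau d1 * tau d2" "tau (e1 * e2) = tau e1 * tau e2"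
    using pos tau_coprime_mult by auto
  have r: "Jac (int d1) e1 = Jac (int e1) d1" "Jac (int d2) e1 = Jac (int e1) d2"
    using Jac_reciprocity P12 odd by auto
  have "Jac (int e1) d1 \<noteq> 0" using Jac_eq_0_iff[of d1 e1] primes_1_mod_4_odd[OF P12(1)] cop by simp
  then have one: "Jac (int e1) d1 * Jac (int e1) d1 = 1" using Jac_vals[of "int e1" d1] by auto
  have "Jac (w * int (e1 * e2)) d1 * Jac (u * int (d1 * d2)) e1
    = (Jac (int e1) d1 * Jac (int e1) d1) * (Jac w d1 * Jac (int e2) d1 * (Jac u e1 * Jac (int e1) d2))"
    by (simp add: Jac_mult_left r)
  also have "\<dots> = Jac w d1 * Jac (int e2) d1 * (Jac u e1 * Jac (int e1) d2)"
    unfolding one by simp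
  finally have "real_of_int (Jac (w * int (e1 * e2)) d1 * Jac (u * int (d1 * d2)) e1)
    = real_of_int (Jac w d1 * Jac (int e2) d1 * (Jac u e1 * Jac (int e1) d2))" by (rule arg_cong)
  then show ?thesis by (simp add: char_term_def tau mult_ac)
qed

lemma solvable_imp_base: "solvable_pair w u d e \<Longrightarrow> base_pair d e"
  using residue_set_odd by (auto simp: solvable_pair_def base_pair_def)

text \<open>The right side is the product of two divisor sums of real characters, divided by
  \<open>tau d * tau e\<close>. It is 1 on a solvable pair, and nonnegative on every other base
  pair.\<close>

lemma indicator_solvable_le:
  assumes "base_pair d e"
  shows "indicator {(d, e). solvable_pair w u d e} (d, e)
    \<le> (\<Sum>d1 | d1 dvd d. \<Sum>e1 | e1 dvd e. char_term w u d1 (d div d1) e1 (e div e1))"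
proof -
  have pos: "d > 0" "e > 0" using base_pair_pos assms by auto
  let ?R = "(\<Sum>d1 | d1 dvd d. rJac (w * int e) d1) * (\<Sum>e1 | e1 dvd e. rJac (u * int d) e1)
       / (real (tau d) * real (tau e))"
  have "(\<Sum>d1 | d1 dvd d. \<Sum>e1 | e1 dvd e. char_term w u d1 (d div d1) e1 (e div e1))
     = (\<Sum>d1 | d1 dvd d. \<Sum>e1 | e1 dvd e. rJac (w * int e) d1 * rJac (u * int d) e1
       / (real (tau d) * real (tau e)))"
  proof (intro sum.cong refl)
    fix d1 e1 assume "d1 \<in> {d1. d1 dvd d}" "e1 \<in> {e1. e1 dvd e}"
    then have de: "d = d1 * (d div d1)" "e = e1 * (e div e1)" by auto
    show "char_term w u d1 (d div d1) e1 (e div e1) = rJac (w * int e) d1 * rJac (u * int d) e1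
       / (real (tau d) * real (tau e))"
      using char_term_eq[of d1 "d div d1" e1 "e div e1" w u] assms de by simp
  qed
  also have "\<dots> = ?R" by (simp add: sum_product sum_divide_distrib)
  finally have eq: "(\<Sum>d1 | d1 dvd d. \<Sum>e1 | e1 dvd e. char_term w u d1 (d div d1) e1 (e div e1)) = ?R" .
  show ?thesis
  proof (cases "solvable_pair w u d e")
    case True
    then have "(\<Sum>d1 | d1 dvd d. rJac (w * int e) d1) = real (tau d)"
      "(\<Sum>e1 | e1 dvd e. rJac (u * int d) e1) = real (tau e)"
      using Jac_right.divisor_sum_split by (auto simp: split_set_Jac solvable_pair_def)
    then show ?thesis unfolding eq using tau_pos pos by (simp add: indicator_def)
  next
    case False
    have "?R \<ge> 0"
      by (intro divide_nonneg_nonneg mult_nonneg_nonneg Jac_right.divisor_sum_nonneg pos) auto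
    then show ?thesis unfolding eq using False by (simp add: indicator_def)
  qed
qed

section \<open>Bilinear sums over a dyadic box\<close>

definition log_size :: "nat \<Rightarrow> real" where "log_size N = 1 + ln (2 * real N)"

lemma sum_Times_product:
  fixes f :: "'a \<Rightarrow> real"
  shows "(\<Sum>p\<in>A \<times> B. f (fst p) * g (snd p)) = (\<Sum>a\<in>A. f a) * (\<Sum>b\<in>B. g b)"
  by (simp add: sum_product sum.cartesian_product case_prod_beta)

text \<open>\<open>m\<close> and \<open>n\<close> are the two long variables joined by the symbol
  (n/m), and \<open>d\<close>, \<open>e\<close> are their cofactors. The predicate \<open>Q\<close>
  admits a further restriction on the cofactors, to keep two such ranges disjoint.\<close>

definition box_quads :: "nat \<Rightarrow> nat \<Rightarrow> nat \<Rightarrow> nat \<Rightarrow> (nat \<Rightarrow> nat \<Rightarrow> bool) \<Rightarrow> (nat \<times> nat \<times> nat \<times> nat) set" where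
  "box_quads V W D E Q = {(m,d,e,n). squarefree ((m * d) * (e * n)) \<and> primes_1_mod_4 m \<and> primes_1_mod_4 d
     \<and> odd e \<and> odd n \<and> V < m \<and> V < n \<and> D < m * d \<and> m * d \<le> 2 * D \<and> e * n \<le> E \<and> W < m * d \<and> W < e * n \<and> Q d e}"

text \<open>For fixed \<open>d\<close> and \<open>e\<close> the sum is bilinear in \<open>m\<close>
  and \<open>n\<close>. The exponent is 68 = 28 + 8 * 5: after the loss \<open>L ^ 28\<close> of the
  eighth-power estimate, the eighth root still saves \<open>L ^ 5\<close>; summing
  \<open>1 / (d * e)\<close> costs \<open>L ^ 2\<close> and leaves \<open>L ^ 3\<close>. The 2
  inside \<open>log_size\<close> accounts for \<open>m * d\<close> reaching
  \<open>2 * D\<close>.\<close>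

lemma box_sum_bound:
  fixes al be :: "nat \<Rightarrow> real" and ka :: "nat \<Rightarrow> nat \<Rightarrow> real" and Q :: "nat \<Rightarrow> nat \<Rightarrow> bool" and W :: nat
  assumes al: "\<And>m. \<bar>al m\<bar> \<le> 1" and be: "\<And>m. \<bar>be m\<bar> \<le> 1" and ka: "\<And>d e. \<bar>ka d e\<bar> \<le> 1"
    and V: "real V \<ge> log_size N ^ 68" and DE: "D * E \<le> N" "D \<ge> 1" and N: "N \<ge> 1"
  defines "Z \<equiv> box_quads V W D E Q"
  shows "\<bar>\<Sum>(m,d,e,n)\<in>Z. ka d e * al m * be n * rJac (int n) m\<bar> \<le> 4 * real N / log_size N ^ 3"
proof (cases "E \<ge> 1")
  case False
  then have "Z = {}" by (auto simp: Z_def box_quads_def)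
  have "log_size N \<ge> 0" using N by (simp add: log_size_def)
  then show ?thesis unfolding \<open>Z = {}\<close> by simp
next
  case E: True
  define L where "L = log_size N"
  have L: "L \<ge> 1" using N by (simp add: L_def log_size_def)
  have "L ^ 68 \<ge> 1" using L by (rule one_le_power)
  then have "real V > 0" using V unfolding L_def[symmetric] by linarith
  then have V1: "V \<ge> 1" by simp
  define G where "G = {(d,e). d \<in> {1..2*D} \<and> e \<in> {1..E} \<and> squarefree (d * e) \<and> primes_1_mod_4 d \<and> odd e \<and> Q d e}"
  define A where "A d e = {m \<in> {1..2 * D div d}. squarefree m \<and> primes_1_mod_4 m \<and> coprime m (d * e) \<and> V < m \<and> D < m * d \<and> W < m * d}" for d e
  define B where "B d e = {n \<in> {1..E div e}. squarefree n \<and> odd n \<and> coprime n (d * e) \<and> V < n \<and> W < e * n}" for d e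
  define tm where "tm d e m n = ka d e * al m * be n * rJac (int n) m" for d e m n
  have finG: "finite G"
    by (rule finite_subset[of _ "{1..2*D} \<times> {1..E}"]) (auto simp: G_def)
  have finA: "finite (A d e)" and finB: "finite (B d e)" for d e by (auto simp: A_def B_def)
  \<comment> \<open>\<open>Z'\<close> drops the coprimality of \<open>m\<close> and
    \<open>n\<close>, the only condition that links these variables once \<open>d\<close> and
    \<open>e\<close> are fixed.\<close>
  define Z' where "Z' = (\<lambda>((d,e),(m,n)). (m,d,e,n)) ` (SIGMA p:G. A (fst p) (snd p) \<times> B (fst p) (snd p))"
  have inj: "inj_on (\<lambda>((d,e),(m,n)). (m,d,e,n)) S" for S :: "((nat \<times> nat) \<times> (nat \<times> nat)) set"
    by (auto simp: inj_on_def)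
  have finZ': "finite Z'" unfolding Z'_def using finG finA finB by (intro finite_imageI finite_SigmaI finite_cartesian_product) auto
  have sub: "Z \<subseteq> Z'"
  proof
    fix z assume "z \<in> Z"
    then obtain m d e n where z: "z = (m,d,e,n)" and sq: "squarefree ((m * d) * (e * n))"
      and h: "primes_1_mod_4 m" "primes_1_mod_4 d" "odd e" "odd n" "V < m" "V < n" "D < m * d" "m * d \<le> 2 * D"
        "e * n \<le> E" "W < m * d" "W < e * n" "Q d e" by (auto simp: Z_def box_quads_def)
    have "(m * d) * (e * n) \<noteq> 0" using sq by (intro notI) simp
    then have pos: "m > 0" "d > 0" "e > 0" "n > 0" by auto
    have "squarefree ((d * e) * (m * n))" using sq by (simp add: mult_ac)
    then have c: "squarefree (d * e)" "coprime (d * e) (m * n)" "squarefree (m * n)"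
      using squarefree_mult_imp_coprime squarefree_multD by blast+
    then have sqmn: "squarefree m" "squarefree n" using squarefree_multD by blast+
    have "d \<le> m * d" "e \<le> e * n" using pos by auto
    then have "d \<le> 2 * D" "e \<le> E" using h by linarith+
    then have "(d, e) \<in> G" using pos h c by (simp add: G_def)
    moreover have "m \<in> A d e" using pos h c sqmn
      by (simp add: A_def less_eq_div_iff_mult_less_eq coprime_commute)
    moreover have "n \<in> B d e" using pos h c sqmn
      by (simp add: B_def less_eq_div_iff_mult_less_eq coprime_commute mult.commute)
    ultimately show "z \<in> Z'" unfolding Z'_def z by force
  qed
  \<comment> \<open>The terms added in passing to \<open>Z'\<close> vanish, because the symbol is 0
    when its arguments have a common factor.\<close>
  have zero: "Jac (int n) m = 0" if "(m,d,e,n) \<in> Z' - Z" for m d e n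
  proof -
    have "(d,e) \<in> G" "m \<in> A d e" "n \<in> B d e" using that by (auto simp: Z'_def)
    then have h: "d \<ge> 1" "e \<ge> 1" "squarefree (d * e)" "primes_1_mod_4 d" "odd e" "Q d e" "squarefree m" "primes_1_mod_4 m"
       "coprime m (d * e)" "V < m" "D < m * d" "W < m * d" "m \<le> 2 * D div d"
       "n \<le> E div e" "squarefree n" "odd n" "coprime n (d * e)" "V < n" "W < e * n"
      by (auto simp: A_def B_def G_def)
    have "m * d \<le> 2 * D" "e * n \<le> E" using h by (simp_all add: less_eq_div_iff_mult_less_eq mult.commute)
    then have "\<not> squarefree ((m * d) * (e * n))" using that h by (auto simp: Z_def box_quads_def)
    moreover have "squarefree ((m * d) * (e * n))" if "coprime n m"
    proof -
      have "squarefree (m * n)" using h that by (intro squarefree_mult_coprime) (auto simp: coprime_commute)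
      moreover have "coprime (m * n) (d * e)" using h by (simp only: coprime_mult_left_iff)
      ultimately have "squarefree ((m * n) * (d * e))" using h by (intro squarefree_mult_coprime[of "m * n" "d * e"]) simp_all
      then show ?thesis by (simp add: mult_ac)
    qed
    ultimately show ?thesis using Jac_eq_0_iff[of m n] primes_1_mod_4_odd h by auto
  qed
  have "(\<Sum>(m,d,e,n)\<in>Z. ka d e * al m * be n * rJac (int n) m) =
     (\<Sum>(m,d,e,n)\<in>Z'. ka d e * al m * be n * rJac (int n) m)"
    by (rule sum.mono_neutral_left[OF finZ' sub]) (use zero in auto)
  also have "\<dots> = (\<Sum>((d,e),(m,n))\<in>(SIGMA p:G. A (fst p) (snd p) \<times> B (fst p) (snd p)). tm d e m n)"
    unfolding Z'_def by (subst sum.reindex[OF inj]) (auto intro!: sum.cong simp: tm_def)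
  also have "\<dots> = (\<Sum>p\<in>G. \<Sum>m\<in>A (fst p) (snd p). \<Sum>n\<in>B (fst p) (snd p). tm (fst p) (snd p) m n)"
    by (subst sum.Sigma[symmetric]) (use finG finA finB in \<open>auto simp: sum.cartesian_product case_prod_beta\<close>)
  finally have eq: "(\<Sum>(m,d,e,n)\<in>Z. ka d e * al m * be n * rJac (int n) m) =
     (\<Sum>p\<in>G. \<Sum>m\<in>A (fst p) (snd p). \<Sum>n\<in>B (fst p) (snd p). tm (fst p) (snd p) m n)" .
  have "D * 1 \<le> D * E" "1 * E \<le> D * E" using DE E by (intro mult_le_mono; simp)+
  then have DEN: "D \<le> N" "E \<le> N" using DE by linarith+
  have inner: "\<bar>\<Sum>m\<in>A d e. \<Sum>n\<in>B d e. tm d e m n\<bar> \<le> 4 * real N / L ^ 5 * (1 / real d * (1 / real e))"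
    if de: "(d, e) \<in> G" for d e
  proof (cases "A d e = {} \<or> B d e = {}")
    case True
    then have "(\<Sum>m\<in>A d e. \<Sum>n\<in>B d e. tm d e m n) = 0" by auto
    then show ?thesis using L by simp
  next
    case False
    define I where "I = (\<Sum>m\<in>A d e. \<Sum>n\<in>B d e. tm d e m n)"
    define M where "M = 2 * D div d"
    define K where "K = E div e"
    have VMK: "V \<le> M" "V \<le> K" using False by (auto simp: A_def B_def M_def K_def)
    have "M \<le> 2 * D" "K \<le> E" unfolding M_def K_def by (rule div_le_dividend)+
    then have MKN: "M \<le> 2 * N" "K \<le> 2 * N" using DEN by linarith+
    have "(\<Sum>m\<in>A d e. \<Sum>n\<in>B d e. (ka d e * al m) * be n * rJac (int n) m) ^ 8 * real V
      \<le> 2 * (real M * real K) ^ 8 * (1 + ln (real (2 * N))) ^ 28"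
    proof (rule bilinear_Jac_bound[OF _ _ _ _ V1 VMK MKN])
      show "\<bar>ka d e * al m\<bar> \<le> 1" for m unfolding abs_mult using ka al by (intro mult_le_one) auto
    qed (auto simp: A_def B_def M_def K_def be)
    then have "I ^ 8 * real V \<le> 2 * (real M * real K) ^ 8 * L ^ 28"
      by (simp add: I_def tm_def L_def log_size_def)
    moreover have "I ^ 8 * L ^ 68 \<le> I ^ 8 * real V" using V by (intro mult_left_mono) (auto simp: L_def)
    ultimately have "(I ^ 8 * L ^ 40) * L ^ 28 \<le> (2 * (real M * real K) ^ 8) * L ^ 28"
      by (simp add: mult.assoc flip: power_add)
    then have "I ^ 8 * L ^ 40 \<le> 2 * (real M * real K) ^ 8" using L by (simp add: mult_le_cancel_right)
    also have "\<dots> \<le> (2 * (real M * real K)) ^ 8" unfolding power_mult_distrib by (intro mult_right_mono) auto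
    finally have "(\<bar>I\<bar> * L ^ 5) ^ 8 \<le> (2 * (real M * real K)) ^ 8"
      by (simp add: power_mult_distrib power_even_abs flip: power_mult)
    then have "\<bar>I\<bar> * L ^ 5 \<le> 2 * (real M * real K)"
      by (rule power_le_imp_le_base[of _ 7, simplified]) simp
    also have "real M * real K \<le> real (2 * D) / real d * (real E / real e)"
      unfolding M_def K_def by (intro mult_mono of_nat_div_le_of_nat) auto
    also have "\<dots> = 2 * real (D * E) * (1 / real d * (1 / real e))" by simp
    also have "\<dots> \<le> 2 * real N * (1 / real d * (1 / real e))"
      using DE by (intro mult_right_mono mult_left_mono) (simp_all del: of_nat_mult)
    finally have "\<bar>I\<bar> * L ^ 5 \<le> 4 * real N * (1 / real d * (1 / real e))" by simp
    then have "\<bar>I\<bar> \<le> 4 * real N * (1 / real d * (1 / real e)) / L ^ 5" using L by (subst pos_le_divide_eq) auto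
    then show ?thesis by (simp add: I_def mult_ac)
  qed
  have "\<bar>\<Sum>p\<in>G. \<Sum>m\<in>A (fst p) (snd p). \<Sum>n\<in>B (fst p) (snd p). tm (fst p) (snd p) m n\<bar>
     \<le> (\<Sum>p\<in>G. \<bar>\<Sum>m\<in>A (fst p) (snd p). \<Sum>n\<in>B (fst p) (snd p). tm (fst p) (snd p) m n\<bar>)" by (rule sum_abs)
  also have "\<dots> \<le> (\<Sum>p\<in>G. 4 * real N / L ^ 5 * (1 / real (fst p) * (1 / real (snd p))))"
    by (rule sum_mono) (use inner in auto)
  also have "\<dots> \<le> (\<Sum>p\<in>{1..2*D} \<times> {1..E}. 4 * real N / L ^ 5 * (1 / real (fst p) * (1 / real (snd p))))"
    using L by (intro sum_mono2) (auto simp: G_def)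
  also have "\<dots> = 4 * real N / L ^ 5 * ((\<Sum>d=1..2*D. 1 / real d) * (\<Sum>e=1..E. 1 / real e))"
    unfolding sum_Times_product[of "\<lambda>d. 1 / real d" "\<lambda>e. 1 / real e", symmetric] by (simp only: sum_distrib_left)
  also have "\<dots> \<le> 4 * real N / L ^ 5 * (L * L)"
  proof (intro mult_left_mono mult_mono)
    have "(\<Sum>d=1..2*D. 1 / real d) \<le> 1 + ln (real (2 * D))" using DE by (intro sum_inverse_le) auto
    also have "\<dots> \<le> L" using DEN DE by (simp add: L_def log_size_def)
    finally show "(\<Sum>d=1..2*D. 1 / real d) \<le> L" .
    have "(\<Sum>d=1..E. 1 / real d) \<le> 1 + ln (real E)" using E by (rule sum_inverse_le)
    also have "\<dots> \<le> L" using DEN E by (simp add: L_def log_size_def)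
    finally show "(\<Sum>d=1..E. 1 / real d) \<le> L" .
  qed (use L in \<open>auto intro: sum_nonneg\<close>)
  also have "\<dots> = 4 * real N / L ^ 3" using L by (simp add: power_numeral_reduce field_simps)
  finally show ?thesis unfolding eq by (simp add: L_def)
qed

section \<open>The weights left when two factors are small\<close>

definition tail_pairs :: "nat \<Rightarrow> (nat \<times> nat) set" where
  "tail_pairs x = {(a, b). a * b \<le> x \<and> squarefree (a * b) \<and> primes_1_mod_4 a}"

lemma tail_pairs_subset: "tail_pairs x \<subseteq> {1..x} \<times> {1..x}"
proof (clarsimp simp: tail_pairs_def)
  fix a b assume h: "a * b \<le> x" "squarefree (a * b)"
  then have "a * b \<noteq> 0" by (intro notI) simp
  then have "a > 0" "b > 0" by auto
  moreover have "a \<le> a * b" "b \<le> a * b" using calculation by auto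
  ultimately show "Suc 0 \<le> a \<and> a \<le> x \<and> Suc 0 \<le> b \<and> b \<le> x" using h(1) by linarith
qed

lemma finite_tail_pairs: "finite (tail_pairs x)"
  by (rule finite_subset[OF tail_pairs_subset]) simp

text \<open>Grouping by \<open>k = a * b\<close>: all pairs over a squarefree \<open>k\<close> have
  weight \<open>1 / tau k\<close>, and they correspond to the divisors counted in
  \<open>divisor_ratio k\<close>.\<close>

lemma sum_tail_pairs:
  "(\<Sum>(a,b)\<in>tail_pairs x. 1 / real (tau a) * (1 / real (tau b))) = (\<Sum>k=1..x. divisor_ratio k)"
proof -
  have "(\<Sum>(a,b)\<in>tail_pairs x. 1 / real (tau a) * (1 / real (tau b))) =
     (\<Sum>k=1..x. \<Sum>p | p \<in> tail_pairs x \<and> fst p * snd p = k. case p of (a,b) \<Rightarrow> 1 / real (tau a) * (1 / real (tau b)))"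
  proof (rule sum.group[symmetric])
    show "(\<lambda>p. fst p * snd p) ` tail_pairs x \<subseteq> {1..x}"
      using tail_pairs_subset[of x] by (auto simp: tail_pairs_def)
  qed (auto simp: finite_tail_pairs)
  also have "\<dots> = (\<Sum>k=1..x. divisor_ratio k)"
  proof (rule sum.cong)
    fix k assume k: "k \<in> {1..x}"
    show "(\<Sum>p | p \<in> tail_pairs x \<and> fst p * snd p = k. case p of (a,b) \<Rightarrow> 1 / real (tau a) * (1 / real (tau b))) = divisor_ratio k"
    proof (cases "squarefree k")
      case True
      have "(\<Sum>p | p \<in> tail_pairs x \<and> fst p * snd p = k. case p of (a,b) \<Rightarrow> 1 / real (tau a) * (1 / real (tau b)))
        = (\<Sum>a | a dvd k \<and> primes_1_mod_4 a. 1 / real (tau k))"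
      proof (rule sum.reindex_bij_witness[of _ "\<lambda>a. (a, k div a)" fst], goal_cases)
        case (5 p)
        then obtain a b where p: "p = (a,b)" "a * b = k" by force
        then have "a > 0" "b > 0" using k by (auto intro: Nat.gr0I)
        then have "tau k = tau a * tau b"
          using tau_coprime_mult[of a b] squarefree_mult_imp_coprime[of a b] p True by auto
        then show ?case using p by simp
      qed (use k True in \<open>auto simp: tail_pairs_def\<close>)
      also have "\<dots> = divisor_ratio k" using True by (simp add: divisor_ratio_def)
      finally show ?thesis .
    next
      case False
      then have "{p. p \<in> tail_pairs x \<and> fst p * snd p = k} = {}" by (auto simp: tail_pairs_def)
      then show ?thesis using False by (simp only: sum.empty) (simp add: divisor_ratio_def)
    qed
  qed simp
  finally show ?thesis .
qed

text \<open>The root factors in the mean value of \<open>divisor_ratio\<close>, taken at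
  \<open>2 * N\<close>. It has order \<open>(ln N) ^ (3/4)\<close>, so division by
  \<open>ln (2 * N)\<close> leaves a saving of a fourth root.\<close>

definition tail_factor :: "nat \<Rightarrow> real" where
  "tail_factor N = sqrt (sqrt ((1 + 4 * ln (2 * real N)) * (3 + ln 4))) * sqrt (1 + 2 * ln (2 * real N))"

text \<open>Since \<open>2 * W\<close> is at most the square root of \<open>N\<close>, the quotient
  \<open>N div c\<close> is at least that root, so its logarithm loses no more than a factor
  2.\<close>

lemma div_bounds:
  assumes c: "1 \<le> c" "c \<le> W" and W: "4 * W ^ 2 \<le> N"
  shows "2 \<le> N div c" "real (N div c) \<le> real N / real c"
    "ln (real N) / 2 \<le> ln (real (N div c))" "ln (real (N div c)) \<le> ln (real N)" "4 \<le> N"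
proof -
  define x where "x = N div c"
  have W1: "W \<ge> 1" using c by simp
  then have W2: "W \<le> W ^ 2" by (simp add: power2_eq_square)
  then have N: "N \<ge> 4" "N \<ge> 2 * c" using W c W1 by linarith+
  have "real N / (2 * real c) \<le> real N / real c - 1"
    using c N by (simp add: field_simps)
  also have "\<dots> \<le> real x"
  proof -
    have "N = x * c + N mod c" by (simp add: x_def)
    moreover have "N mod c < c" using c by simp
    ultimately have "N \<le> x * c + c" by linarith
    then have "real N \<le> real x * real c + real c" by (metis of_nat_add of_nat_le_iff of_nat_mult)
    then show ?thesis using c by (simp add: field_simps)
  qed
  finally have x_ge: "real N / (2 * real c) \<le> real x" .
  have "real N / (2 * real W) \<le> real N / (2 * real c)" using c by (intro divide_left_mono) auto
  then have x_ge': "real N / (2 * real W) \<le> real x" using x_ge by linarith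
  have WN: "4 * real W ^ 2 \<le> real N" using W by (metis of_nat_le_iff of_nat_mult of_nat_numeral of_nat_power)
  then have "2 * real W \<le> real N / (2 * real W)" using W1 by (simp add: field_simps power2_eq_square)
  then have "2 \<le> real x" using x_ge' W1 by linarith
  then have x2: "x \<ge> 2" by simp
  have "real N * (4 * real W ^ 2) \<le> real N * real N"
    using mult_left_mono[OF WN, of "real N"] by simp
  then have "real N \<le> (real N / (2 * real W))\<^sup>2" using W1 by (simp add: field_simps power2_eq_square)
  also have "\<dots> \<le> (real x)\<^sup>2" using x_ge' by (intro power_mono) auto
  finally have "ln (real N) \<le> ln ((real x)\<^sup>2)" using N x2 by (subst ln_le_cancel_iff) auto
  also have "\<dots> = 2 * ln (real x)" using x2 by (simp add: ln_realpow)
  finally have ln_ge: "ln (real x) \<ge> ln (real N) / 2" by simp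
  have xle: "real x \<le> real N / real c"
    using of_nat_div_le_of_nat[of N c, where 'a = real] by (simp add: x_def)
  have "real x \<le> real N / real c" by (rule xle)
  also have "\<dots> \<le> real N" using c N by (simp add: divide_le_eq mult_le_cancel_left1)
  finally have ln_le: "ln (real x) \<le> ln (real N)" using x2 by (subst ln_le_cancel_iff) auto
  show "2 \<le> N div c" "real (N div c) \<le> real N / real c" "ln (real N) / 2 \<le> ln (real (N div c))"
    "ln (real (N div c)) \<le> ln (real N)" "4 \<le> N"
    using x2 xle ln_ge ln_le N unfolding x_def by simp_all
qed

lemma sum_tail_pairs_le:
  assumes c: "1 \<le> c" "c \<le> W" and W: "2 * W ^ 2 \<le> N"
  shows "(\<Sum>(a,b)\<in>tail_pairs (2 * N div c). 1 / real (tau a) * (1 / real (tau b)))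
    \<le> 12 * real N / ln (2 * real N) * tail_factor N * (1 / real c)"
proof -
  define x where "x = 2 * N div c"
  have "4 * W ^ 2 \<le> 2 * N" using W by simp
  note x = div_bounds[OF c this, folded x_def]
  have x2: "x \<ge> 2" and N: "N \<ge> 2" and xle: "real x \<le> 2 * real N / real c"
    and ln_ge: "ln (2 * real N) / 2 \<le> ln (real x)" and ln_le: "ln (real x) \<le> ln (2 * real N)"
    using x by simp_all
  have pos: "ln (2 * real N) > 0" using N by simp
  have "(\<Sum>(a,b)\<in>tail_pairs x. 1 / real (tau a) * (1 / real (tau b))) = (\<Sum>k=1..x. divisor_ratio k)"
    by (rule sum_tail_pairs)
  also have "\<dots> \<le> 3 * real x / ln (real x) *
     (sqrt (sqrt ((1 + 4 * ln (real x)) * (3 + ln 4))) * sqrt (1 + 2 * ln (real x)))"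
    by (rule sum_divisor_ratio_le[OF x2])
  also have "\<dots> \<le> (3 * (2 * real N / real c) / (ln (2 * real N) / 2)) * tail_factor N"
  proof (rule mult_mono)
    show "3 * real x / ln (real x) \<le> 3 * (2 * real N / real c) / (ln (2 * real N) / 2)"
      using xle ln_ge pos by (intro frac_le) auto
    show "sqrt (sqrt ((1 + 4 * ln (real x)) * (3 + ln 4))) * sqrt (1 + 2 * ln (real x)) \<le> tail_factor N"
      unfolding tail_factor_def using ln_le x2 pos by (intro mult_mono real_sqrt_le_mono) auto
  qed (use pos x2 in auto)
  also have "\<dots> = 12 * real N / ln (2 * real N) * tail_factor N * (1 / real c)" by simp
  finally show ?thesis by (simp add: x_def)
qed

text \<open>\<open>c\<close> and \<open>f\<close> are the small factors, \<open>a\<close> and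
  \<open>b\<close> their cofactors; the order \<open>(c, a, f, b)\<close> matches
  \<open>(d1, d2, e1, e2)\<close> when \<open>d1\<close> and \<open>e1\<close> are the small
  ones.\<close>

definition small_quads :: "nat \<Rightarrow> nat \<Rightarrow> (nat \<times> nat \<times> nat \<times> nat) set" where
  "small_quads V N = {(c,a,f,b). c \<in> {1..V} \<and> f \<in> {1..V} \<and> (a,b) \<in> tail_pairs (2 * N div (c * f))}"

text \<open>Each choice of \<open>c\<close> and \<open>f\<close> contributes in proportion to
  \<open>1 / (c * f)\<close>. Summing these costs \<open>(1 + ln V) ^ 2\<close>, a power of
  \<open>ln (ln N)\<close> when \<open>V\<close> is a power of \<open>ln N\<close>, so the saving
  from the cofactors survives.\<close>

lemma small_quads_sum_le:
  assumes V: "1 \<le> V" and N: "2 * V ^ 4 \<le> N"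
  shows "finite (small_quads V N)"
    "(\<Sum>(c,a,f,b)\<in>small_quads V N. 1 / real (tau a) * (1 / real (tau b)))
    \<le> 12 * real N / ln (2 * real N) * tail_factor N * (1 + ln (real V)) ^ 2"
proof -
  let ?C = "12 * real N / ln (2 * real N) * tail_factor N"
  let ?T = "SIGMA p:{1..V} \<times> {1..V}. tail_pairs (2 * N div (fst p * snd p))"
  have "V ^ 4 \<ge> 1" using V by simp
  then have N1: "N \<ge> 1" using N by linarith
  have C: "?C \<ge> 0" using N1 by (auto simp: tail_factor_def intro!: mult_nonneg_nonneg divide_nonneg_nonneg)
  have eq: "small_quads V N = (\<lambda>((c,f),(a,b)). (c,a,f,b)) ` ?T"
    by (auto simp: small_quads_def image_def) force
  have inj: "inj_on (\<lambda>((c,f),(a,b)). (c,a,f,b)) ?T" by (auto simp: inj_on_def)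
  show "finite (small_quads V N)"
    unfolding eq by (intro finite_imageI finite_SigmaI) (auto simp: finite_tail_pairs)
  have "(\<Sum>(c,a,f,b)\<in>small_quads V N. 1 / real (tau a) * (1 / real (tau b))) =
     (\<Sum>((c,f),(a,b))\<in>?T. 1 / real (tau a) * (1 / real (tau b)))"
    unfolding eq by (subst sum.reindex[OF inj]) (auto intro!: sum.cong)
  also have "\<dots> = (\<Sum>p\<in>{1..V} \<times> {1..V}. \<Sum>(a,b)\<in>tail_pairs (2 * N div (fst p * snd p)). 1 / real (tau a) * (1 / real (tau b)))"
    by (subst sum.Sigma) (auto simp: finite_tail_pairs case_prod_beta)
  also have "\<dots> \<le> (\<Sum>p\<in>{1..V} \<times> {1..V}. ?C * (1 / real (fst p) * (1 / real (snd p))))"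
  proof (rule sum_mono)
    fix p assume p: "p \<in> {1..V} \<times> {1..V}"
    then have "fst p \<ge> 1" "snd p \<ge> 1" "fst p \<le> V" "snd p \<le> V" by auto
    then have "1 * 1 \<le> fst p * snd p" "fst p * snd p \<le> V * V" by (intro mult_le_mono; simp)+
    then have "(\<Sum>(a,b)\<in>tail_pairs (2 * N div (fst p * snd p)). 1 / real (tau a) * (1 / real (tau b)))
       \<le> ?C * (1 / real (fst p * snd p))"
      using N by (intro sum_tail_pairs_le[of _ "V * V"]) (auto simp: power2_eq_square power4_eq_xxxx mult.assoc)
    then show "(\<Sum>(a,b)\<in>tail_pairs (2 * N div (fst p * snd p)). 1 / real (tau a) * (1 / real (tau b)))
       \<le> ?C * (1 / real (fst p) * (1 / real (snd p)))" by simp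
  qed
  also have "\<dots> = ?C * ((\<Sum>c=1..V. 1 / real c) * (\<Sum>f=1..V. 1 / real f))"
    unfolding sum_Times_product[of "\<lambda>d. 1 / real d" "\<lambda>e. 1 / real e", symmetric] by (simp only: sum_distrib_left)
  also have "\<dots> \<le> ?C * ((1 + ln (real V)) * (1 + ln (real V)))"
    using V by (intro mult_left_mono[OF _ C] mult_mono sum_inverse_le) (auto intro: sum_nonneg)
  finally show "(\<Sum>(c,a,f,b)\<in>small_quads V N. 1 / real (tau a) * (1 / real (tau b)))
    \<le> ?C * (1 + ln (real V)) ^ 2" by (simp add: power2_eq_square)
qed

section \<open>The middle range of the hyperbola\<close>

definition factor_quads :: "(nat \<times> nat) set \<Rightarrow> (nat \<times> nat \<times> nat \<times> nat) set" where
  "factor_quads U = {(d1,d2,e1,e2). (d1 * d2, e1 * e2) \<in> U}"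

lemma factor_quads_sum:
  fixes F :: "nat \<Rightarrow> nat \<Rightarrow> nat \<Rightarrow> nat \<Rightarrow> real"
  assumes U: "finite U" "\<And>d e. (d,e) \<in> U \<Longrightarrow> d > 0 \<and> e > 0"
  shows "finite (factor_quads U)"
   "(\<Sum>(d,e)\<in>U. \<Sum>d1 | d1 dvd d. \<Sum>e1 | e1 dvd e. F d1 (d div d1) e1 (e div e1)) =
    (\<Sum>(d1,d2,e1,e2)\<in>factor_quads U. F d1 d2 e1 e2)"
proof -
  let ?S = "SIGMA p:U. {d1. d1 dvd fst p} \<times> {e1. e1 dvd snd p}"
  let ?f = "\<lambda>((d,e),(d1,e1)). (d1, d div d1, e1, e div e1)"
  have fin: "finite ?S" using U by (intro finite_SigmaI finite_cartesian_product) auto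
  have eq: "factor_quads U = ?f ` ?S"
  proof (intro equalityI subsetI)
    fix q assume "q \<in> factor_quads U"
    then obtain d1 d2 e1 e2 where q: "q = (d1,d2,e1,e2)" "(d1 * d2, e1 * e2) \<in> U" by (auto simp: factor_quads_def)
    then have "d1 > 0" "e1 > 0" using U(2)[OF q(2)] by auto
    then show "q \<in> ?f ` ?S" using q
      by (intro image_eqI[of _ _ "((d1 * d2, e1 * e2), (d1, e1))"]) auto
  qed (auto simp: factor_quads_def)
  have inj: "inj_on ?f ?S"
  proof (rule inj_onI, clarsimp)
    fix d e d' e' d1 e1 :: nat
    assume h: "d div d1 = d' div d1" "e div e1 = e' div e1" "d1 dvd d" "d1 dvd d'" "e1 dvd e" "e1 dvd e'"
    note c = h(3-6)[THEN dvd_mult_div_cancel]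
    show "d = d' \<and> e = e'" using c h(1,2) by metis
  qed
  show "finite (factor_quads U)" unfolding eq using fin by simp
  have "(\<Sum>(d1,d2,e1,e2)\<in>factor_quads U. F d1 d2 e1 e2) = (\<Sum>((d,e),(d1,e1))\<in>?S. F d1 (d div d1) e1 (e div e1))"
    unfolding eq by (subst sum.reindex[OF inj]) (auto intro!: sum.cong)
  also have "\<dots> = (\<Sum>p\<in>U. \<Sum>z\<in>{d1. d1 dvd fst p} \<times> {e1. e1 dvd snd p}. F (fst z) (fst p div fst z) (snd z) (snd p div snd z))"
    by (subst sum.Sigma) (use U in \<open>auto simp: case_prod_beta\<close>)
  also have "\<dots> = (\<Sum>(d,e)\<in>U. \<Sum>d1 | d1 dvd d. \<Sum>e1 | e1 dvd e. F d1 (d div d1) e1 (e div e1))"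
    by (simp add: sum.cartesian_product case_prod_beta)
  finally show "(\<Sum>(d,e)\<in>U. \<Sum>d1 | d1 dvd d. \<Sum>e1 | e1 dvd e. F d1 (d div d1) e1 (e div e1)) =
    (\<Sum>(d1,d2,e1,e2)\<in>factor_quads U. F d1 d2 e1 e2)" by simp
qed

lemma abs_Jac_div_tau_le: "\<bar>rJac a n / real (tau m)\<bar> \<le> 1"
proof -
  have "\<bar>rJac a n\<bar> \<le> 1" using abs_Jac_le[of a n] by linarith
  then show ?thesis by (cases "tau m = 0") (auto simp: divide_le_eq)
qed

lemma inverse_tau_le: "\<bar>1 / real (tau m)\<bar> \<le> 1"
  by (cases "tau m = 0") auto

lemma abs_Jac_real_le: "\<bar>rJac a n\<bar> \<le> 1"
  using abs_Jac_le[of a n] by linarith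

definition dyadic_box :: "nat \<Rightarrow> nat \<Rightarrow> nat \<Rightarrow> (nat \<times> nat) set" where
  "dyadic_box N W i = {(d,e). 2 ^ i < d \<and> d \<le> 2 * 2 ^ i \<and> e \<le> N div 2 ^ i \<and> W < d \<and> W < e \<and> base_pair d e}"

lemma finite_dyadic_box: "finite (dyadic_box N W i)"
  by (rule finite_subset[of _ "{..2 * 2 ^ i} \<times> {..N div 2 ^ i}"]) (auto simp: dyadic_box_def)

lemma dyadic_box_disjoint: "i \<noteq> j \<Longrightarrow> dyadic_box N W i \<inter> dyadic_box N W j = {}"
proof (induction i j rule: linorder_wlog)
  case (le i j)
  then have "2 * 2 ^ i \<le> (2 ^ j :: nat)"
    using power_increasing[of "Suc i" j "2::nat"] by simp
  then show ?case by (auto simp: dyadic_box_def)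
next
  case (sym i j)
  then show ?case by blast
qed

lemma ex_dyadic:
  fixes d :: nat assumes "d \<ge> 2"
  obtains i where "2 ^ i < d" "d \<le> 2 * 2 ^ i"
proof -
  have "\<exists>i. 2 ^ i < d \<and> d \<le> 2 * 2 ^ i" using assms
  proof (induction d rule: dec_induct)
    case base
    show ?case by (intro exI[of _ 0]) simp
  next
    case (step n)
    then obtain i where i: "2 ^ i < n" "n \<le> 2 * 2 ^ i" by blast
    show ?case
    proof (cases "n = 2 * 2 ^ i")
      case True
      then show ?thesis by (intro exI[of _ "Suc i"]) simp
    next
      case False
      then show ?thesis using i by (intro exI[of _ i]) simp
    qed
  qed
  then show ?thesis using that by blast
qed

text \<open>The threshold is \<open>W = V ^ 2\<close> so that in any factorization of
  \<open>d\<close>, and likewise of \<open>e\<close>, at least one factor exceeds \<open>V\<close>.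
  The first term of the bound is the bilinear part, twice \<open>8 * N / L ^ 2\<close>; the second
  is the part with small factors, in two symmetric copies.\<close>

lemma mid_range_bound:
  assumes V: "real V \<ge> log_size N ^ 68" "V \<ge> 1" and N: "2 * V ^ 4 \<le> N"
  defines "W \<equiv> V ^ 2"
  shows "real (card {(d,e). d * e \<le> N \<and> W < d \<and> W < e \<and> solvable_pair w u d e})
    \<le> 16 * real N / log_size N ^ 2 + 24 * real N / ln (2 * real N) * tail_factor N * (1 + ln (real V)) ^ 2"
proof -
  define L where "L = log_size N"
  define I where "I = {i. 2 ^ i \<le> N}"
  define R where "R = dyadic_box N W"
  define U where "U = (\<Union>i\<in>I. R i)"
  let ?S = "{(d,e). d * e \<le> N \<and> W < d \<and> W < e \<and> solvable_pair w u d e}"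
  let ?t = "char_term w u"
  have "V ^ 4 \<ge> 1" using V by simp
  then have N1: "N \<ge> 2" using N by linarith
  have L: "L \<ge> 1" using N1 by (simp add: L_def log_size_def)
  have W1: "W \<ge> 1" using V by (simp add: W_def)
  have ln_bound: "real i \<le> 2 * ln (real N)" if "i \<in> I" for i
  proof -
    have "real (2 ^ i) \<le> real N" using that by (simp only: I_def of_nat_le_iff mem_Collect_eq)
    then have "ln (real (2 ^ i)) \<le> ln (real N)" using N1 by (subst ln_le_cancel_iff) auto
    then have "real i * ln 2 \<le> ln (real N)" by (simp add: ln_realpow)
    moreover have "real i * (1/2) \<le> real i * ln 2" using ln2_ge_two_thirds by (intro mult_left_mono) auto
    ultimately show ?thesis by simp
  qed
  have Isub: "I \<subseteq> {..nat \<lfloor>2 * ln (real N)\<rfloor>}"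
    using ln_bound by (auto simp: le_nat_floor)
  have finI: "finite I" using Isub finite_subset by blast
  have "card I \<le> nat \<lfloor>2 * ln (real N)\<rfloor> + 1" using card_mono[OF _ Isub] by simp
  then have "real (card I) \<le> real (nat \<lfloor>2 * ln (real N)\<rfloor>) + 1" by linarith
  also have "\<dots> \<le> 2 * ln (real N) + 1" using N1 by (simp add: of_nat_floor)
  also have "\<dots> \<le> 2 * L"
  proof -
    have "ln (real N) \<le> ln (2 * real N)" using N1 by (subst ln_le_cancel_iff) auto
    then show ?thesis by (simp add: L_def log_size_def)
  qed
  finally have cardI: "real (card I) \<le> 2 * L" .
  have finR: "finite (R i)" for i unfolding R_def by (rule finite_dyadic_box)
  have disj: "i \<noteq> j \<Longrightarrow> R i \<inter> R j = {}" for i j unfolding R_def by (rule dyadic_box_disjoint)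
  have finU: "finite U" unfolding U_def using finI finR by blast
  have baseU: "(d,e) \<in> U \<Longrightarrow> base_pair d e" for d e by (auto simp: U_def R_def dyadic_box_def)
  have posU: "(d,e) \<in> U \<Longrightarrow> d > 0 \<and> e > 0" for d e using baseU base_pair_pos by blast
  have sub: "?S \<subseteq> {p \<in> U. p \<in> {(d,e). solvable_pair w u d e}}"
  proof
    fix p assume "p \<in> ?S"
    then obtain d e where p: "p = (d,e)" "d * e \<le> N" "W < d" "W < e" "solvable_pair w u d e" by auto
    obtain i where i: "2 ^ i < d" "d \<le> 2 * 2 ^ i" using ex_dyadic[of d] p W1 by auto
    have "2 ^ i * e \<le> d * e" "d * 1 \<le> d * e" using i p by (intro mult_le_mono; simp)+
    then have "2 ^ i * e \<le> N" "2 ^ i \<le> N" using p i by linarith+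
    then have "(d,e) \<in> R i" "i \<in> I" using i p solvable_imp_base
      by (auto simp: R_def dyadic_box_def I_def less_eq_div_iff_mult_less_eq mult.commute)
    then show "p \<in> {p \<in> U. p \<in> {(d,e). solvable_pair w u d e}}" using p by (auto simp: U_def)
  qed
  define Z where "Z = factor_quads U"
  define Zi where "Zi i = factor_quads (R i)" for i
  have finZ: "finite Z" unfolding Z_def by (rule factor_quads_sum(1)[OF finU posU])
  have finZi: "finite (Zi i)" for i unfolding Zi_def
    by (rule factor_quads_sum(1)[OF finR]) (auto simp: R_def dyadic_box_def dest: base_pair_pos)
  have Z_UN: "Z = (\<Union>i\<in>I. Zi i)" by (auto simp: Z_def Zi_def U_def factor_quads_def)
  have Zi_disj: "i \<noteq> j \<Longrightarrow> Zi i \<inter> Zi j = {}" for i j using disj[of i j] by (auto simp: Zi_def factor_quads_def)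
  have "real (card ?S) \<le> real (card {p \<in> U. p \<in> {(d,e). solvable_pair w u d e}})"
    using finU by (intro of_nat_mono card_mono sub) auto
  also have "\<dots> = (\<Sum>p\<in>U. indicator {(d,e). solvable_pair w u d e} p)"
    by (rule card_filter_eq_sum_indicator[OF finU])
  also have "\<dots> \<le> (\<Sum>(d,e)\<in>U. \<Sum>d1 | d1 dvd d. \<Sum>e1 | e1 dvd e. ?t d1 (d div d1) e1 (e div e1))"
    by (intro sum_mono) (use indicator_solvable_le baseU in auto)
  also have "\<dots> = (\<Sum>(d1,d2,e1,e2)\<in>Z. ?t d1 d2 e1 e2)"
    unfolding Z_def by (rule factor_quads_sum(2)[OF finU posU])
  finally have main: "real (card ?S) \<le> (\<Sum>(d1,d2,e1,e2)\<in>Z. ?t d1 d2 e1 e2)" .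

  define P1 where "P1 = {(d1::nat,d2::nat,e1::nat,e2::nat). V < d1 \<and> V < e2}"
  \<comment> \<open>Removing \<open>P1\<close> avoids double counting. The removed condition
    involves only \<open>d1\<close> and \<open>e2\<close>, which stay fixed when the symbol sum runs
    over \<open>d2\<close> and \<open>e1\<close>, so it fits into the predicate
    \<open>Q\<close>.\<close>
  define P2 where "P2 = {(d1::nat,d2::nat,e1::nat,e2::nat). \<not> (V < d1 \<and> V < e2) \<and> V < d2 \<and> V < e1}"
  let ?f = "\<lambda>(d1,d2,e1,e2). ?t d1 d2 e1 e2"
  have split: "sum ?f Z = sum ?f (Z \<inter> P1) + sum ?f (Z \<inter> P2) + sum ?f (Z - P1 - P2)"
  proof -
    have "P1 \<inter> P2 = {}" by (auto simp: P1_def P2_def)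
    have "sum ?f Z = sum ?f (Z \<inter> P1) + sum ?f (Z - P1)" by (rule sum.Int_Diff[OF finZ])
    also have "sum ?f (Z - P1) = sum ?f ((Z - P1) \<inter> P2) + sum ?f (Z - P1 - P2)"
      by (rule sum.Int_Diff) (use finZ in auto)
    also have "(Z - P1) \<inter> P2 = Z \<inter> P2" using \<open>P1 \<inter> P2 = {}\<close> by blast
    finally show ?thesis by simp
  qed
  have split_i: "sum ?f (Z \<inter> P) = (\<Sum>i\<in>I. sum ?f (Zi i \<inter> P))" for P
  proof -
    have eq: "Z \<inter> P = (\<Union>i\<in>I. Zi i \<inter> P)" unfolding Z_UN by blast
    have dj: "\<forall>i\<in>I. \<forall>j\<in>I. i \<noteq> j \<longrightarrow> (Zi i \<inter> P) \<inter> (Zi j \<inter> P) = {}"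
      using Zi_disj by blast
    show ?thesis unfolding eq by (rule sum.UNION_disjoint[OF finI _ dj]) (simp add: finZi)
  qed
  have boxE: "(2::nat) ^ i * (N div 2 ^ i) \<le> N" for i by simp
  have P_mult: "primes_1_mod_4 (x * y) \<longleftrightarrow> primes_1_mod_4 x \<and> primes_1_mod_4 y" for x y
    by (auto simp: primes_1_mod_4_def prime_dvd_mult_iff)
  have b1: "\<bar>sum ?f (Zi i \<inter> P1)\<bar> \<le> 4 * real N / L ^ 3" for i
  proof -
    let ?al = "\<lambda>m. rJac w m / real (tau m)" and ?be = "\<lambda>n. 1 / real (tau n)"
    let ?ka = "\<lambda>d e. rJac u e / real (tau e) * (1 / real (tau d)) * rJac (int e) d"
    have eq: "Zi i \<inter> P1 = box_quads V W (2 ^ i) (N div 2 ^ i) (\<lambda>_ _. True)"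
      by (auto simp: Zi_def factor_quads_def R_def dyadic_box_def P1_def base_pair_def P_mult box_quads_def)
    have "\<bar>\<Sum>(m,d,e,n)\<in>Zi i \<inter> P1. ?ka d e * ?al m * ?be n * rJac (int n) m\<bar> \<le> 4 * real N / log_size N ^ 3"
      unfolding eq
    proof (rule box_sum_bound[OF _ _ _ V(1) boxE])
      show "\<bar>?ka d e\<bar> \<le> 1" for d e
        unfolding abs_mult using abs_Jac_div_tau_le[of u e e] inverse_tau_le[of d] abs_Jac_real_le[of "int e" d]
        by (intro mult_le_one mult_nonneg_nonneg) auto
    qed (use N1 abs_Jac_div_tau_le inverse_tau_le in auto)
    also have "(\<Sum>(m,d,e,n)\<in>Zi i \<inter> P1. ?ka d e * ?al m * ?be n * rJac (int n) m) = sum ?f (Zi i \<inter> P1)"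
      by (rule sum.cong) (auto simp: char_term_def mult_ac)
    finally show ?thesis by (simp add: L_def)
  qed
  have b2: "\<bar>sum ?f (Zi i \<inter> P2)\<bar> \<le> 4 * real N / L ^ 3" for i
  proof -
    let ?be = "\<lambda>n. rJac u n / real (tau n)" and ?al = "\<lambda>m. 1 / real (tau m)"
    let ?ka = "\<lambda>d e. rJac w d / real (tau d) * (1 / real (tau e)) * rJac (int e) d"
    let ?s = "\<lambda>(d1,d2,e1,e2). (d2::nat,d1::nat,e2::nat,e1::nat)"
    let ?Y = "box_quads V W (2 ^ i) (N div 2 ^ i) (\<lambda>d e. \<not> (V < d \<and> V < e))"
    have "sum ?f (Zi i \<inter> P2) = (\<Sum>(m,d,e,n)\<in>?Y. ?ka d e * ?al m * ?be n * rJac (int n) m)"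
    proof (rule sum.reindex_bij_witness[of _ ?s ?s], goal_cases)
      case (2 q) then show ?case
        by (auto simp: Zi_def factor_quads_def R_def dyadic_box_def P2_def base_pair_def P_mult box_quads_def mult.commute)
    next
      case (4 q) then show ?case
        by (auto simp: Zi_def factor_quads_def R_def dyadic_box_def P2_def base_pair_def P_mult box_quads_def mult.commute)
    qed (auto simp: char_term_def mult_ac)
    moreover have "\<bar>\<Sum>(m,d,e,n)\<in>?Y. ?ka d e * ?al m * ?be n * rJac (int n) m\<bar> \<le> 4 * real N / log_size N ^ 3"
    proof (rule box_sum_bound[OF _ _ _ V(1) boxE])
      show "\<bar>?ka d e\<bar> \<le> 1" for d e
        unfolding abs_mult using abs_Jac_div_tau_le[of w d d] inverse_tau_le[of e] abs_Jac_real_le[of "int e" d]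
        by (intro mult_le_one mult_nonneg_nonneg) auto
    qed (use N1 abs_Jac_div_tau_le inverse_tau_le in auto)
    ultimately show ?thesis by (simp add: L_def)
  qed
  \<comment> \<open>There are at most \<open>2 * L\<close> dyadic scales, so one of the three powers
    of \<open>L\<close> saved in each box is spent here.\<close>
  have bil: "sum ?f (Z \<inter> P) \<le> 8 * real N / L ^ 2" if b: "\<And>i. \<bar>sum ?f (Zi i \<inter> P)\<bar> \<le> 4 * real N / L ^ 3" for P
  proof -
    have "sum ?f (Z \<inter> P) \<le> (\<Sum>i\<in>I. 4 * real N / L ^ 3)"
      unfolding split_i by (intro sum_mono) (use b abs_le_D1 in blast)
    also have "\<dots> = real (card I) * (4 * real N / L ^ 3)" by simp
    also have "\<dots> \<le> 2 * L * (4 * real N / L ^ 3)" using L cardI by (intro mult_right_mono) auto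
    also have "\<dots> = 8 * real N / L ^ 2" using L by (simp add: field_simps power2_eq_square power3_eq_cube)
    finally show ?thesis .
  qed

  define Sq where "Sq = small_quads V N"
  let ?g = "\<lambda>(c,a,f,b). 1 / real (tau a) * (1 / real (tau b))"
  let ?C = "12 * real N / ln (2 * real N) * tail_factor N * (1 + ln (real V)) ^ 2"
  have finSq: "finite Sq" and Sq: "sum ?g Sq \<le> ?C"
    unfolding Sq_def using small_quads_sum_le[OF V(2) N] by auto
  let ?s = "\<lambda>(d1,d2,e1,e2). (d2::nat,d1::nat,e2::nat,e1::nat)"
  \<comment> \<open>Outside \<open>P1\<close> and \<open>P2\<close>, the bounds
    \<open>d1 * d2 > V ^ 2\<close> and \<open>e1 * e2 > V ^ 2\<close> leave two cases:
    \<open>d1\<close> and \<open>e1\<close> are at most \<open>V\<close>, or \<open>d2\<close> and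
    \<open>e2\<close> are. The exchange \<open>?s\<close> carries the second case to the
    first.\<close>
  let ?T1 = "(Z - P1 - P2) \<inter> {(d1,d2,e1,e2). d1 \<le> V}" and ?T2 = "(Z - P1 - P2) - {(d1,d2,e1,e2). d1 \<le> V}"
  have Zprop: "squarefree ((d1 * d2) * (e1 * e2)) \<and> primes_1_mod_4 d1 \<and> primes_1_mod_4 d2 \<and> (d1 * d2) * (e1 * e2) \<le> 2 * N
     \<and> W < d1 * d2 \<and> W < e1 * e2 \<and> d1 > 0 \<and> d2 > 0 \<and> e1 > 0 \<and> e2 > 0"
    if z: "(d1,d2,e1,e2) \<in> Z" for d1 d2 e1 e2
  proof -
    obtain i where i: "(d1 * d2, e1 * e2) \<in> R i" using z by (auto simp: Z_def factor_quads_def U_def)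
    then have h: "d1 * d2 \<le> 2 * 2 ^ i" "e1 * e2 \<le> N div 2 ^ i" "W < d1 * d2" "W < e1 * e2" "base_pair (d1 * d2) (e1 * e2)"
      by (auto simp: R_def dyadic_box_def)
    have "(d1 * d2) * (e1 * e2) \<le> (2 * 2 ^ i) * (N div 2 ^ i)" using h(1,2) by (rule mult_le_mono)
    also have "\<dots> \<le> 2 * N" using boxE[of i] by (simp add: mult.assoc)
    finally have "(d1 * d2) * (e1 * e2) \<le> 2 * N" .
    then show ?thesis using h base_pair_pos[OF h(5)] by (auto simp: base_pair_def P_mult)
  qed
  have tp: "(d2, e2) \<in> tail_pairs (2 * N div (d1 * e1))"
    if "squarefree ((d1 * d2) * (e1 * e2))" "primes_1_mod_4 d2" "(d1 * d2) * (e1 * e2) \<le> 2 * N" "d1 > 0" "e1 > 0" for d1 d2 e1 e2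
  proof -
    have "squarefree ((d1 * e1) * (d2 * e2))" using that(1) by (simp add: mult_ac)
    then have "squarefree (d2 * e2)" by (rule squarefree_multD(2))
    moreover have "(d2 * e2) * (d1 * e1) \<le> 2 * N" using that(3) by (simp add: mult_ac)
    ultimately show ?thesis using that by (simp add: tail_pairs_def less_eq_div_iff_mult_less_eq)
  qed
  have T1: "?T1 \<subseteq> Sq"
  proof
    fix q assume "q \<in> ?T1"
    then obtain d1 d2 e1 e2 where q: "q = (d1,d2,e1,e2)" "(d1,d2,e1,e2) \<in> Z" "d1 \<le> V" "\<not> (V < d2 \<and> V < e1)"
      by (auto simp: P1_def P2_def)
    note h = Zprop[OF q(2)]
    have "\<not> d2 \<le> V"
    proof
      assume "d2 \<le> V"
      then have "d1 * d2 \<le> V * V" using q by (intro mult_le_mono) auto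
      then show False using h by (simp add: W_def power2_eq_square)
    qed
    then have "e1 \<le> V" using q by auto
    then show "q \<in> Sq" using q h tp[of d1 d2 e1 e2] by (simp add: Sq_def small_quads_def Suc_le_eq)
  qed
  have T2: "?s ` ?T2 \<subseteq> Sq"
  proof
    fix q' assume "q' \<in> ?s ` ?T2"
    then obtain d1 d2 e1 e2 where q: "q' = (d2,d1,e2,e1)" "(d1,d2,e1,e2) \<in> Z" "\<not> d1 \<le> V"
       "\<not> (V < d1 \<and> V < e2)" "\<not> (V < d2 \<and> V < e1)"
      by (auto simp: P1_def P2_def)
    note h = Zprop[OF q(2)]
    have "e2 \<le> V" using q by auto
    have "\<not> e1 \<le> V"
    proof
      assume "e1 \<le> V"
      then have "e1 * e2 \<le> V * V" using \<open>e2 \<le> V\<close> by (intro mult_le_mono) auto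
      then show False using h by (simp add: W_def power2_eq_square)
    qed
    then have "d2 \<le> V" using q by auto
    then show "q' \<in> Sq" using q h tp[of d2 d1 e2 e1] \<open>e2 \<le> V\<close>
      by (simp add: Sq_def small_quads_def Suc_le_eq mult.commute[of d2 d1] mult.commute[of e2 e1])
  qed
  \<comment> \<open>All symbols are now bounded by 1. The first inequality keeps the weights of
    \<open>d2\<close> and \<open>e2\<close>, the second those of \<open>d1\<close> and
    \<open>e1\<close>.\<close>
  have abs_prod: "a * b * c * d * x * y \<le> c * d" "a * b * c * d * x * y \<le> a' * d"
    if "\<bar>a\<bar> \<le> 1" "\<bar>b\<bar> \<le> 1" "0 \<le> c" "0 \<le> d" "\<bar>x\<bar> \<le> 1" "\<bar>y\<bar> \<le> 1" "\<bar>a\<bar> \<le> a'" "c \<le> 1" for a b c d x y a' :: real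
  proof -
    have "\<bar>a * b * x * y\<bar> \<le> 1" unfolding abs_mult using that by (intro mult_le_one mult_nonneg_nonneg) auto
    then have "(a * b * x * y) * (c * d) \<le> 1 * (c * d)" using that by (intro mult_right_mono) auto
    then show "a * b * c * d * x * y \<le> c * d" by (simp add: mult_ac)
    have "\<bar>a\<bar> * (\<bar>b\<bar> * c * \<bar>x\<bar> * \<bar>y\<bar>) \<le> a' * 1" using that by (intro mult_mono mult_le_one mult_nonneg_nonneg) auto
    then have "\<bar>a * b * c * x * y\<bar> \<le> a'" using that by (simp add: abs_mult mult_ac)
    then have "(a * b * c * x * y) * d \<le> a' * d" using that by (intro mult_right_mono) auto
    then show "a * b * c * d * x * y \<le> a' * d" by (simp add: mult_ac)
  qed
  have "sum ?f (Z - P1 - P2) = sum ?f ?T1 + sum ?f ?T2"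
    by (rule sum.Int_Diff) (use finZ in auto)
  also have "sum ?f ?T1 \<le> sum ?g ?T1"
  proof (rule sum_mono, clarify)
    fix d1 d2 e1 e2
    show "?t d1 d2 e1 e2 \<le> 1 / real (tau d2) * (1 / real (tau e2))"
      unfolding char_term_def
      by (rule abs_prod(1)[of _ _ _ _ _ _ 1]) (use abs_Jac_div_tau_le abs_Jac_real_le inverse_tau_le in auto)
  qed
  also have "\<dots> \<le> sum ?g Sq" by (rule sum_mono2[OF finSq T1]) auto
  also have "sum ?f ?T2 \<le> (\<Sum>q\<in>?T2. ?g (?s q))"
  proof (rule sum_mono)
    fix q assume "q \<in> ?T2"
    obtain d1 d2 e1 e2 where q: "q = (d1,d2,e1,e2)" by (cases q)
    have "?t d1 d2 e1 e2 = (rJac w d1 / real (tau d1)) * rJac u e1 * (1 / real (tau d2)) * (1 / real (tau e1))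
       * (rJac (int e2) d1 * (1 / real (tau e2))) * rJac (int e1) d2"
      by (simp add: char_term_def mult_ac)
    also have "\<dots> \<le> 1 / real (tau d1) * (1 / real (tau e1))"
      by (rule abs_prod(2))
        (use abs_Jac_div_tau_le abs_Jac_real_le inverse_tau_le in \<open>auto simp: divide_right_mono\<close>)
    finally show "?f q \<le> ?g (?s q)" unfolding q prod.case .
  qed
  also have "\<dots> = sum ?g (?s ` ?T2)"
    by (subst sum.reindex) (auto simp: inj_on_def)
  also have "\<dots> \<le> sum ?g Sq" by (rule sum_mono2[OF finSq T2]) auto
  finally have tail: "sum ?f (Z - P1 - P2) \<le> 2 * ?C" using Sq by linarith
  have "real (card ?S) \<le> 16 * real N / L ^ 2 + 2 * ?C"
    using main split bil[OF b1] bil[OF b2] tail by linarith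
  also have "2 * ?C = 24 * real N / ln (2 * real N) * tail_factor N * (1 + ln (real V)) ^ 2" by simp
  finally show ?thesis by (simp add: L_def)
qed

section \<open>One small factor, and density zero of the solvable pairs\<close>

lemma card_residue_set_div_le:
  assumes c: "1 \<le> c" "c \<le> W" and W: "4 * W ^ 2 \<le> N" and q: "1 \<le> q" "q \<le> 8 * W"
    and bd: "\<And>y. \<bar>\<Sum>n=1..y. rJac a n\<bar> \<le> real q"
  shows "real (card {n \<in> {1..N div c}. squarefree n \<and> n \<in> residue_set a})
    \<le> 6 * real N / ln (real N) * sqrt ((1 + 2 * ln (real N)) * (3 + ln (8 * real W))) * (1 / real c)"
proof -
  define x where "x = N div c"
  have W1: "W \<ge> 1" using c by simp
  note x = div_bounds[OF c W, folded x_def]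
  have x2: "x \<ge> 2" and N: "N \<ge> 4" and xle: "real x \<le> real N / real c"
    and ln_ge: "ln (real N) / 2 \<le> ln (real x)" and ln_le: "ln (real x) \<le> ln (real N)" by (rule x)+
  have pos: "ln (real N) > 0" using N by simp
  have lnq: "0 \<le> ln (real q)" "ln (real q) \<le> ln (8 * real W)" using q W1 by simp (subst ln_le_cancel_iff, use q W1 in auto)
  have "real (card {n \<in> {1..x}. squarefree n \<and> n \<in> residue_set a})
    \<le> 3 * real x / ln (real x) * sqrt ((1 + 2 * ln (real x)) * (3 + ln (real q)))"
    by (rule card_squarefree_residue_set_le[OF q(1) bd x2])
  also have "\<dots> \<le> (3 * (real N / real c) / (ln (real N) / 2)) * sqrt ((1 + 2 * ln (real N)) * (3 + ln (8 * real W)))"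
  proof (rule mult_mono)
    show "3 * real x / ln (real x) \<le> 3 * (real N / real c) / (ln (real N) / 2)"
      using xle ln_ge pos by (intro frac_le) auto
    show "sqrt ((1 + 2 * ln (real x)) * (3 + ln (real q))) \<le> sqrt ((1 + 2 * ln (real N)) * (3 + ln (8 * real W)))"
      using ln_le x2 pos lnq by (intro mult_mono real_sqrt_le_mono) auto
  qed (use pos x2 lnq in \<open>auto intro!: mult_nonneg_nonneg\<close>)
  also have "\<dots> = 6 * real N / ln (real N) * sqrt ((1 + 2 * ln (real N)) * (3 + ln (8 * real W))) * (1 / real c)" by simp
  finally show ?thesis by (simp add: x_def)
qed

lemma card_pairs_fibre_le:
  assumes W: "W \<ge> 1" and fin: "\<And>c. finite (S c)"
    and le: "\<And>c. c \<in> {1..W} \<Longrightarrow> real (card (S c)) \<le> K * (1 / real c)" and K: "K \<ge> 0"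
    and sub: "T \<subseteq> (SIGMA c:{1..W}. S c)"
  shows "real (card T) \<le> K * (1 + ln (real W))"
proof -
  have "card T \<le> card (SIGMA c:{1..W}. S c)" by (rule card_mono[OF _ sub]) (use fin in auto)
  also have "\<dots> = (\<Sum>c=1..W. card (S c))" using fin by (subst card_SigmaI) auto
  finally have "real (card T) \<le> (\<Sum>c=1..W. real (card (S c)))" by (metis of_nat_le_iff of_nat_sum)
  also have "\<dots> \<le> (\<Sum>c=1..W. K * (1 / real c))" by (rule sum_mono) (rule le)
  also have "\<dots> = K * (\<Sum>c=1..W. 1 / real c)" by (simp only: sum_distrib_left)
  also have "\<dots> \<le> K * (1 + ln (real W))" using K W by (intro mult_left_mono sum_inverse_le) auto
  finally show ?thesis .
qed

text \<open>\<open>t\<close> records whether the leading coefficient is even, so that it equals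
  \<open>2 * d\<close> or \<open>d\<close>. The last condition removes leading coefficient 1, whose
  form is soluble for every \<open>n\<close>.\<close>

definition solvable_pairs :: "int \<Rightarrow> bool \<Rightarrow> nat \<Rightarrow> (nat \<times> nat) set" where
  "solvable_pairs w t N = {(d, e). d * e \<le> N \<and> solvable_pair w (if t then 2 else 1) d e \<and> (t \<or> d \<noteq> 1)}"

lemma solvable_pair_pos: "solvable_pair w u d e \<Longrightarrow> d > 0 \<and> e > 0"
  using solvable_imp_base base_pair_pos by blast

lemma finite_solvable_pair: "finite {(d, e). d * e \<le> N \<and> solvable_pair w u d e}"
proof (rule finite_subset)
  show "{(d, e). d * e \<le> N \<and> solvable_pair w u d e} \<subseteq> {..N} \<times> {..N}"
  proof
    fix p assume "p \<in> {(d, e). d * e \<le> N \<and> solvable_pair w u d e}"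
    then obtain d e where p: "p = (d,e)" "d * e \<le> N" "d > 0" "e > 0"
      using solvable_pair_pos by auto
    then have "d * 1 \<le> d * e" "1 * e \<le> d * e" by (intro mult_le_mono; simp)+
    then have "d \<le> N" "e \<le> N" using p by linarith+
    then show "p \<in> {..N} \<times> {..N}" using p by simp
  qed
qed simp

lemma finite_solvable_pairs: "finite (solvable_pairs w t N)"
  by (rule finite_subset[OF _ finite_solvable_pair[of N w "if t then 2 else 1"]]) (auto simp: solvable_pairs_def)

lemma card_solvable_pairs_le:
  assumes V: "real V \<ge> log_size N ^ 68" "V \<ge> 1" and N: "4 * V ^ 4 \<le> N"
  shows "real (card (solvable_pairs w t N)) \<le>
     12 * real N / ln (real N) * sqrt ((1 + 2 * ln (real N)) * (3 + ln (8 * real V ^ 2))) * (1 + 2 * ln (real V))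
     + 16 * real N / log_size N ^ 2 + 24 * real N / ln (2 * real N) * tail_factor N * (1 + ln (real V)) ^ 2"
proof -
  define W where "W = V ^ 2"
  let ?u = "if t then 2 else 1 :: int"
  define K where "K = 6 * real N / ln (real N) * sqrt ((1 + 2 * ln (real N)) * (3 + ln (8 * real W)))"
  let ?T1 = "solvable_pairs w t N \<inter> {(d,e). d \<le> W}" and ?T2 = "solvable_pairs w t N \<inter> {(d,e). e \<le> W}"
  let ?T3 = "{(d,e). d * e \<le> N \<and> V ^ 2 < d \<and> V ^ 2 < e \<and> solvable_pair w ?u d e}"
  have W1: "W \<ge> 1" using V by (simp add: W_def)
  have WN: "4 * W ^ 2 \<le> N" using N by (simp add: W_def flip: power_mult)
  have "V ^ 4 \<ge> 1" using V by simp
  then have N4: "N \<ge> 4" using N by linarith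
  have K: "K \<ge> 0" unfolding K_def using N4 W1 by (auto intro!: mult_nonneg_nonneg divide_nonneg_nonneg)
  have fin3: "finite ?T3" by (rule finite_subset[OF _ finite_solvable_pair[of N w ?u]]) auto
  have sub: "solvable_pairs w t N \<subseteq> ?T1 \<union> ?T2 \<union> ?T3"
    by (auto simp: solvable_pairs_def W_def)
  have "card (solvable_pairs w t N) \<le> card (?T1 \<union> ?T2 \<union> ?T3)"
    by (rule card_mono[OF _ sub]) (use finite_solvable_pairs fin3 in auto)
  also have "\<dots> \<le> card ?T1 + card ?T2 + card ?T3"
    by (intro order_trans[OF card_Un_le] add_mono card_Un_le) auto
  finally have 1: "real (card (solvable_pairs w t N)) \<le> real (card ?T1) + real (card ?T2) + real (card ?T3)" by linarith
  \<comment> \<open>For fixed \<open>d\<close> the twist \<open>?u * d\<close> exceeds 1, so its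
    character is not principal and has partial sums at most \<open>8 * d \<le> 8 * W\<close>; only
    the logarithm of this enters the count of \<open>e\<close>.\<close>
  let ?S = "\<lambda>d. if primes_1_mod_4 d \<and> squarefree d \<and> (t \<or> d \<noteq> 1)
       then {e \<in> {1..N div d}. squarefree e \<and> e \<in> residue_set (?u * int d)} else {}"
  have "real (card ?T1) \<le> K * (1 + ln (real W))"
  proof (rule card_pairs_fibre_le[OF W1 _ _ K])
    show "finite (?S d)" for d by auto
    fix d assume d: "d \<in> {1..W}"
    show "real (card (?S d)) \<le> K * (1 / real d)"
    proof (cases "primes_1_mod_4 d \<and> squarefree d \<and> (t \<or> d \<noteq> 1)")
      case True
      have eq: "?u * int d = int ((if t then 2 else 1) * d)" by simp
      have "real (card {e \<in> {1..N div d}. squarefree e \<and> e \<in> residue_set (?u * int d)}) \<le> K * (1 / real d)"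
        unfolding K_def
      proof (rule card_residue_set_div_le[OF _ _ WN, of _ "8 * d"])
        fix y
        show "\<bar>\<Sum>n=1..y. rJac (?u * int d) n\<bar> \<le> real (8 * d)"
          unfolding eq by (rule sum_Jac_twist_bound[of d _ t]) (use True d in auto)
      qed (use d in auto)
      then show ?thesis unfolding if_P[OF True] .
    next
      case False
      have "0 \<le> K * (1 / real d)" using K by (intro mult_nonneg_nonneg) simp_all
      then show ?thesis unfolding if_not_P[OF False] by (simp only: card.empty of_nat_0)
    qed
  next
    show "?T1 \<subseteq> (SIGMA d:{1..W}. ?S d)"
    proof
      fix p assume "p \<in> ?T1"
      then obtain d e where p: "p = (d,e)" "d * e \<le> N" "solvable_pair w ?u d e" "t \<or> d \<noteq> 1" "d \<le> W"
        by (auto simp: solvable_pairs_def)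
      note pos = solvable_pair_pos[OF p(3)]
      have "squarefree (d * e)" using p by (simp add: solvable_pair_def)
      then have "squarefree d" "squarefree e" using squarefree_multD by blast+
      moreover have "e \<le> N div d" using p pos by (simp add: less_eq_div_iff_mult_less_eq mult.commute)
      ultimately show "p \<in> (SIGMA d:{1..W}. ?S d)"
        using p pos by (simp add: solvable_pair_def Suc_le_eq)
    qed
  qed
  moreover have "real (card ?T2) \<le> K * (1 + ln (real W))"
  proof -
    have "card ?T2 = card (prod.swap ` ?T2)" by (rule card_image[symmetric]) (rule inj_onI, auto)
    moreover have "real (card (prod.swap ` ?T2)) \<le> K * (1 + ln (real W))"
    proof (rule card_pairs_fibre_le[OF W1 _ _ K])
      \<comment> \<open>For fixed \<open>e\<close> the symbol condition on \<open>d\<close> may be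
        vacuous, as for \<open>w = e = 1\<close>. What always excludes half of the primes is that
        those of \<open>d\<close> are 1 modulo 4.\<close>
      let ?R = "\<lambda>e. {d \<in> {1..N div e}. squarefree d \<and> d \<in> residue_set (-1)}"
      show "finite (?R e)" for e by auto
      show "real (card (?R e)) \<le> K * (1 / real e)" if "e \<in> {1..W}" for e
        unfolding K_def by (rule card_residue_set_div_le[OF _ _ WN, of _ 4]) (use that W1 sum_Jac_minus_1_bound in auto)
      show "prod.swap ` ?T2 \<subseteq> (SIGMA e:{1..W}. ?R e)"
      proof
        fix q assume "q \<in> prod.swap ` ?T2"
        then obtain d e where p: "q = (e,d)" "d * e \<le> N" "solvable_pair w ?u d e" "e \<le> W"
          by (auto simp: solvable_pairs_def)
        note pos = solvable_pair_pos[OF p(3)]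
        have "squarefree (d * e)" using p by (simp add: solvable_pair_def)
        then have "squarefree d" using squarefree_multD by blast
        moreover have "d \<le> N div e" using p pos by (simp add: less_eq_div_iff_mult_less_eq)
        ultimately show "q \<in> (SIGMA e:{1..W}. ?R e)"
          using p pos by (simp add: solvable_pair_def Suc_le_eq residue_set_minus_1)
      qed
    qed
    ultimately show ?thesis by simp
  qed
  moreover have "real (card ?T3) \<le> 16 * real N / log_size N ^ 2 + 24 * real N / ln (2 * real N) * tail_factor N * (1 + ln (real V)) ^ 2"
    by (rule mid_range_bound[OF V]) (use N in simp)
  moreover have "ln (real W) = 2 * ln (real V)" using V by (simp add: W_def ln_realpow)
  moreover have "real W = real V ^ 2" by (simp add: W_def)
  moreover have "2 * (K * (1 + ln (real W))) = 12 * real N / ln (real N) * sqrt ((1 + 2 * ln (real N)) * (3 + ln (8 * real V ^ 2))) * (1 + 2 * ln (real V))"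
    unfolding K_def \<open>ln (real W) = 2 * ln (real V)\<close> \<open>real W = real V ^ 2\<close> using V by (simp add: ln_realpow)
  ultimately show ?thesis using 1 by linarith
qed

text \<open>Choosing \<open>V\<close> as the ceiling of \<open>L ^ 68\<close> with
  \<open>L = log_size N\<close> turns every error into a function of \<open>L\<close>. The largest
  has order \<open>L ^ (-1/4)\<close> times the square of \<open>ln L\<close>.\<close>

lemma solvable_pairs_density_0:
  "(\<lambda>N. real (card (solvable_pairs w t N)) / real N) \<longlonglongrightarrow> 0"
proof -
  \<comment> \<open>\<open>B\<close> is the bound per unit of \<open>N\<close> with \<open>V\<close>
    replaced by \<open>2 * y ^ 68\<close> and the logarithms in the denominators by
    \<open>y / 4\<close>; this is where 48 = 12 * 4 and 96 = 24 * 4 come from.\<close>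
  define B where "B y = 48 / y * sqrt (2 * y * (3 + ln (8 * (2 * y ^ 68) ^ 2))) * (1 + 2 * ln (2 * y ^ 68))
     + (16 / y ^ 2 + 96 / y * (sqrt (sqrt (20 * y)) * sqrt (2 * y)) * (1 + ln (2 * y ^ 68)) ^ 2)" for y :: real
  have B0: "(B \<longlongrightarrow> 0) at_top"
    unfolding B_def by real_asymp
  have "filterlim (\<lambda>x::real. 1 + ln (2 * x)) at_top at_top" by real_asymp
  then have "filterlim log_size at_top sequentially"
    unfolding log_size_def by (rule filterlim_compose[OF _ filterlim_real_sequentially])
  then have lim: "(\<lambda>N. B (log_size N)) \<longlonglongrightarrow> 0"
    by (rule filterlim_compose[OF B0])
  have ev': "eventually (\<lambda>x::real. 4 * (2 * (1 + ln (2 * x)) ^ 68) ^ 4 \<le> x) at_top" by real_asymp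
  have ev: "eventually (\<lambda>N. 4 * (2 * (1 + ln (2 * real N)) ^ 68) ^ 4 \<le> real N) sequentially"
    by (rule eventually_compose_filterlim[OF ev' filterlim_real_sequentially])
  have "eventually (\<lambda>N. real (card (solvable_pairs w t N)) / real N \<le> B (log_size N)) sequentially"
    using ev eventually_ge_at_top[of 4]
  proof eventually_elim
    case (elim N)
    define L where "L = log_size N"
    have L: "L \<ge> 1" "L = 1 + ln (2 * real N)" using elim by (simp_all add: L_def log_size_def)
    have lnN: "ln (real N) > 0" "ln (2 * real N) > 0" using elim by simp_all
    have ln4_eq: "ln (4::real) = 2 * ln 2" using ln_realpow[of 2 2] by simp
    have ln4: "0 \<le> ln (4::real)" "ln (4::real) \<le> 2" using ln4_eq ln_2_less_1 by auto
    have "ln 4 \<le> ln (real N)" using elim by (subst ln_le_cancel_iff) auto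
    moreover have "ln (2 * real N) = ln 2 + ln (real N)" using elim by (simp add: ln_mult)
    ultimately have lnL: "L / 4 \<le> ln (real N)" "L / 4 \<le> ln (2 * real N)" "ln (real N) \<le> L - 1"
      using L ln4_eq ln2_ge_two_thirds ln_2_less_1 by auto
    define V where "V = nat \<lceil>L ^ 68\<rceil>"
    have L68: "L ^ 68 \<ge> 1" using L by simp
    have V: "real V \<ge> L ^ 68" unfolding V_def by linarith
    then have "real V \<ge> 1" using L68 by linarith
    then have V1: "V \<ge> 1" by simp
    have "real V \<le> L ^ 68 + 1" unfolding V_def using L68 by linarith
    then have V2: "real V \<le> 2 * L ^ 68" using L68 by linarith
    have "real V ^ 4 \<le> (2 * L ^ 68) ^ 4" using V2 by (rule power_mono) simp
    then have "real (4 * V ^ 4) \<le> 4 * (2 * L ^ 68) ^ 4" unfolding of_nat_mult of_nat_power of_nat_numeral by linarith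
    also have "\<dots> \<le> real N" using elim L by simp
    finally have VN: "4 * V ^ 4 \<le> N" by (simp only: of_nat_le_iff)
    have lnV: "0 \<le> ln (real V)" "ln (real V) \<le> ln (2 * L ^ 68)"
      using V1 V2 L by (simp, subst ln_le_cancel_iff) auto
    have lnV2: "0 \<le> ln (8 * real V ^ 2)" "ln (8 * real V ^ 2) \<le> ln (8 * (2 * L ^ 68) ^ 2)"
    proof -
      have "1 \<le> real V ^ 2" using V1 by simp
      then show "0 \<le> ln (8 * real V ^ 2)" by (intro ln_ge_zero) linarith
      have "real V ^ 2 \<le> (2 * L ^ 68) ^ 2" using V2 by (intro power_mono) auto
      then show "ln (8 * real V ^ 2) \<le> ln (8 * (2 * L ^ 68) ^ 2)" using V1 L by (subst ln_le_cancel_iff) auto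
    qed
    have "real (card (solvable_pairs w t N)) \<le>
     12 * real N / ln (real N) * sqrt ((1 + 2 * ln (real N)) * (3 + ln (8 * real V ^ 2))) * (1 + 2 * ln (real V))
     + 16 * real N / L ^ 2 + 24 * real N / ln (2 * real N) * tail_factor N * (1 + ln (real V)) ^ 2"
      unfolding L_def by (rule card_solvable_pairs_le[OF _ V1 VN]) (use V in \<open>simp add: L_def\<close>)
    also have "\<dots> \<le> 12 * real N / (L / 4) * sqrt (2 * L * (3 + ln (8 * (2 * L ^ 68) ^ 2))) * (1 + 2 * ln (2 * L ^ 68))
     + 16 * real N / L ^ 2 + 24 * real N / (L / 4) * (sqrt (sqrt (20 * L)) * sqrt (2 * L)) * (1 + ln (2 * L ^ 68)) ^ 2"
    proof (intro add_mono mult_mono order.refl power_mono real_sqrt_le_mono)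
      show "12 * real N / ln (real N) \<le> 12 * real N / (L / 4)" "24 * real N / ln (2 * real N) \<le> 24 * real N / (L / 4)"
        by (rule divide_left_mono[OF lnL(1)] divide_left_mono[OF lnL(2)]; use L(1) lnN in simp)+
      have "(1 + 4 * ln (2 * real N)) * (3 + ln 4) \<le> (4 * L) * 5"
        using L lnN ln4 by (intro mult_mono) auto
      then have f: "(1 + 4 * ln (2 * real N)) * (3 + ln 4) \<le> 20 * L" "1 + 2 * ln (2 * real N) \<le> 2 * L"
        using L lnN by linarith+
      show "tail_factor N \<le> sqrt (sqrt (20 * L)) * sqrt (2 * L)"
        unfolding tail_factor_def by (intro mult_mono real_sqrt_le_mono f) (use L(1) lnN in simp_all)
    qed (use L lnN lnL lnV lnV2 in \<open>auto simp: tail_factor_def intro!: mult_nonneg_nonneg divide_nonneg_nonneg\<close>)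
    also have "\<dots> = B L * real N"
      unfolding B_def by (simp add: algebra_simps)
    finally show ?case using elim by (simp add: divide_le_eq L_def)
  qed
  then show ?thesis
    by (rule tendsto_sandwich[OF _ _ tendsto_const lim, rotated]) simp
qed

section \<open>Local solubility\<close>

lemma padic_int_mod:
  assumes "padic_int p x" "j \<le> k"
  shows "x k mod p ^ j = x j"
  using assms(2)
proof (induction k rule: dec_induct)
  case base
  have "0 \<le> x j" "x j < p ^ j" using assms by (auto simp: padic_int_def)
  then show ?case by simp
next
  case (step k)
  have "x (Suc k) mod p ^ k = x k" using assms by (auto simp: padic_int_def)
  moreover have "x (Suc k) mod p ^ k mod p ^ j = x (Suc k) mod p ^ j"
    using step by (intro mod_mod_cancel le_imp_power_dvd)
  ultimately show ?case using step by simp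
qed

text \<open>The denominator \<open>p ^ m\<close> is absorbed into \<open>z\<close>, and a common
  factor \<open>p ^ v\<close> of \<open>x\<close> and \<open>y\<close> is divided out,
  \<open>z\<close> losing \<open>p ^ (2 * v)\<close> by homogeneity. What remains is a primitive
  solution modulo any prescribed power of \<open>p\<close>.\<close>

lemma soluble_Qp_primitive:
  assumes p: "prime p" and sol: "soluble_Qp p a 0 c"
  obtains x y z :: int where "\<not> (p dvd x \<and> p dvd y)" "p ^ K dvd z ^ 2 - (a * x ^ 4 + c * y ^ 4)"
proof -
  obtain m x y z where xy: "padic_int p x" "padic_int p y" and nz: "x \<noteq> (\<lambda>_. 0) \<or> y \<noteq> (\<lambda>_. 0)"
    and eq: "\<And>k. (p ^ (2 * m) * (z k) ^ 2) mod p ^ k = (quartic_eval a 0 c (x k) (y k)) mod p ^ k"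
    using sol unfolding soluble_Qp_def by blast
  obtain k0 where k0: "x k0 \<noteq> 0 \<or> y k0 \<noteq> 0" using nz by (auto simp: fun_eq_iff)
  \<comment> \<open>Dividing out \<open>p ^ v\<close> lowers the precision by \<open>4 * v\<close>,
    and \<open>v < k0\<close>; starting at level \<open>5 * k0 + K\<close> leaves at least
    \<open>K\<close>.\<close>
  define k where "k = 5 * k0 + K"
  have "\<not> (p ^ k0 dvd x k \<and> p ^ k0 dvd y k)"
    using padic_int_mod[OF xy(1), of k0 k] padic_int_mod[OF xy(2), of k0 k] k0
    by (auto simp: k_def dvd_eq_mod_eq_0)
  define n where "n = (LEAST n. \<not> (p ^ n dvd x k \<and> p ^ n dvd y k))"
  have n: "\<not> (p ^ n dvd x k \<and> p ^ n dvd y k)" "n \<le> k0"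
    unfolding n_def using \<open>\<not> (p ^ k0 dvd x k \<and> p ^ k0 dvd y k)\<close> by (rule LeastI, rule Least_le)
  have "n \<noteq> 0" using n(1) by (intro notI) simp
  then obtain v where v: "n = Suc v" by (cases n) auto
  have "v < (LEAST n. \<not> (p ^ n dvd x k \<and> p ^ n dvd y k))" using v n_def by simp
  then have "p ^ v dvd x k \<and> p ^ v dvd y k" using not_less_Least by blast
  then obtain X Y where XY: "x k = p ^ v * X" "y k = p ^ v * Y" by (auto elim!: dvdE)
  have prim: "\<not> (p dvd X \<and> p dvd Y)"
    using n(1) p by (auto simp: v XY mult.commute)
  define Z where "Z = p ^ m * z k"
  have p0: "p \<noteq> 0" using p by auto
  have "p ^ k dvd Z ^ 2 - (a * x k ^ 4 + c * y k ^ 4)"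
    using eq[of k] by (simp add: Z_def quartic_eval_def mod_eq_dvd_iff power_mult_distrib mult.commute flip: power_mult)
  also have "Z ^ 2 - (a * x k ^ 4 + c * y k ^ 4) = Z ^ 2 - p ^ (4 * v) * (a * X ^ 4 + c * Y ^ 4)"
    by (simp add: XY power_mult_distrib algebra_simps flip: power_mult)
  finally have d: "p ^ k dvd Z ^ 2 - p ^ (4 * v) * (a * X ^ 4 + c * Y ^ 4)" .
  have vk: "4 * v + K \<le> k" using n(2) v by (simp add: k_def)
  have "p ^ (4 * v) dvd p ^ k" using vk by (intro le_imp_power_dvd) simp
  then have "p ^ (4 * v) dvd Z ^ 2 - p ^ (4 * v) * (a * X ^ 4 + c * Y ^ 4)" using d by (rule dvd_trans)
  then have "p ^ (4 * v) dvd Z ^ 2" by (metis dvd_diffD1 dvd_triv_left dvd_diff_commute diff_add_cancel dvd_add)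
  then have "(p ^ (2 * v)) ^ 2 dvd Z ^ 2" by (simp flip: power_mult)
  then have "p ^ (2 * v) dvd Z" by simp
  then obtain Z' where Z': "Z = p ^ (2 * v) * Z'" by (elim dvdE)
  have "Z ^ 2 - p ^ (4 * v) * (a * X ^ 4 + c * Y ^ 4) = p ^ (4 * v) * (Z' ^ 2 - (a * X ^ 4 + c * Y ^ 4))"
    by (simp add: Z' power_mult_distrib right_diff_distrib flip: power_mult)
  moreover have "p ^ (4 * v) * p ^ K dvd p ^ k" using vk by (simp add: le_imp_power_dvd flip: power_add)
  ultimately have "p ^ (4 * v) * p ^ K dvd p ^ (4 * v) * (Z' ^ 2 - (a * X ^ 4 + c * Y ^ 4))"
    using d dvd_trans by metis
  then have "p ^ K dvd Z' ^ 2 - (a * X ^ 4 + c * Y ^ 4)" using p0 by simp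
  with prim show ?thesis by (rule that)
qed

lemma Legendre_square_cong:
  assumes "prime p" "2 < p" "[b ^ 2 * t = s ^ 2] (mod int p)" "\<not> int p dvd s"
  shows "Legendre t (int p) = 1"
proof -
  have sq: "Legendre (x ^ 2) (int p) \<in> {0, 1}" for x
    using Legendre_vals[of x "int p"] by (auto simp: power2_eq_square Legendre_mult[OF assms(1,2)])
  have "Legendre (b ^ 2 * t) (int p) = Legendre (s ^ 2) (int p)" using assms by (intro Legendre_cong)
  moreover have "Legendre (s ^ 2) (int p) \<noteq> 0"
    using assms by (auto simp: Legendre_def cong_0_iff prime_dvd_power_iff)
  ultimately have "Legendre (b ^ 2) (int p) * Legendre t (int p) = 1"
    using sq[of s] by (auto simp: Legendre_mult[OF assms(1,2)])
  then show ?thesis using sq[of b] by auto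
qed

text \<open>Since \<open>-4 = (1 + \<iota>)\<^sup>4\<close> when \<open>\<iota>\<^sup>2 = -1\<close>, a zero of \<open>(u x\<^sup>2)\<^sup>2 + 4 (s e y\<^sup>2)\<^sup>2\<close> modulo \<open>p\<close>
  exhibits \<open>u s e\<close> as a square.\<close>
lemma Legendre_of_sum_zero:
  assumes p: "prime p" "2 < p" and d: "int p dvd (u * x ^ 2) ^ 2 + 4 * (s * e * y ^ 2) ^ 2"
    and nd: "\<not> int p dvd u" "\<not> int p dvd x" "\<not> int p dvd s * e * y ^ 2"
  shows "Legendre (-1) (int p) = 1" "Legendre (u * s * e) (int p) = 1"
proof -
  let ?g = "u * x ^ 2" and ?h = "s * e * y ^ 2"
  have pi: "prime (int p)" using p by simp
  have ndg: "\<not> int p dvd ?g" using nd pi by (simp add: prime_dvd_mult_iff prime_dvd_power_iff)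
  have "int p dvd (2 * ?h) ^ 2 * (-1) - ?g ^ 2"
  proof -
    have "(2 * ?h) ^ 2 * (-1) - ?g ^ 2 = - (?g ^ 2 + 4 * ?h ^ 2)" by (simp add: power_mult_distrib)
    then show ?thesis using d by (simp only: dvd_minus_iff)
  qed
  then have "[(2 * ?h) ^ 2 * (-1) = ?g ^ 2] (mod int p)" by (simp add: cong_iff_dvd_diff)
  then show L1: "Legendre (-1) (int p) = 1" using Legendre_square_cong[OF p _ ndg] by blast
  then obtain i where "[i ^ 2 = -1] (mod int p)"
    by (auto simp: Legendre_def QuadRes_def split: if_splits)
  then have i: "int p dvd i ^ 2 + 1" by (simp add: cong_iff_dvd_diff)
  \<comment> \<open>With \<open>i\<close> a square root of -1 modulo \<open>p\<close> the sum of
    squares splits into two linear factors. Replacing \<open>i\<close> by its negative if necessary,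
    the factor with the minus sign vanishes.\<close>
  have "(?g - 2 * i * ?h) * (?g + 2 * i * ?h) = (?g ^ 2 + 4 * ?h ^ 2) - 4 * ?h ^ 2 * (i ^ 2 + 1)"
    by (simp add: algebra_simps power2_eq_square)
  moreover have "int p dvd (?g ^ 2 + 4 * ?h ^ 2) - 4 * ?h ^ 2 * (i ^ 2 + 1)" using d i by (intro dvd_diff dvd_mult)
  ultimately have "int p dvd (?g - 2 * i * ?h) * (?g + 2 * i * ?h)" by metis
  then have "int p dvd ?g - 2 * i * ?h \<or> int p dvd ?g + 2 * i * ?h" using pi by (simp only: prime_dvd_mult_iff)
  then obtain j where j: "int p dvd ?g - 2 * j * ?h" "int p dvd j ^ 2 + 1"
  proof
    assume "int p dvd ?g - 2 * i * ?h" then show ?thesis using i by (rule that)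
  next
    assume "int p dvd ?g + 2 * i * ?h"
    then show ?thesis using i by (intro that[of "- i"]) simp_all
  qed
  \<comment> \<open>Modulo \<open>p\<close> one has \<open>(1 + j) ^ 2 = 2 * j\<close>, so
    \<open>u * s * e\<close> times the square of \<open>(1 + j) * y\<close> is the square of
    \<open>u * x\<close>.\<close>
  have "((1 + j) * y) ^ 2 * (u * s * e) - (u * x) ^ 2 = (j ^ 2 + 1) * (y ^ 2 * (u * s * e)) - u * (?g - 2 * j * ?h)"
    by (simp add: algebra_simps power2_eq_square)
  moreover have "int p dvd (j ^ 2 + 1) * (y ^ 2 * (u * s * e)) - u * (?g - 2 * j * ?h)"
    by (intro dvd_diff dvd_mult[OF j(1)] dvd_mult2[OF j(2)])
  ultimately have "int p dvd ((1 + j) * y) ^ 2 * (u * s * e) - (u * x) ^ 2" by metis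
  then have "[((1 + j) * y) ^ 2 * (u * s * e) = (u * x) ^ 2] (mod int p)" by (simp add: cong_iff_dvd_diff)
  moreover have "\<not> int p dvd u * x" using nd pi by (simp add: prime_dvd_mult_iff)
  ultimately show "Legendre (u * s * e) (int p) = 1" using Legendre_square_cong[OF p] by blast
qed

text \<open>Here \<open>p\<close> divides both coefficients exactly once, and \<open>d\<close>
  stands for the part without \<open>p\<close>. Modulo \<open>p ^ 2\<close> the prime must divide
  \<open>z\<close>, so the form divided by \<open>p\<close> vanishes modulo \<open>p\<close>, and
  primitivity makes both \<open>x\<close> and \<open>y\<close> units. Multiplying by
  \<open>u\<close> and using \<open>u * u' = 4 * s ^ 2\<close> yields a zero of the sum of squares
  treated above.\<close>

lemma local_condition_dvd_left:
  assumes p: "prime p" "2 < p" and sol: "soluble_Qp (int p) a 0 c"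
    and a: "a = int p * (u * d)" and c: "c = int p * (u' * d * e ^ 2)" and uu: "u * u' = 4 * s ^ 2"
    and nd: "\<not> int p dvd u" "\<not> int p dvd u'" "\<not> int p dvd d" "\<not> int p dvd e" "\<not> int p dvd s"
  shows "Legendre (-1) (int p) = 1 \<and> Legendre (u * s * e) (int p) = 1"
proof -
  have pi: "prime (int p)" using p by simp
  obtain x y z where prim: "\<not> (int p dvd x \<and> int p dvd y)" and z: "int p ^ 2 dvd z ^ 2 - (a * x ^ 4 + c * y ^ 4)"
    using soluble_Qp_primitive[OF pi sol] by blast
  let ?q = "u * x ^ 4 + u' * e ^ 2 * y ^ 4"
  have eq: "a * x ^ 4 + c * y ^ 4 = int p * (d * ?q)" by (simp add: a c algebra_simps)
  have "int p dvd int p ^ 2" by (simp add: power2_eq_square)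
  then have "int p dvd z ^ 2 - int p * (d * ?q)" using z unfolding eq by (rule dvd_trans)
  then have "int p dvd z ^ 2" by (metis diff_add_cancel dvd_add dvd_triv_left)
  then have "int p dvd z" using pi prime_dvd_power by blast
  then have "int p ^ 2 dvd z ^ 2" by simp
  then have "int p ^ 2 dvd int p * (d * ?q)" using z unfolding eq by (metis dvd_diff_commute dvd_diff diff_diff_eq2 add_diff_cancel_left')
  then have "int p dvd d * ?q" using p by (simp add: power2_eq_square)
  then have q: "int p dvd ?q" using nd pi by (simp add: prime_dvd_mult_iff)
  have "\<not> int p dvd x"
  proof
    assume x: "int p dvd x"
    then have "int p dvd x ^ 4" by (simp add: power4_eq_xxxx)
    then have "int p dvd u * x ^ 4" by (rule dvd_mult)
    then have "int p dvd u' * e ^ 2 * y ^ 4" using q by (simp add: dvd_add_right_iff)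
    then have "int p dvd y" using nd pi by (simp add: prime_dvd_mult_iff prime_dvd_power_iff)
    then show False using x prim by blast
  qed
  have "\<not> int p dvd y"
  proof
    assume y: "int p dvd y"
    then have "int p dvd y ^ 4" by (simp add: power4_eq_xxxx)
    then have "int p dvd u' * e ^ 2 * y ^ 4" by (rule dvd_mult)
    then have "int p dvd u * x ^ 4" using q by (simp add: dvd_add_left_iff)
    then have "int p dvd x" using nd pi by (simp add: prime_dvd_mult_iff prime_dvd_power_iff)
    then show False using y prim by blast
  qed
  have "(u * x ^ 2) ^ 2 + 4 * (s * e * y ^ 2) ^ 2 = u * u * x ^ 4 + (4 * s ^ 2) * (e ^ 2 * y ^ 4)"
    by (simp add: algebra_simps power2_eq_square power4_eq_xxxx)
  also have "\<dots> = u * ?q" unfolding uu[symmetric] by (simp add: algebra_simps)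
  finally have "int p dvd (u * x ^ 2) ^ 2 + 4 * (s * e * y ^ 2) ^ 2" using q by simp
  moreover have "\<not> int p dvd s * e * y ^ 2"
    using nd pi \<open>\<not> int p dvd y\<close> by (simp add: prime_dvd_mult_iff prime_dvd_power_iff)
  ultimately show ?thesis using Legendre_of_sum_zero[OF p] nd \<open>\<not> int p dvd x\<close> by blast
qed

text \<open>Here \<open>p\<close> does not divide the first coefficient and divides \<open>c\<close>
  exactly twice; \<open>e\<close> stands for the part without \<open>p\<close>. If \<open>x\<close>
  is a unit, the first coefficient is a square modulo \<open>p\<close>. Otherwise \<open>p\<close>
  divides \<open>z\<close> too, and after division by \<open>p ^ 2\<close> the second coefficient is
  a square. Both cases mean the same, because \<open>u * u' = 4 * s ^ 2\<close>. Precision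
  \<open>p ^ 3\<close> is what the second case requires.\<close>

lemma local_condition_dvd_right:
  assumes p: "prime p" "2 < p" and sol: "soluble_Qp (int p) (u * d) 0 c"
    and c: "c = int p ^ 2 * (u' * d * e ^ 2)" and uu: "u * u' = 4 * s ^ 2"
    and nd: "\<not> int p dvd u" "\<not> int p dvd u'" "\<not> int p dvd d" "\<not> int p dvd e" "\<not> int p dvd s"
  shows "Legendre (u * d) (int p) = 1"
proof -
  have pi: "prime (int p)" using p by simp
  have n2: "\<not> int p dvd 2" using p by (auto dest: zdvd_imp_le)
  obtain x y z where prim: "\<not> (int p dvd x \<and> int p dvd y)" and z: "int p ^ 3 dvd z ^ 2 - (u * d * x ^ 4 + c * y ^ 4)"
    using soluble_Qp_primitive[OF pi sol] by blast
  have "int p dvd int p ^ 3" by (simp add: power3_eq_cube)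
  then have z1: "int p dvd z ^ 2 - (u * d * x ^ 4 + c * y ^ 4)" using z by (rule dvd_trans)
  have pc: "int p dvd c" by (simp add: c power2_eq_square)
  have "z ^ 2 - u * d * x ^ 4 = (z ^ 2 - (u * d * x ^ 4 + c * y ^ 4)) + c * y ^ 4" by simp
  then have z2: "int p dvd z ^ 2 - u * d * x ^ 4" using z1 pc by (metis dvd_add dvd_mult2)
  show ?thesis
  proof (cases "int p dvd x")
    case False
    have "[(x ^ 2) ^ 2 * (u * d) = z ^ 2] (mod int p)"
      using z2 by (simp add: cong_iff_dvd_diff mult.commute dvd_diff_commute flip: power_mult)
    moreover have "\<not> int p dvd z"
    proof
      assume "int p dvd z"
      then have "int p dvd z ^ 2" by (simp add: power2_eq_square)
      then have "int p dvd u * d * x ^ 4" using z2 by (metis dvd_diff_right_iff)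
      then show False using nd False pi by (simp add: prime_dvd_mult_iff prime_dvd_power_iff)
    qed
    ultimately show ?thesis using Legendre_square_cong[OF p] by blast
  next
    case True
    then have y: "\<not> int p dvd y" using prim by blast
    obtain x' where x': "x = int p * x'" using True by (elim dvdE)
    have "int p dvd x ^ 4" using True by (simp add: power4_eq_xxxx)
    then have "int p dvd u * d * x ^ 4" by (rule dvd_mult)
    then have "int p dvd z ^ 2" using z2 by (metis diff_add_cancel dvd_add)
    then have "int p dvd z" using pi prime_dvd_power by blast
    then obtain z' where z': "z = int p * z'" by (elim dvdE)
    have "z ^ 2 - (u * d * x ^ 4 + c * y ^ 4) = int p ^ 2 * (z' ^ 2 - (u * d * (int p * (int p * x' ^ 4)) + u' * d * e ^ 2 * y ^ 4))"
      by (simp add: x' z' c algebra_simps power_numeral_reduce)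
    then have "int p ^ 2 * int p dvd int p ^ 2 * (z' ^ 2 - (u * d * (int p * (int p * x' ^ 4)) + u' * d * e ^ 2 * y ^ 4))"
      using z by (simp add: power3_eq_cube power2_eq_square)
    then have "int p dvd z' ^ 2 - (u * d * (int p * (int p * x' ^ 4)) + u' * d * e ^ 2 * y ^ 4)" using p by simp
    moreover have "z' ^ 2 - u' * d * e ^ 2 * y ^ 4 = (z' ^ 2 - (u * d * (int p * (int p * x' ^ 4)) + u' * d * e ^ 2 * y ^ 4))
       + int p * (u * d * (int p * x' ^ 4))" by (simp add: algebra_simps)
    ultimately have z3: "int p dvd z' ^ 2 - u' * d * e ^ 2 * y ^ 4" by (metis dvd_add dvd_triv_left)
    have "u ^ 2 * (z' ^ 2 - u' * d * e ^ 2 * y ^ 4) = (u * z') ^ 2 - (2 * s * e * y ^ 2) ^ 2 * (u * d)"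
    proof -
      have "u ^ 2 * (u' * d * e ^ 2 * y ^ 4) = (u * u') * (u * d * e ^ 2 * y ^ 4)" by (simp add: power2_eq_square algebra_simps)
      also have "\<dots> = (2 * s * e * y ^ 2) ^ 2 * (u * d)" unfolding uu by (simp add: power_mult_distrib flip: power_mult)
      finally show ?thesis by (simp add: right_diff_distrib power_mult_distrib)
    qed
    then have "int p dvd (u * z') ^ 2 - (2 * s * e * y ^ 2) ^ 2 * (u * d)" using z3 by (metis dvd_mult)
    then have z4: "int p dvd (2 * s * e * y ^ 2) ^ 2 * (u * d) - (u * z') ^ 2" by (simp add: dvd_diff_commute)
    then have "[(2 * s * e * y ^ 2) ^ 2 * (u * d) = (u * z') ^ 2] (mod int p)" by (simp only: cong_iff_dvd_diff)
    moreover have "\<not> int p dvd u * z'"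
    proof
      assume "int p dvd u * z'"
      then have "int p dvd (u * z') ^ 2" by (simp add: power2_eq_square)
      then have "int p dvd (2 * s * e * y ^ 2) ^ 2 * (u * d)" using z4 by (metis diff_add_cancel dvd_add)
      then show False using nd y n2 pi by (simp add: prime_dvd_mult_iff prime_dvd_power_iff)
    qed
    ultimately show ?thesis using Legendre_square_cong[OF p] by blast
  qed
qed

section \<open>Counting soluble forms\<close>

lemma squarefree_dvd_square_imp_dvd:
  fixes d n :: nat
  assumes "squarefree d" "d dvd n ^ 2" "n > 0"
  shows "d dvd n"
proof (rule multiplicity_le_imp_dvd)
  show "d \<noteq> 0" using assms(1) by (intro notI) simp
  fix p :: nat assume p: "prime p"
  show "multiplicity p d \<le> multiplicity p n"
  proof (cases "p dvd d")
    case True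
    then have "p dvd n" using assms p by (meson dvd_trans prime_dvd_power)
    then have "multiplicity p n \<ge> 1" using p assms by (simp add: Suc_le_eq prime_multiplicity_gt_zero_iff)
    moreover have "multiplicity p d \<le> 1" using assms(1) p \<open>d \<noteq> 0\<close> by (auto simp: squarefree_factorial_semiring'')
    ultimately show ?thesis by simp
  qed (simp add: not_dvd_imp_multiplicity_0)
qed

lemma finite_F_fam: "M \<noteq> 0 \<Longrightarrow> finite (F_fam B M)"
proof (rule finite_subset)
  assume "M \<noteq> 0"
  then show "finite ({d. d dvd M} \<times> {d. d dvd M})" by simp
  show "F_fam B M \<subseteq> {d. d dvd M} \<times> {d. d dvd M}" by (auto simp: F_fam_def)
qed

text \<open>The real place serves to fix the sign of the leading coefficient.\<close>

lemma soluble_R_imp_pos: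
  assumes "soluble_R a 0 c" "a * c > 0"
  shows "a > 0"
proof (rule ccontr)
  assume "\<not> a > 0"
  then have ac: "a < 0" "c < 0" using assms(2) by (auto simp: zero_less_mult_iff)
  obtain x y z :: real where xyz: "(x, y) \<noteq> (0, 0)" "z ^ 2 = of_int a * x ^ 4 + of_int c * y ^ 4"
    using assms(1) by (auto simp: soluble_R_def quartic_eval_def)
  have "of_int a * x ^ 4 \<le> 0" "of_int c * y ^ 4 \<le> 0"
    using ac by (auto intro!: mult_nonpos_nonneg)
  moreover have "z ^ 2 \<ge> 0" by simp
  ultimately have "of_int a * x ^ 4 = 0" "of_int c * y ^ 4 = 0" using xyz(2) by linarith+
  then show False using ac xyz(1) by simp
qed

text \<open>A pair \<open>(a, c)\<close> with \<open>a c = 4 n\<^sup>2\<close> is encoded by \<open>a = u d\<close> and \<open>n = s d e\<close>, where \<open>u\<close> and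
  \<open>s\<close> are the 2-parts of \<open>a\<close> and \<open>n\<close>.\<close>
lemma locally_soluble_decomposition:
  assumes n: "squarefree n" and F: "(a, c) \<in> F_ls 0 (4 * int n ^ 2)"
  obtains d e where "a = (if even a then 2 else 1) * int d" "n = (if even n then 2 else 1) * d * e"
    "solvable_pair ((if even a then 2 else 1) * (if even n then 2 else 1)) (if even a then 2 else 1) d e"
proof -
  have n0: "n > 0" using n by (auto intro: Nat.gr0I)
  have ac: "a * c = 4 * int n ^ 2" and mult: "\<And>p. prime p \<Longrightarrow> multiplicity p a \<le> 1"
    and ls: "soluble_R a 0 c" "\<And>p. prime p \<Longrightarrow> soluble_Qp p a 0 c"
    using F by (auto simp: F_ls_def F_fam_def locally_soluble_def)
  have acpos: "a * c > 0" using n0 unfolding ac by simp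
  have a0: "a > 0" by (rule soluble_R_imp_pos[OF ls(1) acpos])
  define A where "A = nat a"
  have A: "a = int A" "A > 0" using a0 by (simp_all add: A_def)
  have sqA: "squarefree A"
  proof (subst squarefree_factorial_semiring)
    show "A \<noteq> 0" using A by simp
    show "\<forall>p. prime p \<longrightarrow> \<not> p ^ 2 dvd A"
    proof (intro allI impI notI)
      fix p assume p: "prime p" "p ^ 2 dvd A"
      then have "int p ^ 2 dvd a" unfolding A by (metis of_nat_dvd_iff of_nat_power)
      then have "2 \<le> multiplicity (int p) a" using a0 p by (intro multiplicity_geI) auto
      then show False using mult[of "int p"] p by simp
    qed
  qed
  define u where "u = (if even A then 2 else 1 :: nat)"
  define s where "s = (if even n then 2 else 1 :: nat)"
  have "u dvd A" "s dvd n" by (auto simp: u_def s_def)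
  then obtain d m where d: "A = u * d" and m: "n = s * m" by (elim dvdE)
  have sqd: "squarefree d" and sqm: "squarefree m" using sqA n d m squarefree_multD by blast+
  have "odd d"
  proof
    assume ev: "even d"
    have "even A" unfolding d using ev by simp
    then have "u = 2" by (simp add: u_def)
    then have "2 ^ 2 dvd A" unfolding d using ev by (auto simp: power2_eq_square)
    then show False using squarefreeD[OF sqA, of 2] by simp
  qed
  have "odd m"
  proof
    assume ev: "even m"
    have "even n" unfolding m using ev by simp
    then have "s = 2" by (simp add: s_def)
    then have "2 ^ 2 dvd n" unfolding m using ev by (auto simp: power2_eq_square)
    then show False using squarefreeD[OF n, of 2] by simp
  qed
  have "int A dvd int (4 * n ^ 2)" using ac unfolding A by (metis dvd_triv_left of_nat_mult of_nat_numeral of_nat_power)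
  then have "A dvd 4 * n ^ 2" by (simp only: of_nat_dvd_iff)
  \<comment> \<open>The odd \<open>d\<close> is coprime to the power of 2, so it divides
    \<open>m ^ 2\<close>; being squarefree it then divides \<open>m\<close>, which yields the
    cofactor \<open>e\<close>.\<close>
  then have "d dvd 4 * s ^ 2 * m ^ 2" using d m by (metis dvd_mult_right mult.assoc power_mult_distrib)
  moreover have "coprime d (4 * s ^ 2)"
  proof -
    have "coprime d (2 ^ 2)" using \<open>odd d\<close> by (subst coprime_power_right_iff) simp
    moreover have "coprime d (s ^ 2)" using \<open>odd d\<close> by (auto simp: s_def)
    ultimately show ?thesis by simp
  qed
  ultimately have "d dvd m ^ 2" by (simp add: coprime_dvd_mult_right_iff)
  moreover have "m > 0" using m n0 by (auto intro: Nat.gr0I)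
  ultimately have "d dvd m" using squarefree_dvd_square_imp_dvd sqd by blast
  then obtain e where e: "m = d * e" by (elim dvdE)
  have odd_e: "odd e" using \<open>odd m\<close> e by simp
  have pos: "d > 0" "e > 0" "u > 0" "s > 0" using \<open>m > 0\<close> e by (auto intro!: Nat.gr0I simp: u_def s_def)
  have sqde: "squarefree (d * e)" using sqm e by simp
  have cop: "coprime d e" using sqde by (rule squarefree_mult_imp_coprime)
  \<comment> \<open>\<open>u'\<close> is the power of 2 in \<open>c\<close>, determined by
    \<open>u * u' = 4 * s ^ 2\<close>.\<close>
  define u' where "u' = (if even A then 2 else 4 :: int) * int s ^ 2"
  have uu: "int u * u' = 4 * int s ^ 2" by (simp add: u'_def u_def)
  have "int u * int d * c = int u * int d * (u' * int d * int e ^ 2)"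
  proof -
    have "int u * int d * c = 4 * int s ^ 2 * (int d ^ 2 * int e ^ 2)"
      using ac unfolding A d m e by (simp add: power_mult_distrib mult_ac)
    also have "\<dots> = int u * int d * (u' * int d * int e ^ 2)"
      unfolding uu[symmetric] by (simp add: power2_eq_square mult_ac)
    finally show ?thesis .
  qed
  then have c: "c = u' * int d * int e ^ 2" using pos by simp
  have unit: "\<not> int p dvd int u" "\<not> int p dvd u'" "\<not> int p dvd int s" if p: "prime p" "2 < p" for p
  proof -
    have pi: "prime (int p)" using p by simp
    have "\<not> int p dvd 2" using p by (auto dest: zdvd_imp_le)
    moreover from this have "\<not> int p dvd 2 ^ 2" using pi prime_dvd_power by blast
    ultimately show s': "\<not> int p dvd int s" and "\<not> int p dvd int u" "\<not> int p dvd u'"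
      using pi p by (auto simp: u_def s_def u'_def prime_dvd_mult_iff prime_dvd_power_iff)
  qed
  have gt2: "2 < p" if "prime p" "p dvd d \<or> p dvd e" for p
    using that odd_e \<open>odd d\<close> prime_ge_2_nat[of p] by (cases "p = 2") auto
  have left: "Jac (-1) p = 1 \<and> Jac (int u * int s * int e) p = 1" if p: "prime p" "p dvd d" for p
  proof -
    have p2: "2 < p" using gt2 p by blast
    obtain d' where d': "d = p * d'" using p by (elim dvdE)
    have "squarefree (p * d')" using sqd d' by simp
    then have "coprime p d'" by (rule squarefree_mult_imp_coprime)
    then have "\<not> p dvd d'" using p by (metis coprime_absorb_left not_prime_unit)
    moreover have "\<not> p dvd e" using cop p by (metis coprime_common_divisor not_prime_unit)
    moreover have "a = int p * (int u * int d')" unfolding A d d' by (simp add: mult_ac)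
    moreover have "c = int p * (u' * int d' * int e ^ 2)" unfolding c d' by (simp add: mult_ac)
    ultimately have "Legendre (-1) (int p) = 1 \<and> Legendre (int u * int s * int e) (int p) = 1"
      using local_condition_dvd_left[OF p(1) p2 ls(2)[of "int p"], of "int u" "int d'" u' "int e" "int s"] uu unit[OF p(1) p2] p
      by simp
    moreover have "odd p" using p p2 by (metis prime_odd_nat)
    ultimately show ?thesis using p by (simp add: Jac_prime)
  qed
  have right: "Jac (int u * int d) p = 1" if p: "prime p" "p dvd e" for p
  proof -
    have p2: "2 < p" using gt2 p by blast
    obtain e' where e': "e = p * e'" using p by (elim dvdE)
    have "squarefree (p * e')" using sqde e' squarefree_multD by metis
    then have "coprime p e'" by (rule squarefree_mult_imp_coprime)
    then have "\<not> p dvd e'" using p by (metis coprime_absorb_left not_prime_unit)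
    moreover have "\<not> p dvd d" using cop p by (metis coprime_common_divisor not_prime_unit)
    moreover have "a = int u * int d" unfolding A d by simp
    moreover have "c = int p ^ 2 * (u' * int d * int e' ^ 2)" unfolding c e' by (simp add: power_mult_distrib mult_ac)
    ultimately have "Legendre (int u * int d) (int p) = 1"
      using local_condition_dvd_right[OF p(1) p2, of "int u" "int d" c u' "int e'" "int s"] ls(2)[of "int p"] uu unit[OF p(1) p2] p
      by simp
    moreover have "odd p" using p p2 by (metis prime_odd_nat)
    ultimately show ?thesis using p by (simp add: Jac_prime)
  qed
  have sol: "solvable_pair (int u * int s) (int u) d e"
    unfolding solvable_pair_def residue_set_minus_1[symmetric]
    using sqde left right pos by (auto simp: residue_set_def)
  have us: "int u = (if even a then 2 else 1)" "int s = (if even n then 2 else 1)"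
    by (simp_all add: u_def s_def A)
  have "a = int u * int d" unfolding A d by simp
  moreover have "n = s * d * e" unfolding mult.assoc e[symmetric] by (rule m)
  ultimately show ?thesis using sol unfolding us unfolding s_def by (rule that)
qed

text \<open>Each \<open>n\<close> has one form with leading coefficient 1, which accounts for the
  first term. Every other form comes from a solvable pair, together with the parity \<open>t\<close>
  of \<open>a\<close> and the value 1, 2 or 4 of \<open>w = u * s\<close>.\<close>

lemma sum_card_F_ls_le:
  "(\<Sum>n\<in>{n\<in>{1..N}. squarefree n}. real (card (F_ls 0 (4 * int n ^ 2))))
    \<le> real (card {n\<in>{1..N}. squarefree n}) + (\<Sum>p\<in>UNIV \<times> {1,2,4}. real (card (solvable_pairs (snd p) (fst p) N)))"
proof -
  let ?Q = "{n\<in>{1..N}. squarefree n}"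
  let ?I = "UNIV \<times> {1,2,4::int}"
  define G where "G = (SIGMA n:?Q. F_ls 0 (4 * int n ^ 2) - {(1, 4 * int n ^ 2)})"
  define H where "H = (SIGMA p:?I. solvable_pairs (snd p) (fst p) N)"
  \<comment> \<open>The decoding map: \<open>w div u\<close> recovers \<open>s\<close>, hence
    \<open>n = s * d * e\<close> and \<open>a = u * d\<close>, and \<open>c\<close> is fixed by the
    product \<open>a * c = 4 * n ^ 2\<close>.\<close>
  define f where "f = (\<lambda>((t,w),(d,e)). let u = (if t then 2 else 1 :: int); n = nat (w div u) * d * e; a = u * int d
     in (n, (a, (4 * int n ^ 2) div a)))"
  have finF: "finite (F_ls 0 (4 * int n ^ 2))" if "n > 0" for n
    by (rule finite_subset[OF _ finite_F_fam[of "4 * int n ^ 2" 0]]) (use that in \<open>auto simp: F_ls_def\<close>)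
  have finH: "finite H" unfolding H_def by (intro finite_SigmaI) (auto simp: finite_solvable_pairs)
  have "G \<subseteq> f ` H"
  proof
    fix g assume "g \<in> G"
    then obtain n a c where g: "g = (n, (a, c))" and n: "1 \<le> n" "n \<le> N" "squarefree n"
      and F: "(a, c) \<in> F_ls 0 (4 * int n ^ 2)" and ne: "(a, c) \<noteq> (1, 4 * int n ^ 2)"
      by (auto simp: G_def)
    let ?u = "if even a then 2 else 1 :: int" and ?s = "if even n then 2 else 1 :: nat"
    obtain d e where de: "a = ?u * int d" "n = ?s * d * e"
      and sol: "solvable_pair (?u * (if even n then 2 else 1)) ?u d e"
      using locally_soluble_decomposition[OF n(3) F] by blast
    have ac: "a * c = 4 * int n ^ 2" using F by (auto simp: F_ls_def F_fam_def)
    then have a0: "a \<noteq> 0" using n by auto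
    have c: "c = (4 * int n ^ 2) div a" unfolding ac[symmetric] using a0 by simp
    have "1 * (d * e) \<le> ?s * (d * e)" by (rule mult_le_mono1) simp
    then have "d * e \<le> N" using de(2) n by (simp only: mult.assoc)
    moreover have "even a \<or> d \<noteq> 1"
    proof (rule ccontr)
      assume "\<not> (even a \<or> d \<noteq> 1)"
      then have "a = 1" using de(1) by simp
      then show False using ne ac by simp
    qed
    ultimately have "(d, e) \<in> solvable_pairs (?u * int ?s) (even a) N"
      using sol by (auto simp: solvable_pairs_def)
    then have "((even a, ?u * int ?s), (d, e)) \<in> H" by (auto simp: H_def)
    moreover have "f ((even a, ?u * int ?s), (d, e)) = g"
    proof -
      have "nat (?u * int ?s div ?u) * d * e = n" using de(2) by auto
      then show ?thesis unfolding f_def Let_def prod.case g c de(1)[symmetric] by simp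
    qed
    ultimately show "g \<in> f ` H" by force
  qed
  then have "card G \<le> card (f ` H)" using finH by (intro card_mono) auto
  also have "\<dots> \<le> card H" by (rule card_image_le[OF finH])
  also have "\<dots> = (\<Sum>p\<in>?I. card (solvable_pairs (snd p) (fst p) N))"
    unfolding H_def by (subst card_SigmaI) (auto simp: finite_solvable_pairs)
  finally have "real (card G) \<le> real (\<Sum>p\<in>?I. card (solvable_pairs (snd p) (fst p) N))" by (rule of_nat_mono)
  then have G: "real (card G) \<le> (\<Sum>p\<in>?I. real (card (solvable_pairs (snd p) (fst p) N)))"
    by (simp only: of_nat_sum)
  have "(\<Sum>n\<in>?Q. real (card (F_ls 0 (4 * int n ^ 2))))
     \<le> (\<Sum>n\<in>?Q. 1 + real (card (F_ls 0 (4 * int n ^ 2) - {(1, 4 * int n ^ 2)})))"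
  proof (rule sum_mono)
    fix n assume "n \<in> ?Q"
    then show "real (card (F_ls 0 (4 * int n ^ 2))) \<le> 1 + real (card (F_ls 0 (4 * int n ^ 2) - {(1, 4 * int n ^ 2)}))"
      using finF[of n] by (cases "(1, 4 * int n ^ 2) \<in> F_ls 0 (4 * int n ^ 2)") (auto simp: card_Diff_singleton)
  qed
  also have "\<dots> = real (card ?Q) + real (card G)"
    unfolding G_def by (subst card_SigmaI) (auto simp: sum.distrib intro: finF)
  finally show ?thesis using G by linarith
qed

section \<open>Rational points give real and p-adic points\<close>

lemma soluble_Q_imp_R: "soluble_Q a B c \<Longrightarrow> soluble_R a B c"
proof -
  assume "soluble_Q a B c"
  then obtain x y z :: rat where h: "(x, y) \<noteq> (0, 0)" "z ^ 2 = quartic_eval a B c x y"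
    by (auto simp: soluble_Q_def)
  have "(of_rat z :: real) ^ 2 = of_rat (quartic_eval a B c x y)" using h by (metis of_rat_power)
  also have "\<dots> = quartic_eval a B c (of_rat x) (of_rat y)"
    by (simp add: quartic_eval_def of_rat_add of_rat_mult of_rat_power)
  finally show ?thesis using h unfolding soluble_R_def
    by (intro exI[of _ "of_rat x"] exI[of _ "of_rat y"] exI[of _ "of_rat z"]) auto
qed

lemma padic_int_of_int: "prime p \<Longrightarrow> padic_int p (\<lambda>k. n mod p ^ k)"
  unfolding padic_int_def
  by (auto simp: prime_gt_0_int mod_mod_cancel)

text \<open>At level \<open>k = \<bar>n\<bar>\<close> the residue is nonzero, because
  \<open>p ^ k > k\<close>.\<close>

lemma of_int_padic_nonzero:
  fixes p n :: int
  assumes "prime p" "n \<noteq> 0"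
  shows "(\<lambda>k. n mod p ^ k) \<noteq> (\<lambda>_. 0)"
proof
  assume "(\<lambda>k. n mod p ^ k) = (\<lambda>_. 0)"
  then have "n mod p ^ nat \<bar>n\<bar> = 0" by meson
  then have "p ^ nat \<bar>n\<bar> dvd n" by (simp add: dvd_eq_mod_eq_0)
  then have "\<bar>p ^ nat \<bar>n\<bar>\<bar> \<le> \<bar>n\<bar>" using assms by (intro dvd_imp_le_int) auto
  moreover have "int (nat \<bar>n\<bar>) < 2 ^ nat \<bar>n\<bar>" by (rule of_nat_less_two_power)
  moreover have "(2::int) ^ nat \<bar>n\<bar> \<le> p ^ nat \<bar>n\<bar>" using prime_ge_2_int[OF assms(1)] by (intro power_mono) auto
  ultimately show False by linarith
qed

lemma soluble_Q_imp_Qp: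
  assumes "soluble_Q a 0 c" "prime p"
  shows "soluble_Qp p a 0 c"
proof -
  obtain x y z :: rat where h: "(x, y) \<noteq> (0, 0)" "z ^ 2 = of_int a * x ^ 4 + of_int c * y ^ 4"
    using assms by (auto simp: soluble_Q_def quartic_eval_def)
  obtain x1 x2 where x: "x = of_int x1 / of_int x2" "x2 > 0" by (metis quotient_of_div quotient_of_denom_pos surj_pair)
  obtain y1 y2 where y: "y = of_int y1 / of_int y2" "y2 > 0" by (metis quotient_of_div quotient_of_denom_pos surj_pair)
  obtain z1 z2 where z: "z = of_int z1 / of_int z2" "z2 > 0" by (metis quotient_of_div quotient_of_denom_pos surj_pair)
  define D where "D = x2 * y2 * z2"
  have D: "D > 0" using x y z by (simp add: D_def)
  define X Y Z where "X = x1 * y2 * z2" and "Y = y1 * x2 * z2" and "Z = z1 * x2 * y2"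
  have XYZ: "x * of_int D = of_int X" "y * of_int D = of_int Y" "z * of_int D = of_int Z"
    using x y z by (simp_all add: D_def X_def Y_def Z_def field_simps)
  \<comment> \<open>The form has degree 4, so scaling \<open>x\<close> and \<open>y\<close> by
    \<open>D\<close> scales \<open>z\<close> by \<open>D ^ 2\<close>; this gives the integral value
    \<open>Z * D\<close>, and the p-adic point can be taken with \<open>m = 0\<close>.\<close>
  have "(of_int ((Z * D) ^ 2) :: rat) = (z * of_int D * of_int D) ^ 2" by (simp add: XYZ)
  also have "\<dots> = z ^ 2 * of_int D ^ 4" by (simp add: power_mult_distrib power2_eq_square power4_eq_xxxx)
  also have "\<dots> = of_int a * (x * of_int D) ^ 4 + of_int c * (y * of_int D) ^ 4"
    unfolding h by (simp add: power_mult_distrib algebra_simps)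
  also have "\<dots> = of_int (a * X ^ 4 + c * Y ^ 4)" unfolding XYZ by simp
  finally have eq: "(Z * D) ^ 2 = a * X ^ 4 + c * Y ^ 4" by (simp only: of_int_eq_iff)
  have nz: "X \<noteq> 0 \<or> Y \<noteq> 0" using h(1) XYZ D by auto
  show ?thesis
    unfolding soluble_Qp_def
  proof (intro exI conjI allI)
    show "padic_int p (\<lambda>k. X mod p ^ k)" "padic_int p (\<lambda>k. Y mod p ^ k)" "padic_int p (\<lambda>k. (Z * D) mod p ^ k)"
      using padic_int_of_int assms by blast+
    show "(\<lambda>k. X mod p ^ k) \<noteq> (\<lambda>_. 0) \<or> (\<lambda>k. Y mod p ^ k) \<noteq> (\<lambda>_. 0)"
      using nz of_int_padic_nonzero[OF assms(2)] by blast
    fix k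
    have c1: "[(Z * D mod p ^ k) ^ 2 = (Z * D) ^ 2] (mod p ^ k)" by (intro cong_pow) (simp add: cong_def)
    have c2: "[a * (X mod p ^ k) ^ 4 + c * (Y mod p ^ k) ^ 4 = a * X ^ 4 + c * Y ^ 4] (mod p ^ k)"
      by (intro cong_add cong_mult cong_pow cong_refl) (simp_all add: cong_def)
    have "[(Z * D mod p ^ k) ^ 2 = a * (X mod p ^ k) ^ 4 + c * (Y mod p ^ k) ^ 4] (mod p ^ k)"
      by (rule cong_trans[OF c1[unfolded eq] cong_sym[OF c2]])
    then show "p ^ (2 * 0) * (Z * D mod p ^ k) ^ 2 mod p ^ k = quartic_eval a 0 c (X mod p ^ k) (Y mod p ^ k) mod p ^ k"
      by (simp add: cong_def quartic_eval_def)
  qed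
qed

lemma F_sol_subset_F_ls: "F_sol 0 M \<subseteq> F_ls 0 M"
  by (auto simp: F_sol_def F_ls_def locally_soluble_def soluble_Q_imp_R soluble_Q_imp_Qp)

lemma one_in_F_sol: "(1, M) \<in> F_sol 0 M"
proof -
  have "soluble_Q 1 0 M"
    unfolding soluble_Q_def quartic_eval_def by (intro exI[of _ 1] exI[of _ 0] exI[of _ 1]) simp
  then show ?thesis by (auto simp: F_sol_def F_fam_def)
qed

section \<open>Density of squarefree numbers and the limit\<close>

lemma card_squarefree_ge: "real (card {n\<in>{1..N}. squarefree n}) \<ge> real N / 4"
proof -
  let ?Q = "{n\<in>{1..N}. squarefree n}"
  have "{1..N} - ?Q \<subseteq> (\<Union>k\<in>{2..N}. {n\<in>{1..N}. k ^ 2 dvd n})"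
  proof
    fix n assume "n \<in> {1..N} - ?Q"
    then have n: "1 \<le> n" "n \<le> N" "\<not> squarefree n" by auto
    then obtain k where k: "k ^ 2 dvd n" "\<not> k dvd 1" by (auto simp: squarefree_def)
    have "k \<noteq> 0" using k n by (intro notI) simp
    then have "k \<ge> 2" using k by (cases "k = 1") auto
    moreover have "k \<le> k ^ 2" by (simp add: power2_eq_square)
    moreover have "k ^ 2 \<le> n" using k n by (intro dvd_imp_le) auto
    ultimately show "n \<in> (\<Union>k\<in>{2..N}. {n\<in>{1..N}. k ^ 2 dvd n})" using n k by auto
  qed
  then have "card ({1..N} - ?Q) \<le> card (\<Union>k\<in>{2..N}. {n\<in>{1..N}. k ^ 2 dvd n})" by (intro card_mono) auto
  also have "\<dots> \<le> (\<Sum>k\<in>{2..N}. card {n\<in>{1..N}. k ^ 2 dvd n})" by (rule card_UN_le) simp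
  finally have "real (card ({1..N} - ?Q)) \<le> real (\<Sum>k\<in>{2..N}. card {n\<in>{1..N}. k ^ 2 dvd n})" by (rule of_nat_mono)
  then have "real (card ({1..N} - ?Q)) \<le> (\<Sum>k\<in>{2..N}. real (card {n\<in>{1..N}. k ^ 2 dvd n}))"
    by (simp only: of_nat_sum)
  also have "\<dots> \<le> (\<Sum>k\<in>{2..N}. real N * (1 / real k ^ 2))"
  proof (rule sum_mono)
    fix k assume k: "k \<in> {2..N}"
    have "{n\<in>{1..N}. k ^ 2 dvd n} \<subseteq> (\<lambda>j. k ^ 2 * j) ` {1..N div k ^ 2}"
    proof
      fix n assume "n \<in> {n\<in>{1..N}. k ^ 2 dvd n}"
      then have n: "k ^ 2 dvd n" "1 \<le> n" "n \<le> N" by auto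
      then obtain j where j: "n = k ^ 2 * j" by (elim dvdE)
      then have "j \<ge> 1" using n by (cases j) auto
      moreover have "j \<le> N div k ^ 2" using j n k by (simp add: less_eq_div_iff_mult_less_eq mult.commute)
      ultimately show "n \<in> (\<lambda>j. k ^ 2 * j) ` {1..N div k ^ 2}" using j by auto
    qed
    then have "card {n\<in>{1..N}. k ^ 2 dvd n} \<le> card {1..N div k ^ 2}" by (rule surj_card_le[rotated]) simp
    then have "real (card {n\<in>{1..N}. k ^ 2 dvd n}) \<le> real (N div k ^ 2)" by simp
    also have "\<dots> \<le> real N / real (k ^ 2)" by (rule of_nat_div_le_of_nat)
    finally show "real (card {n\<in>{1..N}. k ^ 2 dvd n}) \<le> real N * (1 / real k ^ 2)" by simp
  qed
  also have "\<dots> = real N * (\<Sum>k\<in>{2..N}. 1 / real k ^ 2)" by (simp only: sum_distrib_left)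
  also have "\<dots> \<le> real N * (3 / 4)"
  proof (rule mult_left_mono)
    \<comment> \<open>The bound with \<open>1 / N\<close> subtracted is what telescopes; at the base
      \<open>N = 2\<close> it is the equality of 1/4 and 3/4 - 1/2.\<close>
    have "(\<Sum>k\<in>{2..N}. 1 / real k ^ 2) \<le> 3 / 4 - 1 / real N" if "N \<ge> 2"
      using that
    proof (induction N rule: dec_induct)
      case (step m)
      have "1 / real (Suc m) ^ 2 \<le> 1 / real m - 1 / real (Suc m)"
      proof -
        have "1 / real (Suc m) ^ 2 \<le> 1 / (real m * real (Suc m))"
          using step by (intro divide_left_mono) (auto simp: power2_eq_square intro!: mult_right_mono)
        also have "\<dots> = 1 / real m - 1 / real (Suc m)" using step by (simp add: field_simps)
        finally show ?thesis .
      qed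
      then show ?case using step by simp
    qed simp
    moreover have "1 / real N \<ge> 0" by simp
    ultimately show "(\<Sum>k\<in>{2..N}. 1 / real k ^ 2) \<le> 3 / 4" by (cases "N \<ge> 2") (linarith, simp)
  qed simp
  finally have "real (card ({1..N} - ?Q)) \<le> 3 / 4 * real N" by simp
  moreover have "card ({1..N} - ?Q) = card {1..N} - card ?Q" by (rule card_Diff_subset) auto
  moreover have "card ?Q \<le> card {1..N}" by (rule card_mono) auto
  ultimately show ?thesis by (simp add: of_nat_diff)
qed

theorem theorem4p2:
  shows "((\<lambda>X::real.
            real (\<Sum>n\<in>{n::nat. 0 < n \<and> real n < X \<and> squarefree n}. card (F_sol 0 (4 * int n ^ 2)))
          / real (\<Sum>n\<in>{n::nat. 0 < n \<and> real n < X \<and> squarefree n}. card (F_ls 0 (4 * int n ^ 2))))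
         \<longlongrightarrow> 1) at_top"
proof -
  define Q where "Q N = {n\<in>{1..N}. squarefree n}" for N :: nat
  define S where "S N = real (\<Sum>n\<in>Q N. card (F_sol 0 (4 * int n ^ 2)))" for N
  define L where "L N = real (\<Sum>n\<in>Q N. card (F_ls 0 (4 * int n ^ 2)))" for N
  define E where "E N = (\<Sum>p\<in>UNIV \<times> {1,2,4}. real (card (solvable_pairs (snd p) (fst p) N)))" for N
  have fin: "finite (F_ls 0 (4 * int n ^ 2))" if "n \<in> Q N" for n N
    by (rule finite_subset[OF _ finite_F_fam[of "4 * int n ^ 2" 0]]) (use that in \<open>auto simp: F_ls_def Q_def\<close>)
  have SL: "S N \<le> L N" for N
    unfolding S_def L_def of_nat_le_iff
    by (intro sum_mono card_mono fin F_sol_subset_F_ls)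
  have QS: "real (card (Q N)) \<le> S N" for N
  proof -
    have "(\<Sum>n\<in>Q N. 1) \<le> (\<Sum>n\<in>Q N. card (F_sol 0 (4 * int n ^ 2)))"
    proof (rule sum_mono)
      fix n assume n: "n \<in> Q N"
      have "finite (F_sol 0 (4 * int n ^ 2))" using F_sol_subset_F_ls fin[OF n] by (rule finite_subset)
      then have "card (F_sol 0 (4 * int n ^ 2)) > 0" using one_in_F_sol[of "4 * int n ^ 2"] by (auto simp: card_gt_0_iff)
      then show "1 \<le> card (F_sol 0 (4 * int n ^ 2))" by simp
    qed
    then show ?thesis unfolding S_def of_nat_le_iff by simp
  qed
  have LE: "L N \<le> real (card (Q N)) + E N" for N
    using sum_card_F_ls_le[of N] by (simp add: L_def E_def Q_def)
  \<comment> \<open>\<open>S N\<close> and \<open>L N\<close> both lie between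
    \<open>card (Q N)\<close> and \<open>card (Q N) + E N\<close>, so they differ by at most
    \<open>E N\<close>, while \<open>L N\<close> is at least \<open>N / 4\<close>.\<close>
  have lower: "1 - 4 * (E N / real N) \<le> S N / L N" if "N \<ge> 1" for N
  proof -
    have q: "real N / 4 \<le> real (card (Q N))" unfolding Q_def by (rule card_squarefree_ge)
    have N: "real N > 0" using that by simp
    then have L0: "L N > 0" "real N / 4 \<le> L N" using q QS[of N] SL[of N] by linarith+
    have E0: "E N \<ge> 0" by (auto simp: E_def intro: sum_nonneg)
    have "1 - S N / L N = (L N - S N) / L N" using L0 by (simp add: diff_divide_distrib)
    also have "\<dots> \<le> E N / (real N / 4)"
      using LE[of N] QS[of N] L0 N E0 by (intro frac_le) auto
    finally show ?thesis by simp
  qed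
  have upper: "S N / L N \<le> 1" for N
  proof -
    have "L N \<ge> 0" unfolding L_def by (rule of_nat_0_le_iff)
    then show ?thesis using SL[of N] by (auto simp: divide_le_eq_1)
  qed
  have "(\<lambda>N. \<Sum>p\<in>UNIV \<times> {1,2,4}. real (card (solvable_pairs (snd p) (fst p) N)) / real N) \<longlonglongrightarrow> (\<Sum>p\<in>(UNIV :: bool set) \<times> {1,2,4::int}. 0)"
    by (intro tendsto_sum solvable_pairs_density_0)
  then have "(\<lambda>N. E N / real N) \<longlonglongrightarrow> 0" by (simp add: E_def sum_divide_distrib)
  then have "(\<lambda>N. 1 - 4 * (E N / real N)) \<longlonglongrightarrow> 1 - 4 * 0" by (intro tendsto_intros)
  then have lim: "(\<lambda>N. S N / L N) \<longlonglongrightarrow> 1"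
    by (intro tendsto_sandwich[OF eventually_mono[OF eventually_ge_at_top[of 1] lower] always_eventually[OF allI[OF upper]]]) auto
  \<comment> \<open>For a positive integer, being less than \<open>X\<close> means being at most
    \<open>\<lceil>X\<rceil> - 1\<close>; the limit over integers \<open>N\<close> is transferred to
    real \<open>X\<close> through this substitution.\<close>
  have "filterlim (\<lambda>X::real. nat (\<lceil>X\<rceil> - 1)) sequentially at_top"
    unfolding filterlim_at_top
  proof
    fix Z :: nat
    show "eventually (\<lambda>X::real. Z \<le> nat (\<lceil>X\<rceil> - 1)) at_top"
      using eventually_gt_at_top[of "real Z"] by eventually_elim linarith
  qed
  then have "((\<lambda>X::real. S (nat (\<lceil>X\<rceil> - 1)) / L (nat (\<lceil>X\<rceil> - 1))) \<longlongrightarrow> 1) at_top"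
    by (rule filterlim_compose[OF lim])
  moreover have "{n::nat. 0 < n \<and> real n < X \<and> squarefree n} = Q (nat (\<lceil>X\<rceil> - 1))" for X :: real
    by (auto simp: Q_def Suc_le_eq) linarith+
  ultimately show ?thesis by (simp add: S_def L_def)
qed

end
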